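(* Consider the triangular array setting of the context: $X_{k,n}=\xi_{k,n}/b_n$, $1\le k\le a_n$, $n\ge 1$, $S_n=X_{1,n}+\dots+X_{a_n,n}$, with $\theta_n$ the characteristic function of $\xi_{1,n}$, $F_n$ the law of $X_{1,n}$, $M_n(du)=a_nu^2F_n(du)$, $\beta_n=\int_{\mathbb R}\sin u\,F_n(du)$. Assume that $\lim_{n\to\infty}P\{|X_{1,n}|\ge\varepsilon\}=0$ for every $\varepsilon>0$, and that $M_n\to M$ properly and $a_n\beta_n\to\beta$ as $n\to\infty$ for some canonical measure $M$ and some $\beta\in\mathbb R$, so that $S_n$ converges in distribution to an infinitely divisible random variable $S$ with characteristic function $\Phi=e^{-\psi}$, $\psi(z)=-i\beta z+\phi(z)$. Let $\delta>0$ be fixed and assume: (A) for every $n\ge1$ the variable $\xi_{1,n}$ possesses a density $g_n$; (B) there exist $\alpha\in(0,2)$ and $c>0$ such that $\mathrm{Re}\,\psi(z)\ge c|z|^\alpha$ for all $|z|$ large enough; (C) for every $\delta'>0$, $N(\delta'):=\sup_{n\ge1,\,|z|\ge\delta'}|\theta_n(z)|<1$; (D) $\sup_{n\ge1}\int_{\mathbb R}g_n^2(x)\,dx<\infty$; (E) $b_n\to\infty$ and $\frac{\ln b_n}{a_n}\to0$ as $n\to\infty$; (F) there exist constants $c(\delta)>0$ and $0<\kappa<2$, not depending on $n$, such that for every $n\ge1$ at least one of the following holds: (a) $a_n\int_{\mathbb R}(1-\cos(zu))\,\hat F_n(du)\ge c(\delta)|z|^\kappa$ for all $|z|\le\delta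 b_n$; (b) $\hat M\le\hat M_n$ on $\mathbb R$; (G) $\inf_{n\ge1,\,|z|\le\delta}|\mathrm{Re}\,\theta_n(z)|>0$. Fix $0<\epsilon<1$ and put $$\rho_{\epsilon,\delta}(n):=\max\left(\chi_n,\ \gamma_n',\ \gamma_n'',\ a_n^{-1},\ e^{a_n(\ln N(\delta)+\epsilon)},\ e^{-(1-\epsilon)\mathrm{Re}\,\psi(\delta b_n)}\right).$$ Then $S_n$ and $S$ possess densities $p_n(x)$ and $p(x)$, respectively, and there is a constant $C>0$ such that, for all sufficiently large $n$, $$\sup_{x\in\mathbb R}|p_n(x)-p(x)|\le C\,\rho_{\epsilon,\delta}(n).$$
   Context: Setting. $(a_n)_{n\ge1}$ is a sequence of positive integers with $a_n\to\infty$ and $(b_n)_{n\ge1}$ is a sequence of positive reals. For each $n$, $\xi_{1,n},\dots,\xi_{a_n,n}$ are i.i.d. real random variables with characteristic function $\theta_n(z)=E e^{iz\xi_{1,n}}$. Put $X_{k,n}=\xi_{k,n}/b_n$ and $S_n=X_{1,n}+\dots+X_{a_n,n}$; $F_n(du)$ is the distribution of $X_{1,n}$. The characteristic function of $S_n$ is $\Phi_n(z)=\theta_n(z/b_n)^{a_n}$. Canonical measures. A measure $M$ on $\mathbb R$ is canonical if $M(I)<\infty$ for every finite interval $I$, and $M^+(x)=\int_x^{\infty}u^{-2}M(du)<\infty$, $M^-(x)=\int_{-\infty}^{-x}u^{-2}M(du)<\infty$ for all $x>0$. Canonical measures $M_n$ converge properly to a canonical measure $M$ (written $M_n\to M$)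 if $M_n(I)\to M(I)$ for every finite interval $I$, and $M_n^+(x)\to M^+(x)$, $M_n^-(x)\to M^-(x)$ for every $x>0$. Exponents. With $M_n(du)=a_nu^2F_n(du)$ and $\beta_n=\int_{\mathbb R}\sin u\,F_n(du)$, define $$\phi(z)=\int_{\mathbb R}\frac{1-e^{izu}+iz\sin u}{u^2}M(du),\qquad \phi_n(z)=\int_{\mathbb R}\frac{1-e^{izu}+iz\sin u}{u^2}M_n(du)$$ (integrands at $u=0$ are understood as their limit $z^2/2$), and $\psi(z)=-i\beta z+\phi(z)$. The limit variable $S$ has characteristic function $\Phi(z)=e^{-\psi(z)}$. Rates: $$\gamma_n'=\sup_{z\in\mathbb R}\frac{|\mathrm{Re}\,\phi(z)-\mathrm{Re}\,\phi_n(z)|}{1+z^2},\quad \gamma_n''=\sup_{z\in\mathbb R}\frac{|\mathrm{Im}\,\phi(z)-\mathrm{Im}\,\phi_n(z)|}{1+z^2},\quad \chi_n=|a_n\beta_n-\beta|.$$ Symmetrization: for a measure $m$ on $\mathbb R$, $\hat m(A)=\frac{m(A)+m(-A)}2$ for Borel $A$. Densities are taken in the version given by Fourier inversion, $p(x)=(2\pi)^{-1}\int_{\mathbb R}e^{-izx}\Phi(z)\,dz$ and $p_n(x)=(2\pi)^{-1}\int_{\mathbb R}e^{-izx}\Phi_n(z)\,dz$ (whenever the characteristic function is integrable). *)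

theory Defs
  imports "HOL-Probability.Probability"
begin

section \<open>Canonical measures and proper convergence\<close>

text \<open>The integrals \<open>M\<^sup>+(x)\<close> and \<open>M\<^sup>-(x)\<close> are taken over the closed half-lines.\<close>

definition Mplus :: "real measure \<Rightarrow> real \<Rightarrow> ennreal" where
  "Mplus M x = (\<integral>\<^sup>+u\<in>{x..}. ennreal (1 / u\<^sup>2) \<partial>M)"

definition Mminus :: "real measure \<Rightarrow> real \<Rightarrow> ennreal" where
  "Mminus M x = (\<integral>\<^sup>+u\<in>{..-x}. ennreal (1 / u\<^sup>2) \<partial>M)"

definition canonical_measure :: "real measure \<Rightarrow> bool" where
  "canonical_measure M \<longleftrightarrow>
     sets M = sets borel \<and>
     (\<forall>I. is_interval I \<and> bounded I \<longrightarrow> emeasure M I < \<infinity>) \<and>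
     (\<forall>x>0. Mplus M x < \<infinity> \<and> Mminus M x < \<infinity>)"

definition converges_properly :: "(nat \<Rightarrow> real measure) \<Rightarrow> real measure \<Rightarrow> bool" where
  "converges_properly Ms M \<longleftrightarrow>
     (\<forall>I. is_interval I \<and> bounded I \<longrightarrow> (\<lambda>n. emeasure (Ms n) I) \<longlonglongrightarrow> emeasure M I) \<and>
     (\<forall>x>0. (\<lambda>n. Mplus (Ms n) x) \<longlonglongrightarrow> Mplus M x) \<and>
     (\<forall>x>0. (\<lambda>n. Mminus (Ms n) x) \<longlonglongrightarrow> Mminus M x)"

definition symmetrization :: "real measure \<Rightarrow> real measure" where
  "symmetrization m =
     measure_of UNIV (sets borel) (\<lambda>A. (emeasure m A + emeasure m (uminus ` A)) / 2)"

text \<open>The set function in the definition is indeed a measure:\<close>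

lemma sets_symmetrization [simp, measurable_cong]: "sets (symmetrization m) = sets borel"
  unfolding symmetrization_def
  by (metis sets.sigma_sets_eq sets.space_closed sets_measure_of space_borel)

lemma emeasure_symmetrization:
  assumes [measurable_cong]: "sets m = sets borel" and A: "A \<in> sets borel"
  shows "emeasure (symmetrization m) A = (emeasure m A + emeasure m (uminus ` A)) / 2"
proof -
  have reflect: "uminus ` B = uminus -` B" for B :: "real set"
    by (auto simp: image_iff) (metis add.inverse_inverse)
  have meas: "uminus ` B \<in> sets m" if "B \<in> sets borel" for B :: "real set"
    using measurable_sets_borel[of "uminus :: real \<Rightarrow> real" borel B] that assms(1)
    by (simp add: reflect)
  show ?thesis
    unfolding symmetrization_def
  proof (rule emeasure_measure_of_sigma)
    show "sigma_algebra UNIV (sets (borel :: real measure))"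
      using sets.sigma_algebra_axioms[of "borel :: real measure"] by simp
    show "positive (sets borel) (\<lambda>A. (emeasure m A + emeasure m (uminus ` A)) / 2)"
      by (simp add: positive_def)
    show "countably_additive (sets borel) (\<lambda>A. (emeasure m A + emeasure m (uminus ` A)) / 2)"
    proof (rule countably_additiveI)
      fix B :: "nat \<Rightarrow> real set"
      assume B: "range B \<subseteq> sets borel" "disjoint_family B"
      have "(\<Sum>i. emeasure m (B i)) = emeasure m (\<Union>i. B i)"
        using B assms(1) by (intro suminf_emeasure) auto
      moreover have "(\<Sum>i. emeasure m (uminus ` B i)) = emeasure m (\<Union>i. uminus ` B i)"
        using B meas
        by (intro suminf_emeasure) (auto simp: disjoint_family_on_def reflect)
      moreover have "(\<Union>i. uminus ` B i) = uminus ` (\<Union>i. B i)"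
        by auto
      ultimately show "(\<Sum>i. (emeasure m (B i) + emeasure m (uminus ` B i)) / 2) =
          (emeasure m (\<Union>i. B i) + emeasure m (uminus ` (\<Union>i. B i))) / 2"
        by (simp add: ennreal_suminf_divide suminf_add[symmetric])
    qed
    show "A \<in> sets borel" by (fact A)
  qed
qed

section \<open>Exponents and rates\<close>

text \<open>At \<open>u = 0\<close> the kernel is extended by its limit.\<close>

definition phi_kernel :: "real \<Rightarrow> real \<Rightarrow> complex" where
  "phi_kernel z u =
     (if u = 0 then complex_of_real (z\<^sup>2 / 2)
      else (1 - iexp (z * u) + \<i> * complex_of_real (z * sin u)) / complex_of_real (u\<^sup>2))"

definition phi :: "real measure \<Rightarrow> real \<Rightarrow> complex" where
  "phi M z = (CLINT u|M. phi_kernel z u)"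

definition psi :: "real \<Rightarrow> real measure \<Rightarrow> real \<Rightarrow> complex" where
  "psi \<beta> M z = - \<i> * complex_of_real (\<beta> * z) + phi M z"

definition gamma_Re :: "real measure \<Rightarrow> real measure \<Rightarrow> real" where
  "gamma_Re M M' = (SUP z. \<bar>Re (phi M z) - Re (phi M' z)\<bar> / (1 + z\<^sup>2))"

definition gamma_Im :: "real measure \<Rightarrow> real measure \<Rightarrow> real" where
  "gamma_Im M M' = (SUP z. \<bar>Im (phi M z) - Im (phi M' z)\<bar> / (1 + z\<^sup>2))"

section \<open>The triangular array\<close>

text \<open>
  Row \<open>n\<close> consists of the variables \<open>\<xi> k n\<close> with \<open>1 \<le> k \<le> a n\<close>, living on a probability
  space \<open>P n\<close> that may depend on the row. Only rows with \<open>n \<ge> 1\<close> are meaningful.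
\<close>

definition iid_array ::
  "(nat \<Rightarrow> 'a measure) \<Rightarrow> (nat \<Rightarrow> nat) \<Rightarrow> (nat \<Rightarrow> nat \<Rightarrow> 'a \<Rightarrow> real) \<Rightarrow> bool" where
  "iid_array P a \<xi> \<longleftrightarrow>
     (\<forall>n\<ge>1. prob_space (P n) \<and>
       (\<forall>k\<in>{1..a n}. \<xi> k n \<in> borel_measurable (P n)) \<and>
       prob_space.indep_vars (P n) (\<lambda>_. borel) (\<lambda>k. \<xi> k n) {1..a n} \<and>
       (\<forall>k\<in>{1..a n}. distr (P n) borel (\<xi> k n) = distr (P n) borel (\<xi> 1 n)))"

definition theta ::
  "(nat \<Rightarrow> 'a measure) \<Rightarrow> (nat \<Rightarrow> nat \<Rightarrow> 'a \<Rightarrow> real) \<Rightarrow> nat \<Rightarrow> real \<Rightarrow> complex" where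
  "theta P \<xi> n = char (distr (P n) borel (\<xi> 1 n))"

definition X_array ::
  "(nat \<Rightarrow> real) \<Rightarrow> (nat \<Rightarrow> nat \<Rightarrow> 'a \<Rightarrow> real) \<Rightarrow> nat \<Rightarrow> nat \<Rightarrow> 'a \<Rightarrow> real" where
  "X_array b \<xi> k n \<omega> = \<xi> k n \<omega> / b n"

definition row_sum ::
  "(nat \<Rightarrow> nat) \<Rightarrow> (nat \<Rightarrow> real) \<Rightarrow> (nat \<Rightarrow> nat \<Rightarrow> 'a \<Rightarrow> real) \<Rightarrow> nat \<Rightarrow> 'a \<Rightarrow> real" where
  "row_sum a b \<xi> n \<omega> = (\<Sum>k = 1..a n. X_array b \<xi> k n \<omega>)"

definition F_law ::
  "(nat \<Rightarrow> 'a measure) \<Rightarrow> (nat \<Rightarrow> real) \<Rightarrow> (nat \<Rightarrow> nat \<Rightarrow> 'a \<Rightarrow> real) \<Rightarrow> nat \<Rightarrow> real measure" where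
  "F_law P b \<xi> n = distr (P n) borel (X_array b \<xi> 1 n)"

definition M_array ::
  "(nat \<Rightarrow> 'a measure) \<Rightarrow> (nat \<Rightarrow> nat) \<Rightarrow> (nat \<Rightarrow> real) \<Rightarrow> (nat \<Rightarrow> nat \<Rightarrow> 'a \<Rightarrow> real) \<Rightarrow>
   nat \<Rightarrow> real measure" where
  "M_array P a b \<xi> n = density (F_law P b \<xi> n) (\<lambda>u. ennreal (real (a n) * u\<^sup>2))"

definition beta_array ::
  "(nat \<Rightarrow> 'a measure) \<Rightarrow> (nat \<Rightarrow> real) \<Rightarrow> (nat \<Rightarrow> nat \<Rightarrow> 'a \<Rightarrow> real) \<Rightarrow> nat \<Rightarrow> real" where
  "beta_array P b \<xi> n = (LINT u|F_law P b \<xi> n. sin u)"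

definition char_tail_sup :: "(nat \<Rightarrow> real \<Rightarrow> complex) \<Rightarrow> real \<Rightarrow> real" where
  "char_tail_sup \<theta> d = (SUP (n, z)\<in>{(n, z). n \<ge> 1 \<and> \<bar>z\<bar> \<ge> d}. cmod (\<theta> n z))"

definition rho ::
  "(nat \<Rightarrow> 'a measure) \<Rightarrow> (nat \<Rightarrow> nat) \<Rightarrow> (nat \<Rightarrow> real) \<Rightarrow> (nat \<Rightarrow> nat \<Rightarrow> 'a \<Rightarrow> real) \<Rightarrow>
   real measure \<Rightarrow> real \<Rightarrow> real \<Rightarrow> real \<Rightarrow> nat \<Rightarrow> real" where
  "rho P a b \<xi> M \<beta> \<epsilon> \<delta> n = Max
     {\<bar>real (a n) * beta_array P b \<xi> n - \<beta>\<bar>,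
      gamma_Re M (M_array P a b \<xi> n),
      gamma_Im M (M_array P a b \<xi> n),
      1 / real (a n),
      exp (real (a n) * (ln (char_tail_sup (theta P \<xi>) \<delta>) + \<epsilon>)),
      exp (- (1 - \<epsilon>) * Re (psi \<beta> M (\<delta> * b n)))}"

section \<open>Densities and infinite divisibility\<close>

text \<open>
  \<open>p\<close> is the version, given by Fourier inversion, of the density of the law \<open>\<mu>\<close>; this includes
  the claim that the characteristic function of \<open>\<mu>\<close> is integrable.
\<close>

definition inversion_density :: "real measure \<Rightarrow> (real \<Rightarrow> real) \<Rightarrow> bool" where
  "inversion_density \<mu> p \<longleftrightarrow>
     integrable lborel (char \<mu>) \<and>
     (\<forall>x. complex_of_real (p x) = (CLINT z|lborel. iexp (- (z * x)) * char \<mu> z) / (2 * pi)) \<and>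
     (\<forall>x. 0 \<le> p x) \<and>
     \<mu> = density lborel (\<lambda>x. ennreal (p x))"

primrec convolution_power :: "real measure \<Rightarrow> nat \<Rightarrow> real measure" where
  "convolution_power \<nu> 0 = return borel 0"
| "convolution_power \<nu> (Suc k) = convolution \<nu> (convolution_power \<nu> k)"

definition infinitely_divisible :: "real measure \<Rightarrow> bool" where
  "infinitely_divisible \<mu> \<longleftrightarrow>
     (\<forall>k\<ge>1. \<exists>\<nu>. real_distribution \<nu> \<and> convolution_power \<nu> k = \<mu>)"

end

theory Submission
  imports Defs
begin

text \<open>
  Write \<open>\<theta> n\<close> for the characteristic function of one variable of row \<open>n\<close>, and put
  \<open>w n z = a n * (1 - \<theta> n (z / b n))\<close>. The characteristic function of \<open>S\<^sub>n\<close> is then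
  \<open>(1 - w n z / a n) ^ a n\<close>, and \<open>w n z\<close> differs from the exponent \<open>\<phi>\<^sub>n z\<close> only by the centring term
  \<open>\<i> * z * a n * \<beta>\<^sub>n\<close> (\<open>phi_M_array\<close>). By the definition of the rates, \<open>w n z - \<psi> z\<close> is at most
  \<open>3 * \<rho> * (1 + z\<^sup>2)\<close>. The distance of the densities is bounded by the \<open>L\<^sup>1\<close> distance of the
  characteristic functions, which is estimated separately on \<open>\<bar>z\<bar> \<le> \<delta> * b n\<close> and on its complement.

  On \<open>\<bar>z\<bar> \<le> \<delta> * b n\<close> the power is compared with \<open>exp (- \<psi> z)\<close> one factor at a time
  (\<open>power_minus_exp_le\<close>), which gives \<open>\<bar>w n z - \<psi> z\<bar> + \<bar>\<psi> z\<bar>\<^sup>2 / a n\<close> times a decaying factor. The decay is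
  the heart of the matter. Condition (F) bounds \<open>Re (w n z)\<close> from below by a power of \<open>\<bar>z\<bar>\<close>, but this
  concerns the real part of \<open>\<theta> n\<close>, while the decay of the power depends on the modulus of \<open>\<theta> n\<close>. The two
  differ under translations: translating a law by \<open>s\<close> may change \<open>1 - Re\<close> by about \<open>s\<^sup>2 t\<^sup>2 / 2\<close> and leaves the
  modulus alone. Condition (G) forces a fixed proportion of the mass of every row into a fixed
  interval \<open>{-T..T}\<close> (\<open>char_bounded_below_imp_mass\<close>), so that the loss is at most a multiple of \<open>t\<^sup>2\<close>
  (\<open>one_minus_norm_char_ge\<close>); and condition (C) makes \<open>1 - \<bar>\<theta> n t\<bar>\<^sup>2\<close> itself at least a multiple of \<open>t\<^sup>2\<close>
  (\<open>char_quadratic_gap\<close>). Together, \<open>1 - \<bar>\<theta> n t\<bar>\<^sup>2\<close> dominates a fixed multiple of \<open>1 - Re (\<theta> n t)\<close>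
  (\<open>one_minus_Re_char_comparison\<close>).

  On \<open>\<bar>z\<bar> > \<delta> * b n\<close> the power is bounded through condition (C) and the \<open>L\<^sup>2\<close> bound that condition (D) gives
  by Plancherel's inequality; condition (E) lets \<open>exp (\<epsilon> * a n)\<close> absorb the factor \<open>b n\<close>. The limit
  \<open>exp (- \<psi> z)\<close> decays faster than any power by (B), and the quadratic gap yields \<open>a n \<le> L * (b n)\<^sup>2\<close>, so
  its tail is already \<open>O (1 / a n)\<close>.

  The limit law exists because \<open>exp (- \<psi> / k)\<close> is a continuous limit of the characteristic functions of
  \<open>a n div k\<close> summands (\<open>exp_limit_root_is_char\<close>), and for varying \<open>k\<close> the same fact gives infinite
  divisibility. Densities come from the inversion theorem \<open>exists_inversion_density\<close>.
\<close>

section \<open>Gaussian means of characteristic functions and tightness\<close>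

lemma real_distribution_distr:
  assumes "real_distribution \<mu>" "f \<in> borel_measurable borel"
  shows "real_distribution (distr \<mu> borel f)"
proof -
  interpret real_distribution \<mu> by fact
  show ?thesis using assms(2) by (intro real_distribution_distr) simp
qed

text \<open>
  Fubini's theorem for the kernel \<open>iexp (t * (y - x))\<close>: an average of one characteristic
  function against another law may be computed on either side. A Gaussian law turns oscillating
  integrals into positive ones, which is the form in which it is used throughout.
\<close>

lemma parseval_char:
  assumes "real_distribution \<mu>" "real_distribution \<nu>"
  shows "(CLINT t|\<nu>. char \<mu> t * iexp (- (t * x))) = (CLINT y|\<mu>. char \<nu> (y - x))"
proof -
  interpret M: real_distribution \<mu> by fact
  interpret N: real_distribution \<nu> by fact
  interpret pair_prob_space \<nu> \<mu> ..
  have [measurable_cong]: "sets \<mu> = sets borel" "sets \<nu> = sets borel" by auto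
  have int: "integrable (\<nu> \<Otimes>\<^sub>M \<mu>) (\<lambda>(t, y). iexp (t * (y - x)))"
    by (intro P.integrable_const_bound[where B=1]) (auto simp: split_beta simp del: of_real_diff of_real_mult)
  have "(CLINT t|\<nu>. char \<mu> t * iexp (- (t * x))) = (CLINT t|\<nu>. CLINT y|\<mu>. iexp (t * (y - x)))"
    unfolding char_def
    by (subst integral_mult_left_zero[symmetric]) (simp add: exp_add[symmetric] algebra_simps)
  also have "\<dots> = (CLINT y|\<mu>. CLINT t|\<nu>. iexp (t * (y - x)))"
    using Fubini_integral[of "\<lambda>t y. iexp (t * (y - x))"] int by simp
  also have "\<dots> = (CLINT y|\<mu>. char \<nu> (y - x))"
    by (simp add: char_def mult.commute)
  finally show ?thesis .
qed

text \<open>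
  A Gaussian weight of scale \<open>s\<close> in frequency is the positive kernel
  \<open>exp (- (s * (y - x))\<^sup>2 / 2)\<close> in space. This one identity gives tightness, a lower bound for the
  mass of a bounded interval, the square integrability estimate and the sign of the inversion
  integral.
\<close>

lemma gauss_mean_char:
  assumes "real_distribution \<mu>"
  shows "(CLINT t|std_normal_distribution. char \<mu> (s * t) * iexp (- (s * t * x)))
    = complex_of_real (LINT y|\<mu>. exp (- ((s * (y - x))\<^sup>2 / 2)))"
proof -
  interpret M: real_distribution \<mu> by fact
  interpret N: real_distribution std_normal_distribution by (rule real_dist_normal_dist)
  let ?G = "distr std_normal_distribution borel ((*) s)"
  have G: "real_distribution ?G"
    by (intro real_distribution_distr real_dist_normal_dist) auto
  have char_G: "char ?G t = complex_of_real (exp (- ((s * t)\<^sup>2 / 2)))" for t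
  proof -
    have "char ?G t = char std_normal_distribution (s * t)"
      unfolding char_def by (subst integral_distr) (auto simp: mult_ac)
    then show ?thesis by (simp add: char_std_normal_distribution)
  qed
  have "(CLINT t|std_normal_distribution. char \<mu> (s * t) * iexp (- (s * t * x)))
     = (CLINT t|?G. char \<mu> t * iexp (- (t * x)))"
    by (subst integral_distr) auto
  also have "\<dots> = (CLINT y|\<mu>. char ?G (y - x))"
    by (rule parseval_char[OF assms G])
  finally show ?thesis unfolding char_G by simp
qed

lemma gauss_mean_Re_char:
  assumes "real_distribution \<mu>"
  shows "(LINT t|std_normal_distribution. Re (char \<mu> (s * t))) = (LINT y|\<mu>. exp (- ((s * y)\<^sup>2 / 2)))"
proof -
  interpret M: real_distribution \<mu> by fact
  interpret N: real_distribution std_normal_distribution by (rule real_dist_normal_dist)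
  have int: "integrable std_normal_distribution (\<lambda>t. char \<mu> (s * t))"
    by (intro N.integrable_const_bound[where B=1]) (auto simp: M.cmod_char_le_1)
  show ?thesis
    using arg_cong[OF gauss_mean_char[OF assms, of s 0], of Re] int by simp
qed

lemma tail_le_gauss_mean:
  assumes "real_distribution \<mu>" "s > 0"
  shows "measure \<mu> {y. 1 / s \<le> \<bar>y\<bar>} \<le> 3 * (1 - (LINT t|std_normal_distribution. Re (char \<mu> (s * t))))"
proof -
  interpret M: real_distribution \<mu> by fact
  have int: "integrable \<mu> (\<lambda>y. exp (- ((s * y)\<^sup>2 / 2)))"
    by (intro M.integrable_const_bound[where B=1]) auto
  have ineq: "indicator {y. 1 / s \<le> \<bar>y\<bar>} y \<le> 3 * (1 - exp (- ((s * y)\<^sup>2 / 2)))" for y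
  proof (cases "1 / s \<le> \<bar>y\<bar>")
    case True
    then have "1 \<le> s * \<bar>y\<bar>" using assms(2) by (simp add: field_simps)
    then have "1 \<le> (s * \<bar>y\<bar>)\<^sup>2" by (simp add: one_le_power)
    then have "1 / 2 \<le> (s * y)\<^sup>2 / 2" by (simp add: power_mult_distrib)
    then have "exp (1 / 2 :: real) \<le> exp ((s * y)\<^sup>2 / 2)" by simp
    \<comment> \<open>the source of the factor \<open>3\<close>: \<open>1 - exp (- 1 / 2) \<ge> 1 / 3\<close>\<close>
    moreover have "3 / 2 \<le> exp (1 / 2 :: real)" using exp_ge_add_one_self[of "1/2::real"] by simp
    ultimately have "3 / 2 \<le> exp ((s * y)\<^sup>2 / 2)" by linarith
    then show ?thesis using True by (simp add: exp_minus field_simps)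
  qed simp
  have "measure \<mu> {y. 1 / s \<le> \<bar>y\<bar>} = (LINT y|\<mu>. indicator {y. 1 / s \<le> \<bar>y\<bar>} y)"
    by simp
  also have "\<dots> \<le> (LINT y|\<mu>. 3 * (1 - exp (- ((s * y)\<^sup>2 / 2))))"
    using int by (intro integral_mono ineq) (auto intro!: integrable_real_indicator simp: M.emeasure_eq_measure)
  also have "\<dots> = 3 * (1 - (LINT y|\<mu>. exp (- ((s * y)\<^sup>2 / 2))))"
    using int by (simp add: M.prob_space[unfolded M.space_eq_univ])
  finally show ?thesis by (simp add: gauss_mean_Re_char[OF assms(1)])
qed

text \<open>
  Continuity of \<open>\<phi>\<close> at \<open>0\<close> brings its Gaussian means of small scale close to \<open>1\<close>, which controls
  the tails of all but finitely many of the laws; the finitely many exceptions have small tails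
  individually.
\<close>

lemma char_limit_imp_tight:
  fixes \<mu> :: "nat \<Rightarrow> real measure"
  assumes \<mu>: "\<And>n. real_distribution (\<mu> n)"
    and lim: "\<And>t. (\<lambda>n. char (\<mu> n) t) \<longlonglongrightarrow> \<phi> t"
    and cont: "isCont \<phi> 0"
  shows "tight \<mu>"
proof -
  interpret M: real_distribution "\<mu> n" for n by (rule \<mu>)
  interpret N: real_distribution std_normal_distribution by (rule real_dist_normal_dist)
  let ?N = std_normal_distribution
  have \<phi>0: "\<phi> 0 = 1"
    using lim[of 0] by (simp add: M.char_zero LIMSEQ_const_iff)
  have \<phi>1: "cmod (\<phi> t) \<le> 1" for t
    using tendsto_norm[OF lim[of t]] by (rule LIMSEQ_le_const2) (auto simp: M.cmod_char_le_1)
  have [measurable]: "\<phi> \<in> borel_measurable borel"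
    by (rule borel_measurable_LIMSEQ_metric[OF _ lim]) simp
  have G_lim: "(\<lambda>k. LINT t|?N. Re (\<phi> (1 / Suc k * t))) \<longlonglongrightarrow> (LINT t|?N. 1)"
  proof (rule integral_dominated_convergence[where w="\<lambda>_. 1"])
    have "(\<lambda>k. Re (\<phi> (1 / Suc k * t))) \<longlonglongrightarrow> Re (\<phi> 0)" for t
    proof (intro tendsto_Re isCont_tendsto_compose[OF cont])
      have "(\<lambda>k. t * (1 / Suc k)) \<longlonglongrightarrow> t * 0"
        by (intro tendsto_intros LIMSEQ_Suc lim_1_over_n)
      then show "(\<lambda>k. 1 / Suc k * t) \<longlonglongrightarrow> 0" by (simp add: mult.commute)
    qed
    then show "AE t in ?N. (\<lambda>k. Re (\<phi> (1 / Suc k * t))) \<longlonglongrightarrow> 1"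
      by (simp add: \<phi>0)
    show "AE t in ?N. norm (Re (\<phi> (1 / Suc k * t))) \<le> 1" for k
      using order.trans[OF abs_Re_le_cmod \<phi>1] by auto
  qed auto
  show ?thesis unfolding tight_def
  proof (intro conjI allI impI \<mu>)
    fix \<epsilon> :: real assume \<epsilon>: "\<epsilon> > 0"
    have "\<forall>\<^sub>F k in sequentially. (LINT t|?N. Re (\<phi> (1 / Suc k * t))) > 1 - \<epsilon> / 3"
      using \<epsilon> N.prob_space by (intro order_tendstoD(1)[OF G_lim]) simp
    then obtain k where k: "(LINT t|?N. Re (\<phi> (1 / Suc k * t))) > 1 - \<epsilon> / 3"
      by (auto simp: eventually_sequentially)
    have "(\<lambda>n. LINT t|?N. Re (char (\<mu> n) (1 / Suc k * t))) \<longlonglongrightarrow> (LINT t|?N. Re (\<phi> (1 / Suc k * t)))"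
      by (rule integral_dominated_convergence[where w="\<lambda>_. 1"])
        (auto intro!: tendsto_Re lim order.trans[OF abs_Re_le_cmod M.cmod_char_le_1])
    from order_tendstoD(1)[OF this k] obtain n0 where
      n0: "\<And>n. n \<ge> n0 \<Longrightarrow> (LINT t|?N. Re (char (\<mu> n) (1 / Suc k * t))) > 1 - \<epsilon> / 3"
      by (auto simp: eventually_sequentially)
    have large: "measure (\<mu> n) {-T<..T} > 1 - \<epsilon>" if "n \<ge> n0" "T \<ge> real (Suc k)" for n and T :: real
    proof -
      have "measure (\<mu> n) {y. Suc k \<le> \<bar>y\<bar>} < \<epsilon>"
        using tail_le_gauss_mean[OF \<mu>, of "1 / Suc k" n] n0[OF that(1)] by simp
      moreover have "measure (\<mu> n) (UNIV - {y. Suc k \<le> \<bar>y\<bar>}) = 1 - measure (\<mu> n) {y. Suc k \<le> \<bar>y\<bar>}"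
        using M.prob_compl[of "{y. Suc k \<le> \<bar>y\<bar>}" n] by simp
      moreover have "measure (\<mu> n) (UNIV - {y. Suc k \<le> \<bar>y\<bar>}) \<le> measure (\<mu> n) {-T<..T}"
        using that(2) by (intro M.finite_measure_mono) auto
      ultimately show ?thesis by linarith
    qed
    have each: "\<forall>\<^sub>F T in sequentially. measure (\<mu> n) {- real T<..real T} > 1 - \<epsilon>" for n
    proof -
      have "(\<lambda>T. measure (\<mu> n) {- real T<..real T}) \<longlonglongrightarrow> measure (\<mu> n) (\<Union>T. {- real T<..real T})"
        by (rule M.finite_Lim_measure_incseq) (auto simp: incseq_def)
      then have "(\<lambda>T. measure (\<mu> n) {- real T<..real T}) \<longlonglongrightarrow> 1"
        using M.prob_space[of n] by (simp add: UN_Ioc_eq_UNIV)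
      then show ?thesis using \<epsilon> by (intro order_tendstoD(1)[of _ 1]) auto
    qed
    have "\<forall>\<^sub>F T in sequentially. (\<forall>n\<in>{..<n0}. measure (\<mu> n) {- real T<..real T} > 1 - \<epsilon>) \<and> T \<ge> Suc k"
      by (intro eventually_conj eventually_ball_finite eventually_ge_at_top ballI each) auto
    then obtain T :: nat where T: "\<And>n. n < n0 \<Longrightarrow> measure (\<mu> n) {- real T<..real T} > 1 - \<epsilon>" "T \<ge> Suc k"
      by (auto simp: eventually_sequentially)
    have "measure (\<mu> n) {- real T<..real T} > 1 - \<epsilon>" for n
      using T large[of n "real T"] by (cases "n < n0") auto
    then show "\<exists>a b. a < b \<and> (\<forall>n. measure (\<mu> n) {a<..b} > 1 - \<epsilon>)"
      using T(2) by (intro exI[of _ "- real T"] exI[of _ "real T"]) auto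
  qed
qed

text \<open>
  The existence half of the continuity theorem: tightness yields a weak limit along a
  subsequence, and its characteristic function can only be \<open>\<phi>\<close>.
\<close>

lemma char_limit_is_char:
  fixes \<mu> :: "nat \<Rightarrow> real measure"
  assumes \<mu>: "\<And>n. real_distribution (\<mu> n)"
    and lim: "\<And>t. (\<lambda>n. char (\<mu> n) t) \<longlonglongrightarrow> \<phi> t"
    and cont: "isCont \<phi> 0"
  shows "\<exists>\<nu>. real_distribution \<nu> \<and> char \<nu> = \<phi>"
proof -
  from tight_imp_convergent_subsubsequence[OF char_limit_imp_tight[OF assms], of id]
  obtain r \<nu> where r: "strict_mono (r :: nat \<Rightarrow> nat)" "real_distribution \<nu>" "weak_conv_m (\<mu> \<circ> id \<circ> r) \<nu>"
    by (auto simp: strict_mono_def)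
  have "char \<nu> t = \<phi> t" for t
  proof (rule LIMSEQ_unique)
    show "(\<lambda>n. char ((\<mu> \<circ> id \<circ> r) n) t) \<longlonglongrightarrow> char \<nu> t"
      using \<mu> r by (intro levy_continuity1) (auto simp: o_def)
    show "(\<lambda>n. char ((\<mu> \<circ> id \<circ> r) n) t) \<longlonglongrightarrow> \<phi> t"
      using LIMSEQ_subseq_LIMSEQ[OF lim r(1)] by (simp add: o_def)
  qed
  then show ?thesis using r(2) by auto
qed

section \<open>The gap between a characteristic function and the unit circle\<close>

text \<open>
  The law of \<open>x - y\<close> for independent \<open>x\<close> and \<open>y\<close>. Its characteristic function is the squared modulus
  of the original one, so that questions about moduli become questions about the non-negative
  kernel \<open>1 - cos\<close>.
\<close>

definition difference_law :: "real measure \<Rightarrow> real measure" where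
  "difference_law \<mu> = distr (\<mu> \<Otimes>\<^sub>M \<mu>) borel (\<lambda>(x, y). x - y)"

lemma real_distribution_difference_law:
  assumes "real_distribution \<mu>"
  shows "real_distribution (difference_law \<mu>)"
proof -
  interpret real_distribution \<mu> by fact
  interpret pair_prob_space \<mu> \<mu> ..
  show ?thesis unfolding difference_law_def
    by (intro P.real_distribution_distr) (auto simp: split_beta)
qed

lemma integral_difference_law:
  fixes f :: "real \<Rightarrow> 'b :: {banach, second_countable_topology}"
  assumes "real_distribution \<mu>" and [measurable]: "f \<in> borel_measurable borel"
    and bound: "\<And>x. norm (f x) \<le> B"
  shows "(LINT w|difference_law \<mu>. f w) = (LINT x|\<mu>. LINT y|\<mu>. f (x - y))"
proof -
  interpret real_distribution \<mu> by fact
  interpret pair_prob_space \<mu> \<mu> ..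
  have [measurable_cong]: "sets \<mu> = sets borel" by auto
  have "integrable (\<mu> \<Otimes>\<^sub>M \<mu>) (\<lambda>z. f (fst z - snd z))"
    by (intro P.integrable_const_bound[where B=B]) (auto simp: bound)
  from integral_fst'[OF this]
  have "(LINT x|\<mu>. LINT y|\<mu>. f (x - y)) = (LINT z|(\<mu> \<Otimes>\<^sub>M \<mu>). f (fst z - snd z))" by simp
  also have "\<dots> = (LINT w|difference_law \<mu>. f w)"
    unfolding difference_law_def by (subst integral_distr) (auto simp: split_beta)
  finally show ?thesis by simp
qed

lemma char_difference_law:
  assumes "real_distribution \<mu>"
  shows "char (difference_law \<mu>) t = complex_of_real ((cmod (char \<mu> t))\<^sup>2)"
proof -
  interpret real_distribution \<mu> by fact
  have "char (difference_law \<mu>) t = (CLINT x|\<mu>. CLINT y|\<mu>. iexp (t * (x - y)))"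
    unfolding char_def by (rule integral_difference_law[OF assms, of _ 1]) auto
  also have "\<dots> = (CLINT x|\<mu>. CLINT y|\<mu>. iexp (t * x) * cnj (iexp (t * y)))"
    by (intro Bochner_Integration.integral_cong refl)
      (simp add: exp_cnj exp_add[symmetric] algebra_simps)
  also have "\<dots> = char \<mu> t * cnj (char \<mu> t)"
    unfolding char_def by simp
  also have "\<dots> = complex_of_real ((cmod (char \<mu> t))\<^sup>2)"
    by (rule complex_norm_square[symmetric])
  finally show ?thesis .
qed

lemma cos_char:
  assumes "real_distribution \<mu>"
  shows "(LINT x|\<mu>. 1 - cos (t * x)) = 1 - Re (char \<mu> t)"
proof -
  interpret real_distribution \<mu> by fact
  have i: "integrable \<mu> (\<lambda>x. iexp (t * x))" by (rule integrable_iexp) auto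
  have "Re (char \<mu> t) = (LINT x|\<mu>. cos (t * x))"
    using integral_Re[OF i] by (simp add: char_def Re_exp)
  moreover have "integrable \<mu> (\<lambda>x. cos (t * x))"
    using integrable_Re[OF i] by (simp add: Re_exp)
  ultimately show ?thesis using prob_space by simp
qed

lemma one_minus_norm_char_square:
  assumes "real_distribution \<mu>"
  shows "1 - (cmod (char \<mu> t))\<^sup>2 = (LINT w|difference_law \<mu>. 1 - cos (t * w))"
  by (simp add: cos_char[OF real_distribution_difference_law[OF assms]] char_difference_law[OF assms])

text \<open>
  This is \<open>1 - cos (2 x) \<le> 4 (1 - cos x)\<close>, integrated.
\<close>

lemma char_doubling:
  assumes "real_distribution \<mu>"
  shows "1 - (cmod (char \<mu> (2 * t)))\<^sup>2 \<le> 4 * (1 - (cmod (char \<mu> t))\<^sup>2)"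
proof -
  interpret D: real_distribution "difference_law \<mu>" by (rule real_distribution_difference_law[OF assms])
  have int: "integrable (difference_law \<mu>) (\<lambda>w. 1 - cos (s * w))" for s
  proof (intro D.integrable_const_bound[where B=2] always_eventually allI)
    show "norm (1 - cos (s * w)) \<le> 2" for w
      using cos_le_one[of "s * w"] cos_ge_minus_one[of "s * w"] unfolding real_norm_def by linarith
  qed auto
  have "(LINT w|difference_law \<mu>. 1 - cos (2 * t * w)) \<le> (LINT w|difference_law \<mu>. 4 * (1 - cos (t * w)))"
  proof (intro integral_mono int integrable_mult_right)
    fix w
    have "1 - cos (2 * (t * w)) = 2 * (1 - cos (t * w)) * (1 + cos (t * w))"
      using cos_double_cos[of "t * w"] by (simp add: power2_eq_square algebra_simps)
    also have "\<dots> \<le> 2 * (1 - cos (t * w)) * 2"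
      by (intro mult_left_mono) auto
    finally show "1 - cos (2 * t * w) \<le> 4 * (1 - cos (t * w))" by (simp add: mult_ac)
  qed
  then show ?thesis
    unfolding one_minus_norm_char_square[OF assms] integral_mult_right_zero by simp
qed

text \<open>
  Doubling \<open>t\<close> until it leaves \<open>{-\<delta><..<\<delta>}\<close> costs a factor \<open>4\<close> per step, hence at most
  \<open>(2 * \<delta> / t)\<^sup>2\<close> altogether.
\<close>

lemma char_quadratic_gap:
  assumes \<mu>: "real_distribution \<mu>" and "\<delta> > 0" and N: "\<And>t. \<delta> \<le> \<bar>t\<bar> \<Longrightarrow> cmod (char \<mu> t) \<le> N"
    and t: "\<bar>t\<bar> \<le> \<delta>"
  shows "(1 - N\<^sup>2) / (4 * \<delta>\<^sup>2) * t\<^sup>2 \<le> 1 - (cmod (char \<mu> t))\<^sup>2"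
proof (cases "t = 0")
  case True
  interpret real_distribution \<mu> by fact
  show ?thesis using True by (simp add: char_zero)
next
  case False
  have iter: "1 - (cmod (char \<mu> (2 ^ m * t)))\<^sup>2 \<le> 4 ^ m * (1 - (cmod (char \<mu> t))\<^sup>2)" for m
  proof (induction m)
    case (Suc m)
    then show ?case using char_doubling[OF \<mu>, of "2 ^ m * t"] by (simp add: mult_ac)
  qed simp
  define P where "P m \<longleftrightarrow> \<delta> \<le> 2 ^ m * \<bar>t\<bar>" for m :: nat
  have "\<exists>m. P m"
    using real_arch_pow[of 2 "\<delta> / \<bar>t\<bar>"] False unfolding P_def
    by (auto simp: field_simps intro: less_imp_le)
  define m where "m = (LEAST m. P m)"
  have m: "\<delta> \<le> 2 ^ m * \<bar>t\<bar>"
    using LeastI_ex[OF \<open>\<exists>m. P m\<close>] unfolding P_def m_def by simp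
  have m2: "2 ^ m * \<bar>t\<bar> \<le> 2 * \<delta>"
  proof (cases m)
    case 0 then show ?thesis using t \<open>\<delta> > 0\<close> by simp
  next
    case (Suc k)
    then have "\<not> P k" using not_less_Least[of k P] unfolding m_def by simp
    then show ?thesis using Suc unfolding P_def by simp
  qed
  have four: "(2 ^ m)\<^sup>2 = (4 :: real) ^ m"
    by (simp add: power2_eq_square power_mult_distrib[symmetric])
  have "1 - N\<^sup>2 \<le> 1 - (cmod (char \<mu> (2 ^ m * t)))\<^sup>2"
    using N[of "2 ^ m * t"] m by (simp add: abs_mult power_mono)
  also have "\<dots> \<le> 4 ^ m * (1 - (cmod (char \<mu> t))\<^sup>2)" by (rule iter)
  finally have "(1 - N\<^sup>2) * t\<^sup>2 \<le> 4 ^ m * (1 - (cmod (char \<mu> t))\<^sup>2) * t\<^sup>2"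
    by (intro mult_right_mono) auto
  also have "\<dots> = (2 ^ m * \<bar>t\<bar>)\<^sup>2 * (1 - (cmod (char \<mu> t))\<^sup>2)"
    by (simp add: power_mult_distrib four)
  also have "\<dots> \<le> (2 * \<delta>)\<^sup>2 * (1 - (cmod (char \<mu> t))\<^sup>2)"
  proof -
    interpret real_distribution \<mu> by fact
    show ?thesis using m2 by (intro mult_right_mono power_mono) (auto simp: cmod_char_le_1 power_le_one)
  qed
  finally show ?thesis using \<open>\<delta> > 0\<close> by (simp add: field_simps power_mult_distrib)
qed

lemma one_minus_cos_le: "1 - cos u \<le> u\<^sup>2 / 2" for u :: real
proof -
  have "1 - cos (2 * (u / 2)) = 2 * (sin (u / 2))\<^sup>2"
    by (simp only: cos_double_sin)
  also have "\<dots> \<le> 2 * (u / 2)\<^sup>2"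
    using abs_sin_x_le_abs_x[of "u / 2"] by (simp only: abs_le_square_iff)
  finally show ?thesis by (simp add: power_divide)
qed

text \<open>
  In half angles this reads \<open>sin\<^sup>2 (s + t) \<le> 2 (sin\<^sup>2 s + sin\<^sup>2 t)\<close>.
\<close>

lemma one_minus_cos_diff:
  fixes A B :: real
  shows "(1 - cos A) / 2 - (1 - cos B) \<le> 1 - cos (A - B)"
proof -
  define s where "s = (A - B) / 2"
  define t where "t = B / 2"
  have half: "1 - cos (2 * x) = 2 * (sin x)\<^sup>2" for x :: real
    by (simp add: cos_double_sin)
  have A: "A = 2 * (s + t)" and B: "B = 2 * t" and AB: "A - B = 2 * s"
    by (simp_all add: s_def t_def field_simps)
  have "(sin (s + t))\<^sup>2 \<le> 2 * ((sin s * cos t)\<^sup>2 + (cos s * sin t)\<^sup>2)"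
    using sum_squares_bound[of "sin s * cos t" "cos s * sin t"]
    by (simp add: sin_add power2_sum)
  also have "\<dots> \<le> 2 * ((sin s)\<^sup>2 + (sin t)\<^sup>2)"
    by (simp add: power_mult_distrib abs_square_le_1 mult_left_le mult_left_le_one_le add_mono)
  finally show ?thesis unfolding A B half using AB half[of s] by (simp add: A B)
qed

text \<open>
  A translation of the law changes \<open>Re (char \<mu> t)\<close> but not the modulus, so a gap of the real part
  alone says nothing about the modulus. Writing the squared modulus as an average over
  translations by points \<open>y\<close> of the law itself and keeping only \<open>\<bar>y\<bar> \<le> T\<close>, each translation costs at
  most \<open>T\<^sup>2 * t\<^sup>2 / 2\<close>.
\<close>

lemma one_minus_norm_char_ge:
  assumes \<mu>: "real_distribution \<mu>" and T: "T \<ge> 0" and \<eta>: "\<eta> \<le> measure \<mu> {-T..T}" "0 \<le> \<eta>"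
  shows "\<eta> * ((1 - Re (char \<mu> t)) / 2 - T\<^sup>2 * t\<^sup>2 / 2) \<le> 1 - (cmod (char \<mu> t))\<^sup>2"
proof -
  interpret real_distribution \<mu> by fact
  let ?h = "(1 - Re (char \<mu> t)) / 2 - T\<^sup>2 * t\<^sup>2 / 2"
  have bd: "\<bar>1 - cos s\<bar> \<le> 2" for s :: real
    using cos_le_one[of s] cos_ge_minus_one[of s] by linarith
  have int: "integrable \<mu> (\<lambda>x. 1 - cos (f x))" if [measurable]: "f \<in> borel_measurable borel" for f :: "real \<Rightarrow> real"
    by (intro integrable_const_bound[where B=2] always_eventually) (auto simp: bd)
  have norm1: "1 - (cmod (char \<mu> t))\<^sup>2 = (LINT y|\<mu>. LINT x|\<mu>. 1 - cos (t * (y - x)))"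
    unfolding one_minus_norm_char_square[OF \<mu>]
    by (rule integral_difference_law[OF \<mu>, where B=2]) (auto simp: bd)
  have inner: "indicator {-T..T} y * ?h \<le> (LINT x|\<mu>. 1 - cos (t * (y - x)))" for y
  proof (cases "y \<in> {-T..T}")
    case True
    have "1 - cos (t * y) \<le> T\<^sup>2 * t\<^sup>2 / 2"
    proof -
      have "1 - cos (t * y) \<le> (t * y)\<^sup>2 / 2"
        by (rule one_minus_cos_le)
      also have "\<dots> \<le> (t\<^sup>2 * T\<^sup>2) / 2"
      proof -
        have "y\<^sup>2 \<le> T\<^sup>2" using True T by (auto simp: abs_le_square_iff[symmetric])
        then show ?thesis by (simp add: power_mult_distrib mult_left_mono)
      qed
      finally show ?thesis by (simp add: mult_ac)
    qed
    then have "?h \<le> (1 - Re (char \<mu> t)) / 2 - (1 - cos (t * y))" by simp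
    also have "\<dots> = (LINT x|\<mu>. (1 - cos (t * x)) / 2 - (1 - cos (t * y)))"
      using int[of "\<lambda>x. t * x"] cos_char[OF \<mu>, of t] prob_space by simp
    also have "\<dots> \<le> (LINT x|\<mu>. 1 - cos (t * (y - x)))"
    proof (intro integral_mono)
      fix x show "(1 - cos (t * x)) / 2 - (1 - cos (t * y)) \<le> 1 - cos (t * (y - x))"
        using one_minus_cos_diff[of "t * x" "t * y"] cos_minus[of "t * x - t * y"]
        by (simp add: algebra_simps)
    qed (use int[of "\<lambda>x. t * x"] int[of "\<lambda>x. t * (y - x)"] in auto)
    finally show ?thesis using True by simp
  qed simp
  have nonneg: "0 \<le> 1 - (cmod (char \<mu> t))\<^sup>2" by (simp add: cmod_char_le_1 power_le_one)
  show ?thesis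
  proof (cases "?h \<ge> 0")
    case True
    have "\<eta> * ?h \<le> measure \<mu> {-T..T} * ?h" by (rule mult_right_mono[OF \<eta>(1) True])
    also have "\<dots> = (LINT y|\<mu>. indicator {-T..T} y * ?h)" by simp
    also have "\<dots> \<le> (LINT y|\<mu>. LINT x|\<mu>. 1 - cos (t * (y - x)))"
    proof (intro integral_mono inner)
      show "integrable \<mu> (\<lambda>y. LINT x|\<mu>. 1 - cos (t * (y - x)))"
      proof (intro integrable_const_bound[where B=2] always_eventually allI)
        show "(\<lambda>y. LINT x|\<mu>. 1 - cos (t * (y - x))) \<in> borel_measurable \<mu>"
        proof -
          have [measurable_cong]: "sets \<mu> = sets borel" by simp
          show ?thesis by measurable
        qed
        fix y
        have "norm (LINT x|\<mu>. 1 - cos (t * (y - x))) \<le> (LINT x|\<mu>. norm (1 - cos (t * (y - x))))"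
          by (rule integral_norm_bound)
        also have "\<dots> \<le> (LINT x|\<mu>. 2)"
          using int[of "\<lambda>x. t * (y - x)"] by (intro integral_mono integrable_norm) (auto simp: bd)
        finally show "norm (LINT x|\<mu>. 1 - cos (t * (y - x))) \<le> 2" using prob_space by simp
      qed
    qed (auto intro!: integrable_real_indicator simp: emeasure_eq_measure)
    finally show ?thesis by (simp add: norm1)
  next
    case False
    then have "\<eta> * ?h \<le> 0" using \<eta>(2) by (simp add: mult_nonneg_nonpos)
    then show ?thesis using nonneg by linarith
  qed
qed

text \<open>
  The real part starts at \<open>1\<close> and cannot cross the gap between \<open>-g0\<close> and \<open>g0\<close>.
\<close>

lemma Re_char_bounded_below:
  assumes \<mu>: "real_distribution \<mu>" and "g0 > 0" and g0: "\<And>t. \<bar>t\<bar> \<le> \<delta> \<Longrightarrow> g0 \<le> \<bar>Re (char \<mu> t)\<bar>"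
    and t: "\<bar>t\<bar> \<le> \<delta>"
  shows "g0 \<le> Re (char \<mu> t)"
proof (rule ccontr)
  assume "\<not> g0 \<le> Re (char \<mu> t)"
  then have neg: "Re (char \<mu> t) \<le> 0" using g0[OF t] by linarith
  interpret real_distribution \<mu> by fact
  let ?I = "(\<lambda>t. Re (char \<mu> t)) ` {-\<delta>..\<delta>}"
  have "connected ?I"
    by (intro connected_continuous_image continuous_at_imp_continuous_on ballI continuous_Re isCont_char) simp
  moreover have "Re (char \<mu> t) \<in> ?I" using t by (intro image_eqI[of _ _ t]) auto
  moreover have "1 \<in> ?I" using t by (intro image_eqI[of _ _ 0]) (auto simp: char_zero)
  ultimately have "{Re (char \<mu> t)..1} \<subseteq> ?I" by (rule connected_contains_Icc)
  then have "0 \<in> ?I" using neg by auto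
  then obtain s where s: "s \<in> {-\<delta>..\<delta>}" "Re (char \<mu> s) = 0" by auto
  then have "\<bar>s\<bar> \<le> \<delta>" by (auto simp: abs_le_iff)
  from g0[OF this] show False using s \<open>g0 > 0\<close> by simp
qed

text \<open>
  The Gaussian mean of the real part, at a scale for which the Gaussian law sits almost entirely
  in \<open>{-\<delta>..\<delta>}\<close>, is not much below \<open>g0\<close>. Read in space, the same mean exceeds the mass of \<open>{-T..T}\<close> by
  at most \<open>exp (- (s * T)\<^sup>2 / 2)\<close>. The choice of \<open>T\<close> involves only \<open>\<delta>\<close> and \<open>g0\<close>, which makes the
  bound uniform over all laws.
\<close>

lemma char_bounded_below_imp_mass:
  assumes "\<delta> > 0" "g0 > 0"
  shows "\<exists>T\<ge>0. \<forall>\<mu>. real_distribution \<mu> \<longrightarrow> (\<forall>t. \<bar>t\<bar> \<le> \<delta> \<longrightarrow> g0 \<le> Re (char \<mu> t)) \<longrightarrow>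
    g0 / 4 \<le> measure \<mu> {-T..T}"
proof -
  interpret N: real_distribution std_normal_distribution by (rule real_dist_normal_dist)
  let ?N = std_normal_distribution
  have "(\<lambda>k. measure ?N {- real k..real k}) \<longlonglongrightarrow> measure ?N (\<Union>k. {- real k..real k})"
    by (rule N.finite_Lim_measure_incseq) (auto simp: incseq_def)
  moreover have "(\<Union>k. {- real k..real k}) = UNIV"
  proof -
    have "\<exists>k. x \<in> {- real k..real k}" for x
      using real_arch_simple[of "\<bar>x\<bar>"] by (simp add: abs_le_iff minus_le_iff conj_commute)
    then show ?thesis by blast
  qed
  ultimately have "(\<lambda>k. measure ?N {- real k..real k}) \<longlonglongrightarrow> 1"
    using N.prob_space by simp
  then have "\<forall>\<^sub>F k in sequentially. measure ?N {- real k..real k} > 1 - g0 / 4 \<and> k \<ge> 1"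
    using assms by (intro eventually_conj order_tendstoD(1)[of _ 1] eventually_ge_at_top) auto
  then obtain k :: nat where k: "measure ?N {- real k..real k} > 1 - g0 / 4" "k \<ge> 1"
    by (auto simp: eventually_sequentially)
  define s where "s = \<delta> / k"
  have s: "s > 0" using assms k unfolding s_def by simp
  \<comment> \<open>chosen so that \<open>exp (- (s * T)\<^sup>2 / 2) = exp (- 4 / g0) < g0 / 4\<close>\<close>
  define T where "T = sqrt (8 / g0) / s"
  have T2: "T \<ge> 0" using s assms unfolding T_def by simp
  have T1: "exp (- ((s * T)\<^sup>2 / 2)) < g0 / 4"
  proof -
    have "(s * T)\<^sup>2 / 2 = 4 / g0"
      using s assms unfolding T_def by simp
    moreover have "4 / g0 < exp (4 / g0)"
      using exp_ge_add_one_self[of "4 / g0"] by linarith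
    ultimately have "4 / g0 < exp ((s * T)\<^sup>2 / 2)" by simp
    then have "inverse (exp ((s * T)\<^sup>2 / 2)) < inverse (4 / g0)"
      using assms by (intro less_imp_inverse_less) auto
    then show ?thesis by (simp add: exp_minus)
  qed
  show ?thesis
  proof (intro exI[of _ T] conjI T2 allI impI)
    fix \<mu> assume \<mu>: "real_distribution \<mu>" and g0: "\<forall>t. \<bar>t\<bar> \<le> \<delta> \<longrightarrow> g0 \<le> Re (char \<mu> t)"
    interpret M: real_distribution \<mu> by fact
    have "g0 \<le> 1" using g0[rule_format, of 0] \<open>\<delta> > 0\<close> by (simp add: M.char_zero)
    have "(g0 + 1) * measure ?N {- real k..real k} - 1 = (LINT t|?N. (g0 + 1) * indicator {- real k..real k} t - 1)"
      using N.prob_space by (simp add: N.emeasure_eq_measure integrable_real_indicator)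
    also have "\<dots> \<le> (LINT t|?N. Re (char \<mu> (s * t)))"
    proof (intro integral_mono)
      show "integrable ?N (\<lambda>t. Re (char \<mu> (s * t)))"
        by (intro N.integrable_const_bound[where B=1]) (auto intro!: order.trans[OF abs_Re_le_cmod M.cmod_char_le_1])
      fix t
      have "- 1 \<le> Re (char \<mu> (s * t))"
        using order.trans[OF abs_Re_le_cmod M.cmod_char_le_1, of "s * t"] by linarith
      moreover have "g0 \<le> Re (char \<mu> (s * t))" if "t \<in> {- real k..real k}"
      proof (rule g0[rule_format])
        have "\<bar>t\<bar> \<le> k" using that by auto
        then show "\<bar>s * t\<bar> \<le> \<delta>"
          using k assms unfolding s_def by (simp add: abs_mult field_simps)
      qed
      ultimately show "(g0 + 1) * indicator {- real k..real k} t - 1 \<le> Re (char \<mu> (s * t))"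
        by (simp split: split_indicator)
    qed (auto simp: N.emeasure_eq_measure integrable_real_indicator)
    also have "\<dots> = (LINT y|\<mu>. exp (- ((s * y)\<^sup>2 / 2)))" by (rule gauss_mean_Re_char[OF \<mu>])
    also have "\<dots> \<le> (LINT y|\<mu>. indicator {-T..T} y + g0 / 4)"
    proof (intro integral_mono)
      show "integrable \<mu> (\<lambda>y. exp (- ((s * y)\<^sup>2 / 2)))"
        by (intro M.integrable_const_bound[where B=1]) auto
      fix y
      have "exp (- ((s * y)\<^sup>2 / 2)) \<le> g0 / 4" if "y \<notin> {-T..T}"
      proof -
        have "T\<^sup>2 \<le> y\<^sup>2" using that T2 by (auto simp: abs_le_square_iff[symmetric])
        then have "exp (- ((s * y)\<^sup>2 / 2)) \<le> exp (- ((s * T)\<^sup>2 / 2))"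
          by (simp add: power_mult_distrib mult_left_mono)
        then show ?thesis using T1 by linarith
      qed
      then show "exp (- ((s * y)\<^sup>2 / 2)) \<le> indicator {-T..T} y + g0 / 4"
        using assms by (cases "y \<in> {-T..T}") (simp_all add: add_increasing2)
    qed (auto simp: M.emeasure_eq_measure integrable_real_indicator)
    also have "\<dots> = measure \<mu> {-T..T} + g0 / 4"
      using M.prob_space by (simp add: M.emeasure_eq_measure integrable_real_indicator)
    finally have "(g0 + 1) * measure ?N {- real k..real k} - 1 \<le> measure \<mu> {-T..T} + g0 / 4" .
    moreover have "(g0 + 1) * (1 - g0 / 4) \<le> (g0 + 1) * measure ?N {- real k..real k}"
      using k(1) assms by (intro mult_left_mono) auto
    moreover have "g0 * g0 \<le> g0 * 1" using \<open>g0 \<le> 1\<close> assms by (intro mult_left_mono) auto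
    moreover have "(g0 + 1) * (1 - g0 / 4) = 1 + 3 * g0 / 4 - g0 * g0 / 4"
      by (simp add: field_simps)
    ultimately show "g0 / 4 \<le> measure \<mu> {-T..T}" by linarith
  qed
qed

section \<open>Square integrability and Fourier inversion\<close>

lemma nn_integral_std_normal_scale:
  fixes f :: "real \<Rightarrow> ennreal"
  assumes [measurable]: "f \<in> borel_measurable borel" and "T > 0"
  shows "(\<integral>\<^sup>+t. f t * ennreal (exp (- ((t / T)\<^sup>2 / 2))) \<partial>lborel)
    = ennreal (T * sqrt (2 * pi)) * (\<integral>\<^sup>+t. f (T * t) \<partial>std_normal_distribution)"
proof -
  have "(\<integral>\<^sup>+t. f t * ennreal (exp (- ((t / T)\<^sup>2 / 2))) \<partial>lborel)
    = ennreal T * (\<integral>\<^sup>+t. f (T * t) * ennreal (exp (- (t\<^sup>2 / 2))) \<partial>lborel)"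
    using \<open>T > 0\<close> by (subst nn_integral_real_affine[where c=T and t=0]) auto
  also have "(\<integral>\<^sup>+t. f (T * t) * ennreal (exp (- (t\<^sup>2 / 2))) \<partial>lborel)
    = (\<integral>\<^sup>+t. ennreal (sqrt (2 * pi)) * (ennreal (std_normal_density t) * f (T * t)) \<partial>lborel)"
  proof (intro nn_integral_cong)
    fix t
    have "exp (- (t\<^sup>2 / 2)) = sqrt (2 * pi) * std_normal_density t"
      by (simp add: std_normal_density_def)
    then show "f (T * t) * ennreal (exp (- (t\<^sup>2 / 2)))
        = ennreal (sqrt (2 * pi)) * (ennreal (std_normal_density t) * f (T * t))"
      by (simp only: ennreal_mult'' normal_density_nonneg) (simp add: mult_ac)
  qed
  also have "\<dots> = ennreal (sqrt (2 * pi)) * (\<integral>\<^sup>+t. f (T * t) \<partial>std_normal_distribution)"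
    by (simp add: nn_integral_cmult nn_integral_density)
  finally show ?thesis using \<open>T > 0\<close> by (simp add: ennreal_mult' mult.assoc)
qed

text \<open>
  One inequality of Plancherel's theorem. With a Gaussian weight of scale \<open>T\<close> the left side is a
  double integral of \<open>g x * g y\<close> against an approximate identity in \<open>x - y\<close>; the bound
  \<open>g x * g y \<le> ((g x)\<^sup>2 + (g y)\<^sup>2) / 2\<close> makes it independent of \<open>T\<close>, and Fatou's lemma removes the
  weight.
\<close>

lemma nn_integral_norm_char_square_le:
  assumes [measurable]: "g \<in> borel_measurable borel" and g: "\<And>x. 0 \<le> g x"
    and \<mu>: "\<mu> = density lborel (\<lambda>x. ennreal (g x))" "real_distribution \<mu>"
  shows "(\<integral>\<^sup>+t. ennreal ((cmod (char \<mu> t))\<^sup>2) \<partial>lborel) \<le> ennreal (2 * pi) * (\<integral>\<^sup>+x. ennreal ((g x)\<^sup>2) \<partial>lborel)"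
proof -
  interpret M: real_distribution \<mu> by fact
  interpret N: real_distribution std_normal_distribution by (rule real_dist_normal_dist)
  let ?N = std_normal_distribution
  let ?f = "\<lambda>t. ennreal ((cmod (char \<mu> t))\<^sup>2)"
  let ?E = "\<lambda>T t. ennreal (exp (- ((t / T)\<^sup>2 / 2)))"
  let ?E' = "\<lambda>T w. ennreal (exp (- ((T * w)\<^sup>2 / 2)))"
  let ?I = "\<integral>\<^sup>+x. ennreal ((g x)\<^sup>2) \<partial>lborel"
  have bound: "(\<integral>\<^sup>+t. ?f t * ?E T t \<partial>lborel) \<le> ennreal (2 * pi) * ?I" if T: "T > 0" for T
  proof -
    have E_int: "(\<integral>\<^sup>+y. ?E' T (x - y) \<partial>lborel) = ennreal (sqrt (2 * pi) / T)" for x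
    proof -
      have "(\<integral>\<^sup>+y. ?E' T (x - y) \<partial>lborel) = (\<integral>\<^sup>+w. 1 * ?E (1 / T) w \<partial>lborel)"
        by (subst nn_integral_real_affine[where c="-1" and t=x]) (auto simp: mult.commute)
      also have "\<dots> = ennreal (sqrt (2 * pi) / T)"
        using T by (subst nn_integral_std_normal_scale) (auto simp: N.emeasure_space_1[simplified])
      finally show ?thesis .
    qed
    have E_int': "(\<integral>\<^sup>+x. ?E' T (x - y) \<partial>lborel) = ennreal (sqrt (2 * pi) / T)" for y
    proof -
      have "(\<integral>\<^sup>+x. ?E' T (x - y) \<partial>lborel) = (\<integral>\<^sup>+x. ?E' T (y - x) \<partial>lborel)"
        by (intro nn_integral_cong) (simp add: power_mult_distrib power2_commute[of _ y])
      then show ?thesis by (simp add: E_int)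
    qed
    have "(\<integral>\<^sup>+t. ?f (T * t) \<partial>?N) = ennreal (LINT t|?N. Re (char (difference_law \<mu>) (T * t)))"
      by (subst nn_integral_eq_integral)
        (auto intro!: N.integrable_const_bound[where B=1] simp: char_difference_law[OF \<mu>(2)] M.cmod_char_le_1 power_le_one)
    also have "\<dots> = ennreal (LINT w|difference_law \<mu>. exp (- ((T * w)\<^sup>2 / 2)))"
      by (simp only: gauss_mean_Re_char[OF real_distribution_difference_law[OF \<mu>(2)]])
    also have "\<dots> = (\<integral>\<^sup>+w. ?E' T w \<partial>difference_law \<mu>)"
    proof -
      interpret D: real_distribution "difference_law \<mu>"
        by (rule real_distribution_difference_law[OF \<mu>(2)])
      show ?thesis
        by (subst nn_integral_eq_integral) (auto intro!: D.integrable_const_bound[where B=1])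
    qed
    also have "\<dots> = (\<integral>\<^sup>+x. \<integral>\<^sup>+y. ?E' T (x - y) \<partial>\<mu> \<partial>\<mu>)"
    proof -
      have [measurable_cong]: "sets \<mu> = sets borel" by simp
      have "(\<integral>\<^sup>+w. ?E' T w \<partial>difference_law \<mu>) = (\<integral>\<^sup>+z. ?E' T (fst z - snd z) \<partial>(\<mu> \<Otimes>\<^sub>M \<mu>))"
        unfolding difference_law_def by (subst nn_integral_distr) (auto simp: split_beta)
      also have "\<dots> = (\<integral>\<^sup>+x. \<integral>\<^sup>+y. ?E' T (x - y) \<partial>\<mu> \<partial>\<mu>)"
        by (subst M.nn_integral_fst[symmetric]) auto
      finally show ?thesis .
    qed
    also have "\<dots> = (\<integral>\<^sup>+x. \<integral>\<^sup>+y. ennreal (g x) * (ennreal (g y) * ?E' T (x - y)) \<partial>lborel \<partial>lborel)"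
      unfolding \<mu>(1) by (simp add: nn_integral_density nn_integral_cmult)
    also have "\<dots> \<le> (\<integral>\<^sup>+x. \<integral>\<^sup>+y. ennreal ((g x)\<^sup>2 / 2) * ?E' T (x - y) + ennreal ((g y)\<^sup>2 / 2) * ?E' T (x - y) \<partial>lborel \<partial>lborel)"
    proof (intro nn_integral_mono)
      fix x y
      have "g x * g y \<le> (g x)\<^sup>2 / 2 + (g y)\<^sup>2 / 2"
        using sum_squares_bound[of "g x" "g y"] by simp
      define e where "e = exp (- ((T * (x - y))\<^sup>2 / 2))"
      have e: "e \<ge> 0" unfolding e_def by simp
      have "g x * (g y * e) \<le> (g x)\<^sup>2 / 2 * e + (g y)\<^sup>2 / 2 * e"
      proof -
        have "g x * g y * e \<le> ((g x)\<^sup>2 / 2 + (g y)\<^sup>2 / 2) * e"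
          by (rule mult_right_mono[OF _ e]) fact
        then show ?thesis by (simp only: distrib_right mult.assoc)
      qed
      then have "ennreal (g x * (g y * e)) \<le> ennreal ((g x)\<^sup>2 / 2 * e + (g y)\<^sup>2 / 2 * e)"
        by (rule ennreal_leI)
      also have "\<dots> = ennreal ((g x)\<^sup>2 / 2) * ennreal e + ennreal ((g y)\<^sup>2 / 2) * ennreal e"
        using e by (subst ennreal_plus) (auto simp only: ennreal_mult'' intro!: mult_nonneg_nonneg divide_nonneg_nonneg zero_le_power2 zero_le_numeral)
      finally show "ennreal (g x) * (ennreal (g y) * ?E' T (x - y))
          \<le> ennreal ((g x)\<^sup>2 / 2) * ?E' T (x - y) + ennreal ((g y)\<^sup>2 / 2) * ?E' T (x - y)"
        unfolding e_def[symmetric] using g e by (simp only: ennreal_mult mult_nonneg_nonneg)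
    qed
    also have "\<dots> = (\<integral>\<^sup>+x. \<integral>\<^sup>+y. ennreal ((g x)\<^sup>2 / 2) * ?E' T (x - y) \<partial>lborel \<partial>lborel)
        + (\<integral>\<^sup>+x. \<integral>\<^sup>+y. ennreal ((g y)\<^sup>2 / 2) * ?E' T (x - y) \<partial>lborel \<partial>lborel)"
      by (simp add: nn_integral_add)
    also have "(\<integral>\<^sup>+x. \<integral>\<^sup>+y. ennreal ((g y)\<^sup>2 / 2) * ?E' T (x - y) \<partial>lborel \<partial>lborel)
        = (\<integral>\<^sup>+y. \<integral>\<^sup>+x. ennreal ((g y)\<^sup>2 / 2) * ?E' T (x - y) \<partial>lborel \<partial>lborel)"
      by (rule lborel_pair.Fubini') simp
    also have "(\<integral>\<^sup>+x. \<integral>\<^sup>+y. ennreal ((g x)\<^sup>2 / 2) * ?E' T (x - y) \<partial>lborel \<partial>lborel)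
        + (\<integral>\<^sup>+y. \<integral>\<^sup>+x. ennreal ((g y)\<^sup>2 / 2) * ?E' T (x - y) \<partial>lborel \<partial>lborel)
       = 2 * ((\<integral>\<^sup>+x. ennreal ((g x)\<^sup>2 / 2) \<partial>lborel) * ennreal (sqrt (2 * pi) / T))"
      by (simp add: nn_integral_cmult E_int E_int' nn_integral_multc) (simp only: mult_2)
    also have "(\<integral>\<^sup>+x. ennreal ((g x)\<^sup>2 / 2) \<partial>lborel) = ennreal (1 / 2) * ?I"
    proof -
      have "ennreal ((g x)\<^sup>2 / 2) = ennreal (1 / 2) * ennreal ((g x)\<^sup>2)" for x
        by (subst ennreal_mult[symmetric]) auto
      then show ?thesis by (simp only:) (rule nn_integral_cmult, measurable)
    qed
    also have "2 * (ennreal (1 / 2) * ?I * ennreal (sqrt (2 * pi) / T)) = ennreal (sqrt (2 * pi) / T) * ?I"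
    proof -
      have "ennreal 2 * ennreal (1 / 2) = 1"
        by (subst ennreal_mult[symmetric]) auto
      then have "2 * ennreal (1 / 2) = 1" by simp
      then have "2 * (ennreal (1 / 2) * ?I * c) = c * ?I" for c
        by (simp only: mult.assoc[symmetric]) (simp only: mult_1_left mult.commute)
      then show ?thesis .
    qed
    finally have "(\<integral>\<^sup>+t. ?f (T * t) \<partial>?N) \<le> ennreal (sqrt (2 * pi) / T) * ?I" .
    then have "ennreal (T * sqrt (2 * pi)) * (\<integral>\<^sup>+t. ?f (T * t) \<partial>?N)
        \<le> ennreal (T * sqrt (2 * pi)) * (ennreal (sqrt (2 * pi) / T) * ?I)"
      by (rule mult_left_mono) simp
    also have "\<dots> = ennreal (2 * pi) * ?I"
    proof -
      have "T * sqrt (2 * pi) * (sqrt (2 * pi) / T) = 2 * pi"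
        using T by simp
      then show ?thesis
        using T by (simp only: mult.assoc[symmetric]) (subst ennreal_mult[symmetric], auto)
    qed
    finally show ?thesis using T by (subst nn_integral_std_normal_scale) auto
  qed
  have "(\<integral>\<^sup>+t. ?f t \<partial>lborel) = (\<integral>\<^sup>+t. liminf (\<lambda>n. ?f t * ?E (real (Suc n)) t) \<partial>lborel)"
  proof (intro nn_integral_cong)
    fix t
    have "(\<lambda>n. (cmod (char \<mu> t))\<^sup>2 * exp (- ((t / real (Suc n))\<^sup>2 / 2))) \<longlonglongrightarrow> (cmod (char \<mu> t))\<^sup>2 * exp (- (0\<^sup>2 / 2))"
      by (intro tendsto_intros LIMSEQ_Suc[OF lim_const_over_n]) simp_all
    then have "(\<lambda>n. ennreal ((cmod (char \<mu> t))\<^sup>2 * exp (- ((t / real (Suc n))\<^sup>2 / 2)))) \<longlonglongrightarrow> ?f t"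
      by (intro tendsto_ennrealI) simp
    then show "?f t = liminf (\<lambda>n. ?f t * ?E (real (Suc n)) t)"
      by (intro lim_imp_Liminf[symmetric]) (simp_all add: ennreal_mult')
  qed
  also have "\<dots> \<le> liminf (\<lambda>n. \<integral>\<^sup>+t. ?f t * ?E (real (Suc n)) t \<partial>lborel)"
    by (intro nn_integral_liminf) auto
  also have "\<dots> \<le> ennreal (2 * pi) * ?I"
    by (intro Liminf_le always_eventually allI bound) auto
  finally show ?thesis .
qed

text \<open>
  The integral with an additional Gaussian weight is a positive multiple of a Gaussian mean of \<open>\<mu>\<close>;
  the weight is removed by dominated convergence.
\<close>

lemma inversion_integral_nonneg:
  assumes \<mu>: "real_distribution \<mu>" and int: "integrable lborel (char \<mu>)"
  shows "\<exists>p\<ge>0. (CLINT z|lborel. iexp (- (z * x)) * char \<mu> z) / (2 * pi) = complex_of_real p"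
proof -
  interpret M: real_distribution \<mu> by fact
  let ?I = "\<lambda>n. CLINT z|lborel. iexp (- (z * x)) * char \<mu> z * exp (- ((z / real (Suc n))\<^sup>2 / 2))"
  let ?L = "CLINT z|lborel. iexp (- (z * x)) * char \<mu> z"
  have int': "integrable lborel (\<lambda>z. norm (char \<mu> z))" using int by simp
  have lim: "?I \<longlonglongrightarrow> ?L"
  proof (rule integral_dominated_convergence[OF _ _ int'])
    show "AE z in lborel. (\<lambda>n. iexp (- (z * x)) * char \<mu> z * exp (- ((z / real (Suc n))\<^sup>2 / 2)))
        \<longlonglongrightarrow> iexp (- (z * x)) * char \<mu> z"
    proof (intro always_eventually allI)
      fix z
      have "(\<lambda>n. iexp (- (z * x)) * char \<mu> z * exp (- ((z / real (Suc n))\<^sup>2 / 2)))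
          \<longlonglongrightarrow> iexp (- (z * x)) * char \<mu> z * complex_of_real (exp (- (0\<^sup>2 / 2)))"
        by (intro tendsto_intros LIMSEQ_Suc[OF lim_const_over_n]) simp_all
      then show "(\<lambda>n. iexp (- (z * x)) * char \<mu> z * exp (- ((z / real (Suc n))\<^sup>2 / 2)))
          \<longlonglongrightarrow> iexp (- (z * x)) * char \<mu> z" by simp
    qed
  qed (auto simp: norm_mult mult_left_le)
  have gauss: "?I n = complex_of_real (Suc n * sqrt (2 * pi) * (LINT y|\<mu>. exp (- ((Suc n * (y - x))\<^sup>2 / 2))))" for n
  proof -
    let ?T = "real (Suc n)"
    have "?I n = ?T *\<^sub>R (CLINT t|lborel. iexp (- (?T * t * x)) * char \<mu> (?T * t) * exp (- (t\<^sup>2 / 2)))"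
      by (subst lborel_integral_real_affine[where c="?T" and t=0]) auto
    also have "\<dots> = ?T *\<^sub>R (CLINT t|lborel. sqrt (2 * pi) * (std_normal_density t *\<^sub>R (char \<mu> (?T * t) * iexp (- (?T * t * x)))))"
      by (intro arg_cong[where f="(*\<^sub>R) ?T"] Bochner_Integration.integral_cong refl)
        (simp add: std_normal_density_def scaleR_conv_of_real)
    also have "\<dots> = ?T *\<^sub>R (sqrt (2 * pi) * (CLINT t|std_normal_distribution. char \<mu> (?T * t) * iexp (- (?T * t * x))))"
      by (simp only: integral_mult_right_zero) (subst integral_density, auto simp: normal_density_nonneg)
    finally show ?thesis
      unfolding gauss_mean_char[OF \<mu>] by (simp only: scaleR_conv_of_real of_real_mult mult.assoc)
  qed
  have "0 \<le> Re (?I n)" for n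
    unfolding gauss Re_complex_of_real by (intro mult_nonneg_nonneg integral_nonneg) auto
  moreover have "Im (?I n) = 0" for n
    unfolding gauss Im_complex_of_real ..
  ultimately have "0 \<le> Re ?L" "Im ?L = 0"
    using LIMSEQ_le_const[OF tendsto_Re[OF lim], of 0] tendsto_Im[OF lim]
    by (blast, simp only: LIMSEQ_const_iff)
  then show ?thesis
    by (intro exI[of _ "Re ?L / (2 * pi)"]) (auto simp: complex_eq_iff)
qed

lemma Levy_difference_quotient_integral:
  assumes "a \<le> b" "t \<noteq> 0"
  shows "(CLINT x|lborel. indicator {a..b} x *\<^sub>R iexp (- (t * x))) = (iexp (- (t * a)) - iexp (- (t * b))) / (\<i> * t)"
proof -
  let ?F = "\<lambda>z :: complex. (\<i> / complex_of_real t) * exp (- (\<i> * (complex_of_real t * z)))"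
  have "(CLINT x|lborel. indicator {a..b} x *\<^sub>R iexp (- (t * x))) = ?F (complex_of_real b) - ?F (complex_of_real a)"
  proof (rule integral_FTC_Icc[OF \<open>a \<le> b\<close>])
    fix x
    have "(?F has_field_derivative iexp (- (t * x))) (at (complex_of_real x))"
      using \<open>t \<noteq> 0\<close> by (auto intro!: derivative_eq_intros)
    then show "((\<lambda>x. ?F (complex_of_real x)) has_vector_derivative iexp (- (t * x))) (at x within {a..b})"
      by (rule has_vector_derivative_real_field)
  qed (intro continuous_intros)
  also have "\<dots> = (iexp (- (t * a)) - iexp (- (t * b))) / (\<i> * t)"
  proof -
    have "(\<i> / t) * B - (\<i> / t) * A = (A - B) / (\<i> * t)" for A B :: complex
    proof -
      have "(A - B) / (\<i> * t) = (A - B) / \<i> / t" by (simp only: divide_divide_eq_left)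
      also have "(A - B) / \<i> = - (\<i> * (A - B))" by simp
      finally show ?thesis by (simp add: algebra_simps diff_divide_distrib)
    qed
    from this[of "exp (- (\<i> * (t * b)))" "exp (- (\<i> * (t * a)))"] show ?thesis by simp
  qed
  finally show ?thesis .
qed

text \<open>
  For an integrable characteristic function the principal value in Levy's inversion formula is an
  ordinary integral, and the difference quotient in it is an integral over \<open>{a..b}\<close> that may be
  pulled outside.
\<close>

lemma measure_Ioc_eq_inversion_integral:
  assumes \<mu>: "real_distribution \<mu>" and int: "integrable lborel (char \<mu>)"
    and p: "\<And>x. (CLINT z|lborel. iexp (- (z * x)) * char \<mu> z) / (2 * pi) = complex_of_real (p x)"
    and ab: "a \<le> b" "measure \<mu> {a} = 0" "measure \<mu> {b} = 0"
  shows "measure \<mu> {a<..b} = (LINT x|lborel. indicator {a..b} x * p x)"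
proof -
  interpret M: real_distribution \<mu> by fact
  let ?F = "\<lambda>t. (iexp (- (t * a)) - iexp (- (t * b))) / (\<i> * t)"
  have F_le: "norm (?F t) \<le> b - a" for t
  proof (cases "t = 0")
    case False
    have "norm (?F t) = cmod ((iexp (- t * b) - iexp (- t * a)) / (\<i> * complex_of_real (- t)))"
      unfolding norm_divide norm_mult by (simp add: norm_minus_commute)
    then show ?thesis using Levy_Inversion_aux2[of a b "- t"] ab(1) False by simp
  qed (use ab in simp)
  have int': "integrable lborel (\<lambda>t. (b - a) * norm (char \<mu> t))" using int by simp
  have conv: "(\<lambda>T. CLBINT t=- real T..real T. ?F t * char \<mu> t) \<longlonglongrightarrow> (CLINT t|lborel. ?F t * char \<mu> t)"
  proof -
    have "(\<lambda>T. CLINT t|lborel. indicator {- real T<..<real T} t *\<^sub>R (?F t * char \<mu> t)) \<longlonglongrightarrow> (CLINT t|lborel. ?F t * char \<mu> t)"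
    proof (rule integral_dominated_convergence[OF _ _ int'])
      show "AE t in lborel. (\<lambda>T. indicator {- real T<..<real T} t *\<^sub>R (?F t * char \<mu> t)) \<longlonglongrightarrow> ?F t * char \<mu> t"
      proof (rule AE_I2, rule tendsto_eventually)
        fix t
        obtain k where "\<bar>t\<bar> < real k" using reals_Archimedean2 by blast
        then show "\<forall>\<^sub>F T in sequentially. indicator {- real T<..<real T} t *\<^sub>R (?F t * char \<mu> t) = ?F t * char \<mu> t"
          by (intro eventually_sequentiallyI[of k]) (auto simp: indicator_def)
      qed
      show "AE t in lborel. norm (indicator {- real T<..<real T} t *\<^sub>R (?F t * char \<mu> t)) \<le> (b - a) * norm (char \<mu> t)" for T
      proof (rule AE_I2)
        fix t
        have "norm (indicator {- real T<..<real T} t *\<^sub>R (?F t * char \<mu> t)) \<le> norm (?F t * char \<mu> t)"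
          by (cases "t \<in> {- real T<..<real T}") simp_all
        also have "\<dots> \<le> (b - a) * norm (char \<mu> t)"
          unfolding norm_mult by (intro mult_right_mono F_le) simp
        finally show "norm (indicator {- real T<..<real T} t *\<^sub>R (?F t * char \<mu> t)) \<le> (b - a) * norm (char \<mu> t)" .
      qed
    qed auto
    then show ?thesis
      by (simp add: interval_lebesgue_integral_def set_lebesgue_integral_def einterval_eq)
  qed
  have pair: "integrable (lborel \<Otimes>\<^sub>M lborel) (\<lambda>(t, x). char \<mu> t * (indicator {a..b} x *\<^sub>R iexp (- (t * x))))"
  proof -
    have "integrable (lborel \<Otimes>\<^sub>M lborel) (\<lambda>(t, x). char \<mu> t * complex_of_real (indicator {a..b} x))"
    proof (rule lborel_pair.Fubini_integrable)
      show "integrable lborel (\<lambda>t. LINT x|lborel. norm (case (t, x) of (t, x) \<Rightarrow> char \<mu> t * complex_of_real (indicator {a..b} x)))"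
        using int by (simp add: norm_mult)
    qed (use ab in auto)
    then show ?thesis
      by (rule Bochner_Integration.integrable_bound)
        (auto simp: split_beta norm_mult indicator_def intro!: always_eventually)
  qed
  have "(CLINT t|lborel. ?F t * char \<mu> t) = (CLINT t|lborel. CLINT x|lborel. char \<mu> t * (indicator {a..b} x *\<^sub>R iexp (- (t * x))))"
  proof (intro integral_cong_AE)
    show "AE t in lborel. ?F t * char \<mu> t = (CLINT x|lborel. char \<mu> t * (indicator {a..b} x *\<^sub>R iexp (- (t * x))))"
      using AE_lborel_singleton[of 0]
      by eventually_elim
        (simp only: integral_mult_right_zero Levy_difference_quotient_integral[OF ab(1)] simp_thms, rule mult.commute)
    show "(\<lambda>t. CLINT x|lborel. char \<mu> t * (indicator {a..b} x *\<^sub>R iexp (- (t * x)))) \<in> borel_measurable lborel"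
      by (measurable)
  qed auto
  also have "\<dots> = (CLINT x|lborel. CLINT t|lborel. char \<mu> t * (indicator {a..b} x *\<^sub>R iexp (- (t * x))))"
    using lborel_pair.Fubini_integral[OF pair] by simp
  also have "\<dots> = (CLINT x|lborel. 2 * pi * complex_of_real (indicator {a..b} x * p x))"
  proof (intro Bochner_Integration.integral_cong refl)
    fix x
    have "(CLINT t|lborel. char \<mu> t * (indicator {a..b} x *\<^sub>R iexp (- (t * x))))
        = indicator {a..b} x * (CLINT t|lborel. iexp (- (t * x)) * char \<mu> t)"
      by (cases "x \<in> {a..b}") (simp_all add: mult.commute)
    also have "(CLINT t|lborel. iexp (- (t * x)) * char \<mu> t) = 2 * pi * complex_of_real (p x)"
      using p[of x] by (simp add: field_simps)
    finally show "(CLINT t|lborel. char \<mu> t * (indicator {a..b} x *\<^sub>R iexp (- (t * x))))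
        = 2 * pi * complex_of_real (indicator {a..b} x * p x)"
      by (simp add: indicator_def)
  qed
  also have "\<dots> = 2 * pi * complex_of_real (LINT x|lborel. indicator {a..b} x * p x)"
    by (simp only: integral_mult_right_zero integral_complex_of_real)
  finally have "(\<lambda>T. 1 / (2 * pi) * (CLBINT t=- real T..real T. ?F t * char \<mu> t))
      \<longlonglongrightarrow> 1 / (2 * pi) * (2 * pi * complex_of_real (LINT x|lborel. indicator {a..b} x * p x))"
    using conv by (intro tendsto_intros) simp
  moreover have "(\<lambda>T. 1 / (2 * pi) * (CLBINT t=- real T..real T. ?F t * char \<mu> t))
      \<longlonglongrightarrow> complex_of_real (measure \<mu> {a<..b})"
    using M.Levy_Inversion[OF ab] by simp
  ultimately have "complex_of_real (1 / (2 * pi)) * (2 * pi * complex_of_real (LINT x|lborel. indicator {a..b} x * p x))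
      = complex_of_real (measure \<mu> {a<..b})"
    by (rule LIMSEQ_unique)
  then have "complex_of_real (LINT x|lborel. indicator {a..b} x * p x) = complex_of_real (measure \<mu> {a<..b})"
    by simp
  then show ?thesis by (simp only: of_real_eq_iff)
qed

text \<open>
  The inversion integral is bounded by some \<open>K\<close>, so an interval of length \<open>h\<close> with atomless
  endpoints has mass at most \<open>K * h\<close>. Shrinking such intervals around a point excludes atoms
  altogether, and then the inversion formula holds for every interval.
\<close>

lemma exists_inversion_density:
  assumes \<mu>: "real_distribution \<mu>" and int: "integrable lborel (char \<mu>)"
  shows "\<exists>p. inversion_density \<mu> p"
proof -
  interpret M: real_distribution \<mu> by fact
  obtain p where p0: "\<And>x. 0 \<le> p x"
    and p: "\<And>x. (CLINT z|lborel. iexp (- (z * x)) * char \<mu> z) / (2 * pi) = complex_of_real (p x)"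
    using inversion_integral_nonneg[OF assms] by metis
  define K where "K = (LINT z|lborel. norm (char \<mu> z)) / (2 * pi)"
  have p_eq: "p x = Re ((CLINT z|lborel. iexp (- (z * x)) * char \<mu> z) / (2 * pi))" for x
    by (simp only: p Re_complex_of_real)
  have [measurable]: "p \<in> borel_measurable borel"
    unfolding p_eq[abs_def] by measurable
  have p_le: "p x \<le> K" for x
  proof -
    have "p x = norm ((CLINT z|lborel. iexp (- (z * x)) * char \<mu> z) / (2 * pi))"
      unfolding p norm_of_real using p0[of x] by simp
    also have "\<dots> \<le> (LINT z|lborel. norm (iexp (- (z * x)) * char \<mu> z)) / (2 * pi)"
      by (simp add: norm_divide divide_right_mono integral_norm_bound)
    finally show ?thesis by (simp add: K_def norm_mult)
  qed
  have p_int: "integrable lborel (\<lambda>x. indicator {a..b} x * p x)" for a b :: real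
  proof (rule Bochner_Integration.integrable_bound[where f="\<lambda>x. indicator {a..b} x * K"])
    show "integrable lborel (\<lambda>x. indicator {a..b} x * K)" by (cases "a \<le> b") auto
    show "AE x in lborel. norm (indicator {a..b} x * p x) \<le> norm (indicator {a..b} x * K)"
      using p0 p_le order.trans[OF p0 p_le] by (intro always_eventually) (auto simp: indicator_def abs_mult)
  qed auto
  define G where "G b = (LINT x|lborel. indicator {0..b} x * p x) - (LINT x|lborel. indicator {b..0} x * p x)" for b
  have countable: "countable {x. measure \<mu> {x} \<noteq> 0}"
    by (rule M.countable_support)
  have no_atom_between: "\<exists>c. a < c \<and> c < b \<and> measure \<mu> {c} = 0" if "a < b" for a b :: real
    using uncountable_open_interval[of a b] that countable
    by (metis (mono_tags, lifting) countable_subset greaterThanLessThan_iff mem_Collect_eq subsetI)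
  have no_atoms: "measure \<mu> {x} = 0" for x
  proof (rule ccontr)
    assume "measure \<mu> {x} \<noteq> 0"
    then have pos: "0 < measure \<mu> {x}" by (simp add: zero_less_measure_iff)
    define e where "e = measure \<mu> {x} / (4 * (\<bar>K\<bar> + 1))"
    have e: "e > 0" using pos unfolding e_def by simp
    obtain c where c: "x - e < c" "c < x" "measure \<mu> {c} = 0"
      using no_atom_between[of "x - e" x] e by auto
    obtain d where d: "x < d" "d < x + e" "measure \<mu> {d} = 0"
      using no_atom_between[of x "x + e"] e by auto
    have "measure \<mu> {x} \<le> measure \<mu> {c<..d}"
      using c d by (intro M.finite_measure_mono) auto
    also have "\<dots> = (LINT y|lborel. indicator {c..d} y * p y)"
      using c d by (intro measure_Ioc_eq_inversion_integral[OF \<mu> int p]) auto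
    also have "\<dots> \<le> (LINT y|lborel. indicator {c..d} y * K)"
      using c d by (intro integral_mono p_int mult_left_mono p_le) auto
    also have "\<dots> = (d - c) * K" using c d by simp
    also have "\<dots> \<le> (2 * e) * (\<bar>K\<bar> + 1)"
      using c d order.trans[OF p0 p_le] by (intro mult_mono) auto
    also have "\<dots> = measure \<mu> {x} / 2" unfolding e_def by (simp add: field_simps)
    finally show False using pos by simp
  qed
  have Ioc: "emeasure \<mu> {a<..b} = emeasure (density lborel (\<lambda>x. ennreal (p x))) {a<..b}" if "a \<le> b" for a b
  proof -
    have "emeasure \<mu> {a<..b} = ennreal (LINT x|lborel. indicator {a..b} x * p x)"
      using that by (simp add: M.emeasure_eq_measure measure_Ioc_eq_inversion_integral[OF \<mu> int p] no_atoms)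
    also have "\<dots> = (\<integral>\<^sup>+x. ennreal (indicator {a..b} x * p x) \<partial>lborel)"
      using p0 by (intro nn_integral_eq_integral[symmetric] p_int) auto
    also have "\<dots> = (\<integral>\<^sup>+x. ennreal (p x) * indicator {a<..b} x \<partial>lborel)"
      using AE_lborel_singleton[of a]
      by (intro nn_integral_cong_AE, eventually_elim) (auto simp: indicator_def)
    finally show ?thesis by (simp add: emeasure_density)
  qed
  have "\<mu> = density lborel (\<lambda>x. ennreal (p x))"
  proof (rule measure_eqI_generator_eq[where \<Omega>=UNIV and E="range (\<lambda>(a, b). {a<..b::real})" and A="\<lambda>i. {- real i<..real i}"])
    show "Int_stable (range (\<lambda>(a, b). {a<..b::real}))"
      by (auto simp: Int_stable_def)
    show "emeasure \<mu> X = emeasure (density lborel (\<lambda>x. ennreal (p x))) X"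
      if X_range: "X \<in> range (\<lambda>(a, b). {a<..b})" for X
    proof -
      obtain a b where X: "X = {a<..b}" using X_range by auto
      show ?thesis using Ioc[of a b] unfolding X by (cases "a \<le> b") auto
    qed
    show "sets \<mu> = sigma_sets UNIV (range (\<lambda>(a, b). {a<..b}))"
      by (simp add: borel_sigma_sets_Ioc)
    show "sets (density lborel (\<lambda>x. ennreal (p x))) = sigma_sets UNIV (range (\<lambda>(a, b). {a<..b}))"
      by (simp add: borel_sigma_sets_Ioc)
    show "(\<Union>i. {- real i<..real i}) = UNIV" by (rule UN_Ioc_eq_UNIV)
  qed (auto simp: M.emeasure_eq_measure)
  then show ?thesis
    unfolding inversion_density_def using p p0 int by (intro exI[of _ p]) auto
qed

section \<open>Canonical measures and their exponents\<close>

text \<open>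
  Canonical measures integrate this function, and up to the factor \<open>3 * (1 + z\<^sup>2)\<close> it dominates the
  kernel of the exponent.
\<close>

definition levy_weight :: "real \<Rightarrow> real" where
  "levy_weight u = (if \<bar>u\<bar> \<le> 1 then 1 else 1 / u\<^sup>2)"

lemma levy_weight_nonneg: "0 \<le> levy_weight u"
  by (simp add: levy_weight_def)

lemma levy_weight_le_1: "levy_weight u \<le> 1"
proof -
  have "1 \<le> u\<^sup>2" if "\<not> \<bar>u\<bar> \<le> 1"
    using one_le_power[of "\<bar>u\<bar>" 2] that by simp
  then show ?thesis by (simp add: levy_weight_def)
qed

lemma levy_weight_measurable [measurable]: "levy_weight \<in> borel_measurable borel"
  unfolding levy_weight_def[abs_def] by measurable

lemma phi_kernel_measurable [measurable]: "phi_kernel z \<in> borel_measurable borel"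
  unfolding phi_kernel_def[abs_def] by measurable

lemma abs_sin_minus_id_le_square: "\<bar>sin u - u\<bar> \<le> u\<^sup>2 / 2" for u :: real
proof -
  have "\<bar>Im (iexp u - (\<Sum>k\<le>1. (\<i> * u) ^ k / fact k))\<bar> \<le> \<bar>u\<bar> ^ Suc 1 / fact (Suc 1)"
    by (rule order.trans[OF abs_Im_le_cmod iexp_approx1])
  then show ?thesis by (simp add: Im_exp power2_eq_square abs_mult[symmetric])
qed

lemma abs_sin_minus_id_le_cube: "\<bar>sin u - u\<bar> \<le> \<bar>u\<bar> ^ 3 / 6" for u :: real
proof -
  have "\<bar>Im (iexp u - (\<Sum>k\<le>2. (\<i> * u) ^ k / fact k))\<bar> \<le> \<bar>u\<bar> ^ Suc 2 / fact (Suc 2)"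
    by (rule order.trans[OF abs_Im_le_cmod iexp_approx1])
  then show ?thesis by (simp add: Im_exp numeral_2_eq_2 numeral_3_eq_3 fact_numeral power2_eq_square)
qed

text \<open>
  The term \<open>z * sin u\<close> cancels the linear part of \<open>iexp (z * u)\<close> up to second order.
\<close>

lemma norm_phi_kernel_near:
  "cmod (1 - iexp (z * u) + \<i> * complex_of_real (z * sin u)) \<le> (1 + z\<^sup>2) * u\<^sup>2"
proof -
  have e: "cmod (iexp (z * u) - (1 + \<i> * complex_of_real (z * u))) \<le> (z * u)\<^sup>2 / 2"
    using iexp_approx1[of "z * u" 1] by (simp add: power2_eq_square abs_mult[symmetric] del: of_real_mult)
  have "1 - iexp (z * u) + \<i> * complex_of_real (z * sin u)
     = \<i> * complex_of_real (z * (sin u - u)) - (iexp (z * u) - (1 + \<i> * complex_of_real (z * u)))"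
    by (simp add: algebra_simps)
  then have "cmod (1 - iexp (z * u) + \<i> * complex_of_real (z * sin u))
     \<le> cmod (\<i> * complex_of_real (z * (sin u - u))) + (z * u)\<^sup>2 / 2"
    by (simp only:) (rule order.trans[OF norm_triangle_ineq4 add_left_mono[OF e]])
  also have "cmod (\<i> * complex_of_real (z * (sin u - u))) = \<bar>z\<bar> * \<bar>sin u - u\<bar>"
    by (simp only: norm_mult norm_of_real abs_mult) simp
  also have "\<dots> \<le> \<bar>z\<bar> * (u\<^sup>2 / 2)"
    by (intro mult_left_mono abs_sin_minus_id_le_square) simp
  also have "\<bar>z\<bar> * (u\<^sup>2 / 2) + (z * u)\<^sup>2 / 2 = (\<bar>z\<bar> + z\<^sup>2) / 2 * u\<^sup>2"
    by (simp add: power_mult_distrib field_simps)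
  also have "\<dots> \<le> (1 + z\<^sup>2) * u\<^sup>2"
  proof (rule mult_right_mono)
    have "2 * \<bar>z\<bar> \<le> 1 + \<bar>z\<bar>\<^sup>2" using sum_squares_bound[of 1 "\<bar>z\<bar>"] by simp
    then show "(\<bar>z\<bar> + z\<^sup>2) / 2 \<le> 1 + z\<^sup>2" by simp
  qed simp
  finally show ?thesis by simp
qed

lemma norm_phi_kernel_far:
  "cmod (1 - iexp (z * u) + \<i> * complex_of_real (z * sin u)) \<le> 3 * (1 + z\<^sup>2)"
proof -
  have "cmod (1 - iexp (z * u) + \<i> * complex_of_real (z * sin u))
      \<le> cmod 1 + cmod (iexp (z * u)) + cmod (\<i> * complex_of_real (z * sin u))"
    by (rule order.trans[OF norm_triangle_ineq add_right_mono[OF norm_triangle_ineq4]])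
  also have "\<dots> = 2 + \<bar>z\<bar> * \<bar>sin u\<bar>"
    by (simp only: norm_mult norm_of_real abs_mult norm_exp_i_times) simp
  also have "\<dots> \<le> 2 + \<bar>z\<bar> * 1"
    by (intro add_left_mono mult_left_mono) auto
  also have "\<dots> \<le> 3 + z\<^sup>2"
    using sum_squares_bound[of 1 "\<bar>z\<bar>"] abs_ge_zero[of z] by simp
  also have "\<dots> \<le> 3 * (1 + z\<^sup>2)" by simp
  finally show ?thesis .
qed

lemma norm_phi_kernel_le: "cmod (phi_kernel z u) \<le> 3 * (1 + z\<^sup>2) * levy_weight u"
proof (cases "u = 0")
  case True
  have "z\<^sup>2 / 2 \<le> 3 * (1 + z\<^sup>2)" by simp
  then show ?thesis using True by (simp add: phi_kernel_def levy_weight_def norm_power)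
next
  case False
  have eq: "cmod (phi_kernel z u) = cmod (1 - iexp (z * u) + \<i> * complex_of_real (z * sin u)) / u\<^sup>2"
    using False by (simp add: phi_kernel_def norm_divide norm_power)
  show ?thesis
  proof (cases "\<bar>u\<bar> \<le> 1")
    case True
    have "cmod (phi_kernel z u) \<le> (1 + z\<^sup>2) * u\<^sup>2 / u\<^sup>2"
      unfolding eq by (intro divide_right_mono norm_phi_kernel_near) simp
    also have "\<dots> \<le> 3 * (1 + z\<^sup>2)" using False by simp
    finally show ?thesis using True by (simp add: levy_weight_def)
  next
    case F: False
    have "cmod (phi_kernel z u) \<le> 3 * (1 + z\<^sup>2) / u\<^sup>2"
      unfolding eq by (intro divide_right_mono norm_phi_kernel_far) simp
    then show ?thesis using F by (simp add: levy_weight_def)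
  qed
qed

text \<open>
  Continuity at \<open>0\<close> matters: canonical measures that converge properly may concentrate near the
  origin, as they do for a Gaussian limit.
\<close>

lemma isCont_phi_kernel: "isCont (phi_kernel z) u"
proof (cases "u = 0")
  case False
  have "isCont (\<lambda>u. (1 - iexp (z * u) + \<i> * complex_of_real (z * sin u)) / complex_of_real (u\<^sup>2)) u"
    using False by (intro continuous_intros) auto
  moreover have "\<forall>\<^sub>F v in nhds u. phi_kernel z v = (1 - iexp (z * v) + \<i> * complex_of_real (z * sin v)) / complex_of_real (v\<^sup>2)"
    using t1_space_nhds[OF False] by eventually_elim (simp add: phi_kernel_def)
  ultimately show ?thesis by (subst isCont_cong) auto
next
  case True
  have bound: "cmod (phi_kernel z v - phi_kernel z 0) \<le> (\<bar>z\<bar> ^ 3 + \<bar>z\<bar>) / 6 * \<bar>v\<bar>" if "v \<noteq> 0" for v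
  proof -
    have e: "cmod (iexp (z * v) - (1 + \<i> * complex_of_real (z * v) - complex_of_real ((z * v)\<^sup>2 / 2))) \<le> \<bar>z * v\<bar> ^ 3 / 6"
      using iexp_approx1[of "z * v" 2]
      by (simp add: numeral_2_eq_2 numeral_3_eq_3 fact_numeral power_mult_distrib algebra_simps)
    have "phi_kernel z v - phi_kernel z 0
       = (\<i> * complex_of_real (z * (sin v - v)) - (iexp (z * v) - (1 + \<i> * complex_of_real (z * v) - complex_of_real ((z * v)\<^sup>2 / 2)))) / complex_of_real (v\<^sup>2)"
      using that by (simp add: phi_kernel_def field_simps power_mult_distrib)
    also have "cmod \<dots> \<le> (\<bar>z\<bar> * \<bar>sin v - v\<bar> + \<bar>z * v\<bar> ^ 3 / 6) / v\<^sup>2"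
      unfolding norm_divide
    proof (rule frac_le)
      show "cmod (\<i> * complex_of_real (z * (sin v - v)) - (iexp (z * v) - (1 + \<i> * complex_of_real (z * v) - complex_of_real ((z * v)\<^sup>2 / 2))))
          \<le> \<bar>z\<bar> * \<bar>sin v - v\<bar> + \<bar>z * v\<bar> ^ 3 / 6"
        by (rule order.trans[OF norm_triangle_ineq4 add_mono[OF _ e]])
          (simp only: norm_mult norm_of_real abs_mult norm_ii mult_1_left)
    qed (use that in \<open>auto simp: norm_power\<close>)
    also have "\<dots> \<le> (\<bar>z\<bar> * (\<bar>v\<bar> ^ 3 / 6) + \<bar>z * v\<bar> ^ 3 / 6) / v\<^sup>2"
      by (intro divide_right_mono add_mono mult_left_mono abs_sin_minus_id_le_cube) auto
    also have "\<dots> = (\<bar>z\<bar> ^ 3 + \<bar>z\<bar>) / 6 * (\<bar>v\<bar> ^ 3 / \<bar>v\<bar>\<^sup>2)"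
      by (simp add: abs_mult power_mult_distrib field_simps)
    also have "\<bar>v\<bar> ^ 3 / \<bar>v\<bar>\<^sup>2 = \<bar>v\<bar>"
      using that by (simp add: power2_eq_square power3_eq_cube)
    finally show ?thesis .
  qed
  have "((\<lambda>v. phi_kernel z v - phi_kernel z 0) \<longlongrightarrow> 0) (at 0)"
  proof (rule Lim_null_comparison)
    show "\<forall>\<^sub>F v in at 0. cmod (phi_kernel z v - phi_kernel z 0) \<le> (\<bar>z\<bar> ^ 3 + \<bar>z\<bar>) / 6 * \<bar>v\<bar>"
      unfolding eventually_at_filter by (intro always_eventually allI impI bound)
    show "((\<lambda>v. (\<bar>z\<bar> ^ 3 + \<bar>z\<bar>) / 6 * \<bar>v\<bar>) \<longlongrightarrow> 0) (at 0)"
      by (intro tendsto_mult_right_zero tendsto_rabs_zero tendsto_ident_at)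
  qed
  then show ?thesis using True by (simp add: isCont_def LIM_zero_cancel)
qed

lemma Re_phi_kernel: "Re (phi_kernel z u) = (if u = 0 then z\<^sup>2 / 2 else (1 - cos (z * u)) / u\<^sup>2)"
  by (simp add: phi_kernel_def Re_exp Re_divide_of_real)

lemma Re_phi_kernel_nonneg: "0 \<le> Re (phi_kernel z u)"
  by (simp add: Re_phi_kernel)

lemma Re_phi_kernel_minus: "Re (phi_kernel z (- u)) = Re (phi_kernel z u)"
  by (simp add: Re_phi_kernel)

lemma canonical_sets: "canonical_measure M \<Longrightarrow> sets M = sets borel"
  by (simp add: canonical_measure_def)

lemma integrable_levy_weight:
  assumes "canonical_measure M"
  shows "integrable M levy_weight"
proof (rule integrableI_nonneg)
  have [measurable_cong]: "sets M = sets borel" using assms by (rule canonical_sets)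
  show "levy_weight \<in> borel_measurable M" by measurable
  have "(\<integral>\<^sup>+u. ennreal (levy_weight u) \<partial>M) \<le> (\<integral>\<^sup>+u. indicator {-1..1} u
      + (ennreal (1 / u\<^sup>2) * indicator {1..} u + ennreal (1 / u\<^sup>2) * indicator {..-1} u) \<partial>M)"
    by (intro nn_integral_mono) (auto simp: levy_weight_def indicator_def)
  also have "\<dots> = emeasure M {-1..1} + (Mplus M 1 + Mminus M 1)"
    unfolding Mplus_def Mminus_def by (subst nn_integral_add, measurable, subst nn_integral_add) auto
  also have "\<dots> < \<infinity>"
    using assms unfolding canonical_measure_def by (auto simp: less_top[symmetric])
  finally show "(\<integral>\<^sup>+u. ennreal (levy_weight u) \<partial>M) < \<infinity>" .
qed (simp add: levy_weight_nonneg)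

lemma integrable_phi_kernel:
  assumes "canonical_measure M"
  shows "integrable M (phi_kernel z)"
proof (rule Bochner_Integration.integrable_bound)
  have [measurable_cong]: "sets M = sets borel" using assms by (rule canonical_sets)
  show "integrable M (\<lambda>u. 3 * (1 + z\<^sup>2) * levy_weight u)"
    by (intro integrable_mult_right integrable_levy_weight assms)
  show "phi_kernel z \<in> borel_measurable M" by measurable
  show "AE u in M. norm (phi_kernel z u) \<le> norm (3 * (1 + z\<^sup>2) * levy_weight u)"
    using norm_phi_kernel_le by (auto intro!: always_eventually order.trans[OF _ abs_ge_self])
qed

lemma norm_phi_le:
  assumes "canonical_measure M"
  shows "\<exists>K\<ge>0. \<forall>z. cmod (phi M z) \<le> K * (1 + z\<^sup>2)"
proof (intro exI[of _ "3 * (LINT u|M. levy_weight u)"] conjI allI)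
  show "0 \<le> 3 * (LINT u|M. levy_weight u)"
    by (simp add: integral_nonneg levy_weight_nonneg)
  fix z
  have "cmod (phi M z) \<le> (LINT u|M. cmod (phi_kernel z u))"
    unfolding phi_def by (rule integral_norm_bound)
  also have "\<dots> \<le> (LINT u|M. 3 * (1 + z\<^sup>2) * levy_weight u)"
    by (intro integral_mono norm_phi_kernel_le integrable_norm integrable_phi_kernel assms
        integrable_mult_right integrable_levy_weight)
  also have "\<dots> = 3 * (LINT u|M. levy_weight u) * (1 + z\<^sup>2)" by simp
  finally show "cmod (phi M z) \<le> 3 * (LINT u|M. levy_weight u) * (1 + z\<^sup>2)" .
qed

lemma isCont_phi:
  assumes "canonical_measure M"
  shows "isCont (phi M) z"
  unfolding continuous_at_sequentially
proof safe
  fix X assume X: "X \<longlonglongrightarrow> z"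
  have [measurable_cong]: "sets M = sets borel" using assms by (rule canonical_sets)
  obtain B where B: "\<And>n. \<bar>X n\<bar> \<le> B"
    using X convergent_imp_Bseq[of X] by (auto simp: convergent_def Bseq_def)
  show "(phi M \<circ> X) \<longlonglongrightarrow> phi M z"
    unfolding comp_def phi_def
  proof (rule integral_dominated_convergence)
    show "integrable M (\<lambda>u. 3 * (1 + B\<^sup>2) * levy_weight u)"
      by (intro integrable_mult_right integrable_levy_weight assms)
    show "AE u in M. (\<lambda>n. phi_kernel (X n) u) \<longlonglongrightarrow> phi_kernel z u"
    proof (rule AE_I2)
      fix u show "(\<lambda>n. phi_kernel (X n) u) \<longlonglongrightarrow> phi_kernel z u"
        by (cases "u = 0") (auto simp: phi_kernel_def intro!: tendsto_intros X)
    qed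
    show "AE u in M. norm (phi_kernel (X n) u) \<le> 3 * (1 + B\<^sup>2) * levy_weight u" for n
    proof (rule AE_I2)
      fix u
      have "(X n)\<^sup>2 \<le> B\<^sup>2" using power_mono[OF B[of n], of 2] by simp
      then show "norm (phi_kernel (X n) u) \<le> 3 * (1 + B\<^sup>2) * levy_weight u"
        by (intro order.trans[OF norm_phi_kernel_le] mult_right_mono levy_weight_nonneg) simp
    qed
  qed measurable
qed

lemma ennreal_Re_phi:
  assumes "canonical_measure M"
  shows "ennreal (Re (phi M z)) = (\<integral>\<^sup>+u. ennreal (Re (phi_kernel z u)) \<partial>M)"
proof -
  have "Re (phi M z) = (LINT u|M. Re (phi_kernel z u))"
    unfolding phi_def by (rule integral_Re[symmetric]) (rule integrable_phi_kernel[OF assms])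
  then show ?thesis
    using integrable_Re[OF integrable_phi_kernel[OF assms]]
    by (simp add: nn_integral_eq_integral Re_phi_kernel_nonneg)
qed

lemma Re_phi_nonneg:
  assumes "canonical_measure M"
  shows "0 \<le> Re (phi M z)"
proof -
  have "Re (phi M z) = (LINT u|M. Re (phi_kernel z u))"
    unfolding phi_def by (rule integral_Re[symmetric]) (rule integrable_phi_kernel[OF assms])
  then show ?thesis by (simp add: integral_nonneg Re_phi_kernel_nonneg)
qed

text \<open>
  A measure and its symmetrization have the same image under the absolute value, and an even
  function factors through it.
\<close>

lemma nn_integral_symmetrization_even:
  assumes m: "sets m = sets borel" and f: "f \<in> borel_measurable borel" "\<And>u. f (- u) = f u"
  shows "(\<integral>\<^sup>+u. f u \<partial>symmetrization m) = (\<integral>\<^sup>+u. f u \<partial>m)"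
proof -
  note [measurable_cong] = m and [measurable] = f(1)
  have even: "f u = f \<bar>u\<bar>" for u
    using f(2)[of u] by (simp add: abs_if)
  have abs: "distr (symmetrization m) borel abs = distr m borel abs"
  proof (rule measure_eqI)
    fix A :: "real set" assume "A \<in> sets (distr (symmetrization m) borel abs)"
    then have A: "A \<in> sets borel" by simp
    have B: "abs -` A \<in> sets (borel :: real measure)"
      using measurable_sets_borel[OF _ A, of "abs :: real \<Rightarrow> real"] by simp
    have space: "space m = UNIV" using sets_eq_imp_space_eq[OF m] by simp
    have "uminus ` (abs -` A) = abs -` A"
      by (auto simp: image_iff intro!: bexI[of _ "- _"])
    then have "emeasure (symmetrization m) (abs -` A) = (emeasure m (abs -` A) + emeasure m (abs -` A)) / 2"
      by (simp add: emeasure_symmetrization[OF m B])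
    also have "\<dots> = emeasure m (abs -` A)"
      using ennreal_mult_divide_eq[of 2 "emeasure m (abs -` A)"] by (simp only: mult_2_right[symmetric]) simp
    finally show "emeasure (distr (symmetrization m) borel abs) A = emeasure (distr m borel abs) A"
      using A space sets_eq_imp_space_eq[OF sets_symmetrization[of m]] by (simp add: emeasure_distr)
  qed simp
  have "(\<integral>\<^sup>+u. f u \<partial>symmetrization m) = (\<integral>\<^sup>+u. f u \<partial>distr (symmetrization m) borel abs)"
    by (subst nn_integral_distr) (auto intro!: nn_integral_cong even)
  also have "\<dots> = (\<integral>\<^sup>+u. f u \<partial>m)"
    unfolding abs by (subst nn_integral_distr) (auto intro!: nn_integral_cong even[symmetric])
  finally show ?thesis .
qed

text \<open>
  The two tails that proper convergence controls, as one real number.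
\<close>

definition levy_tail :: "real measure \<Rightarrow> real \<Rightarrow> real" where
  "levy_tail M T = enn2real (Mplus M T) + enn2real (Mminus M T)"

lemma levy_tail_integral:
  assumes "canonical_measure M" "T > 0"
  shows "integrable M (\<lambda>u. indicator {T..} u / u\<^sup>2 + indicator {..-T} u / u\<^sup>2)"
    and "(LINT u|M. indicator {T..} u / u\<^sup>2 + indicator {..-T} u / u\<^sup>2) = levy_tail M T"
proof -
  have [measurable_cong]: "sets M = sets borel" using assms by (intro canonical_sets)
  have fin: "Mplus M T < \<infinity>" "Mminus M T < \<infinity>"
    using assms unfolding canonical_measure_def by auto
  have p: "(\<integral>\<^sup>+u. ennreal (indicator {T..} u / u\<^sup>2) \<partial>M) = Mplus M T"
    "(\<integral>\<^sup>+u. ennreal (indicator {..-T} u / u\<^sup>2) \<partial>M) = Mminus M T"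
    unfolding Mplus_def Mminus_def by (auto intro!: nn_integral_cong simp: indicator_def)
  have i: "integrable M (\<lambda>u. indicator {T..} u / u\<^sup>2)" "integrable M (\<lambda>u. indicator {..-T} u / u\<^sup>2)"
    using fin by (auto intro!: integrableI_nonneg simp: p)
  then show "integrable M (\<lambda>u. indicator {T..} u / u\<^sup>2 + indicator {..-T} u / u\<^sup>2)"
    by (rule Bochner_Integration.integrable_add)
  have "(LINT u|M. indicator {T..} u / u\<^sup>2) = enn2real (Mplus M T)"
    "(LINT u|M. indicator {..-T} u / u\<^sup>2) = enn2real (Mminus M T)"
    by (simp_all add: integral_eq_nn_integral p)
  then show "(LINT u|M. indicator {T..} u / u\<^sup>2 + indicator {..-T} u / u\<^sup>2) = levy_tail M T"
    using i by (simp add: levy_tail_def)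
qed

lemma levy_tail_tendsto_0:
  assumes "canonical_measure M"
  shows "(\<lambda>k. levy_tail M (real (Suc k))) \<longlonglongrightarrow> 0"
proof -
  have [measurable_cong]: "sets M = sets borel" using assms by (rule canonical_sets)
  let ?h = "\<lambda>T u :: real. indicator {T..} u / u\<^sup>2 + indicator {..-T} u / u\<^sup>2 :: real"
  have "(\<lambda>k. LINT u|M. ?h (real (Suc k)) u) \<longlonglongrightarrow> (LINT u|M. 0)"
  proof (rule integral_dominated_convergence)
    show "integrable M (?h 1)" by (rule levy_tail_integral(1)[OF assms]) simp
    show "AE u in M. (\<lambda>k. ?h (real (Suc k)) u) \<longlonglongrightarrow> 0"
    proof (rule AE_I2, rule tendsto_eventually)
      fix u :: real
      obtain k where k: "\<bar>u\<bar> < real k" using reals_Archimedean2 by blast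
      show "\<forall>\<^sub>F k in sequentially. ?h (real (Suc k)) u = 0"
        using k by (intro eventually_sequentiallyI[of k]) (auto simp: indicator_def)
    qed
    show "AE u in M. norm (?h (real (Suc k)) u) \<le> ?h 1 u" for k
      by (rule AE_I2) (auto simp: indicator_def)
  qed measurable
  then show ?thesis
    by (simp add: levy_tail_integral(2)[OF assms] del: of_nat_Suc)
qed

lemma norm_phi_truncation_le:
  assumes M: "canonical_measure M" and T: "T \<ge> 1"
  shows "cmod (phi M z - (CLINT u|M. indicator {-T<..T} u *\<^sub>R phi_kernel z u)) \<le> 3 * (1 + z\<^sup>2) * levy_tail M T"
proof -
  have [measurable_cong]: "sets M = sets borel" using M by (rule canonical_sets)
  note int = integrable_phi_kernel[OF M, of z]
  have int': "integrable M (\<lambda>u. indicator {-T<..T} u *\<^sub>R phi_kernel z u)"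
    using int by (rule integrable_mult_indicator[rotated]) simp
  have "phi M z - (CLINT u|M. indicator {-T<..T} u *\<^sub>R phi_kernel z u)
     = (CLINT u|M. phi_kernel z u - indicator {-T<..T} u *\<^sub>R phi_kernel z u)"
    unfolding phi_def using int int' by (rule Bochner_Integration.integral_diff[symmetric])
  also have "cmod \<dots> \<le> (LINT u|M. cmod (phi_kernel z u - indicator {-T<..T} u *\<^sub>R phi_kernel z u))"
    by (rule integral_norm_bound)
  also have "\<dots> \<le> (LINT u|M. 3 * (1 + z\<^sup>2) * (indicator {T..} u / u\<^sup>2 + indicator {..-T} u / u\<^sup>2))"
  proof (intro integral_mono)
    show "integrable M (\<lambda>u. cmod (phi_kernel z u - indicator {-T<..T} u *\<^sub>R phi_kernel z u))"
      using int int' by (intro integrable_norm Bochner_Integration.integrable_diff)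
    show "integrable M (\<lambda>u. 3 * (1 + z\<^sup>2) * (indicator {T..} u / u\<^sup>2 + indicator {..-T} u / u\<^sup>2))"
      using T by (intro integrable_mult_right levy_tail_integral(1)[OF M]) simp
    fix u
    show "cmod (phi_kernel z u - indicator {-T<..T} u *\<^sub>R phi_kernel z u)
        \<le> 3 * (1 + z\<^sup>2) * (indicator {T..} u / u\<^sup>2 + indicator {..-T} u / u\<^sup>2)"
    proof (cases "u \<in> {-T<..T}")
      case True
      have "0 \<le> 3 * (1 + z\<^sup>2) * (indicator {T..} u / u\<^sup>2 + indicator {..-T} u / u\<^sup>2)"
        by (intro mult_nonneg_nonneg add_nonneg_nonneg divide_nonneg_nonneg) auto
      then show ?thesis using True by simp
    next
      case False
      then have u: "\<bar>u\<bar> \<ge> 1" using T by auto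
      have "levy_weight u \<le> 1 / u\<^sup>2"
      proof (cases "\<bar>u\<bar> \<le> 1")
        case True
        then have "u\<^sup>2 = 1" using u by (simp add: abs_if power2_eq_1_iff split: if_splits)
        then show ?thesis by (simp add: levy_weight_le_1)
      qed (simp add: levy_weight_def)
      moreover have "1 / u\<^sup>2 \<le> indicator {T..} u / u\<^sup>2 + indicator {..-T} u / u\<^sup>2"
        using False T by (auto simp: indicator_def)
      ultimately have "levy_weight u \<le> indicator {T..} u / u\<^sup>2 + indicator {..-T} u / u\<^sup>2" by linarith
      then have "3 * (1 + z\<^sup>2) * levy_weight u
          \<le> 3 * (1 + z\<^sup>2) * (indicator {T..} u / u\<^sup>2 + indicator {..-T} u / u\<^sup>2)"
        by (rule mult_left_mono) simp
      then show ?thesis using False norm_phi_kernel_le[of z u] by simp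
    qed
  qed
  also have "\<dots> = 3 * (1 + z\<^sup>2) * levy_tail M T"
    using T by (simp only: integral_mult_right_zero) (subst levy_tail_integral(2)[OF M], auto)
  finally show ?thesis .
qed

text \<open>
  Conditioned on \<open>{-T<..T}\<close>, the distribution functions converge at every point because masses of
  intervals do, so integrals of bounded continuous functions converge; the conditioning is undone
  by the convergence of the masses of \<open>{-T<..T}\<close>.
\<close>

lemma proper_convergence_truncated_integral:
  fixes f :: "real \<Rightarrow> complex"
  assumes Ms: "\<And>n. canonical_measure (Ms n)" and M: "canonical_measure M"
    and conv: "converges_properly Ms M"
    and cont: "\<And>u. isCont f u" and B: "\<And>u. cmod (f u) \<le> B"
  shows "(\<lambda>n. CLINT u|Ms n. indicator {-T<..T} u *\<^sub>R f u) \<longlonglongrightarrow> (CLINT u|M. indicator {-T<..T} u *\<^sub>R f u)"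
proof -
  let ?J = "{-T<..T}"
  have sets[measurable_cong]: "sets M = sets borel" "sets (Ms n) = sets borel" for n
    using canonical_sets[OF M] canonical_sets[OF Ms] by auto
  have space: "space M = UNIV" "space (Ms n) = UNIV" for n
    using sets[THEN sets_eq_imp_space_eq] by auto
  have [measurable]: "f \<in> borel_measurable borel"
    using cont by (intro borel_measurable_continuous_onI continuous_at_imp_continuous_on) auto
  have interval: "is_interval (?J \<inter> {..x})" "bounded (?J \<inter> {..x})" "is_interval ?J" "bounded ?J" for x
    by (auto intro: is_interval_Int is_interval_oc is_interval_ic bounded_Int)
  have fin: "emeasure M (?J \<inter> {..x}) < \<infinity>" "emeasure M ?J < \<infinity>"
      "emeasure (Ms n) (?J \<inter> {..x}) < \<infinity>" "emeasure (Ms n) ?J < \<infinity>" for n x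
    using M Ms interval unfolding canonical_measure_def by blast+
  have measure_lim: "(\<lambda>n. measure (Ms n) (?J \<inter> {..x})) \<longlonglongrightarrow> measure M (?J \<inter> {..x})"
      "(\<lambda>n. measure (Ms n) ?J) \<longlonglongrightarrow> measure M ?J" for x
    using conv interval fin unfolding converges_properly_def measure_def
    by (auto intro!: tendsto_enn2real simp: less_top[symmetric])
  have le_mass: "cmod (CLINT u|m. indicator ?J u *\<^sub>R f u) \<le> B * measure m ?J"
    if [measurable_cong]: "sets m = sets borel" and fin: "emeasure m ?J < \<infinity>" for m
  proof -
    have ind: "integrable m (indicator ?J :: real \<Rightarrow> real)"
      using fin that(1) by (intro integrable_real_indicator) auto
    have "cmod (CLINT u|m. indicator ?J u *\<^sub>R f u) \<le> (LINT u|m. cmod (indicator ?J u *\<^sub>R f u))"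
      by (rule integral_norm_bound)
    also have "\<dots> \<le> (LINT u|m. B * indicator ?J u)"
    proof (intro integral_mono)
      show "integrable m (\<lambda>u. B * indicator ?J u)" using ind by simp
      then show "integrable m (\<lambda>u. cmod (indicator ?J u *\<^sub>R f u))"
        by (rule Bochner_Integration.integrable_bound)
          (auto simp: indicator_def intro!: AE_I2 order.trans[OF B])
    qed (auto simp: indicator_def B)
    also have "\<dots> = B * measure m ?J"
      using sets_eq_imp_space_eq[OF that(1)] by simp
    finally show ?thesis .
  qed
  show ?thesis
  proof (cases "measure M ?J = 0")
    case True
    have "(\<lambda>n. B * measure (Ms n) ?J) \<longlonglongrightarrow> B * 0"
      using measure_lim(2) unfolding True by (rule tendsto_mult_left)
    then have "(\<lambda>n. CLINT u|Ms n. indicator ?J u *\<^sub>R f u) \<longlonglongrightarrow> 0"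
      by (intro Lim_null_comparison[OF always_eventually[OF allI, OF le_mass]] sets fin) simp
    moreover have "(CLINT u|M. indicator ?J u *\<^sub>R f u) = 0"
      using le_mass[OF sets(1) fin(2)] True by simp
    ultimately show ?thesis by simp
  next
    case False
    then have pos: "measure M ?J > 0" by (simp add: zero_less_measure_iff)
    have "\<forall>\<^sub>F n in sequentially. measure (Ms n) ?J > 0"
      by (rule order_tendstoD(1)[OF measure_lim(2) pos])
    then obtain n0 where n0: "\<And>n. n \<ge> n0 \<Longrightarrow> measure (Ms n) ?J > 0"
      by (auto simp: eventually_sequentially)
    have uniform: "real_distribution (uniform_measure m ?J)"
        "cdf (uniform_measure m ?J) x = measure m (?J \<inter> {..x}) / measure m ?J"
        "(CLINT u|m. indicator ?J u *\<^sub>R f u) = measure m ?J *\<^sub>R (CLINT u|uniform_measure m ?J. f u)"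
      if m[measurable_cong]: "sets m = sets borel" and fin: "emeasure m ?J < \<infinity>" and pos: "measure m ?J > 0" for m x
    proof -
      have em: "emeasure m ?J \<noteq> 0" "emeasure m ?J \<noteq> \<infinity>"
        using fin pos by (auto simp: measure_def)
      have ennr: "emeasure m ?J = ennreal (measure m ?J)"
        using fin by (intro emeasure_eq_ennreal_measure) auto
      show "real_distribution (uniform_measure m ?J)"
        using prob_space_uniform_measure[OF em] m
        by (simp add: real_distribution_def real_distribution_axioms_def)
      show "cdf (uniform_measure m ?J) x = measure m (?J \<inter> {..x}) / measure m ?J"
        unfolding cdf_def using em m by (intro measure_uniform_measure) auto
      have "uniform_measure m ?J = density m (\<lambda>u. ennreal (indicator ?J u / measure m ?J))"
        unfolding uniform_measure_def ennr
        by (intro density_cong AE_I2) (use pos in \<open>auto simp: indicator_def divide_ennreal[symmetric]\<close>)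
      then have "(CLINT u|uniform_measure m ?J. f u) = (CLINT u|m. (indicator ?J u / measure m ?J) *\<^sub>R f u)"
        by (simp only:) (subst integral_density, auto)
      also have "\<dots> = (CLINT u|m. inverse (measure m ?J) *\<^sub>R (indicator ?J u *\<^sub>R f u))"
        by (simp add: divide_inverse mult.commute)
      also have "\<dots> = inverse (measure m ?J) *\<^sub>R (CLINT u|m. indicator ?J u *\<^sub>R f u)"
        by (rule integral_scaleR_right)
      finally show "(CLINT u|m. indicator ?J u *\<^sub>R f u) = measure m ?J *\<^sub>R (CLINT u|uniform_measure m ?J. f u)"
        using pos by simp
    qed
    let ?\<mu> = "\<lambda>n. uniform_measure (Ms (n + n0)) ?J"
    have "weak_conv_m ?\<mu> (uniform_measure M ?J)"
      unfolding weak_conv_m_def weak_conv_def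
    proof (intro allI impI)
      fix x
      have "(\<lambda>n. measure (Ms (n + n0)) (?J \<inter> {..x}) / measure (Ms (n + n0)) ?J)
          \<longlonglongrightarrow> measure M (?J \<inter> {..x}) / measure M ?J"
        using pos by (intro tendsto_divide LIMSEQ_ignore_initial_segment measure_lim) auto
      then show "(\<lambda>n. cdf (?\<mu> n) x) \<longlonglongrightarrow> cdf (uniform_measure M ?J) x"
        unfolding uniform(2)[OF sets(1) fin(2) pos] uniform(2)[OF sets(2) fin(4) n0[OF le_add2]] .
    qed
    then have "(\<lambda>n. CLINT u|?\<mu> n. f u) \<longlonglongrightarrow> (CLINT u|uniform_measure M ?J. f u)"
      by (rule weak_conv_imp_integral_bdd_continuous_conv[OF uniform(1)[OF sets(2) fin(4) n0[OF le_add2]]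
            uniform(1)[OF sets(1) fin(2) pos] _ cont B])
    then have "(\<lambda>n. measure (Ms (n + n0)) ?J *\<^sub>R (CLINT u|?\<mu> n. f u)) \<longlonglongrightarrow> measure M ?J *\<^sub>R (CLINT u|uniform_measure M ?J. f u)"
      by (rule tendsto_scaleR[OF LIMSEQ_ignore_initial_segment[OF measure_lim(2)]])
    then have "(\<lambda>n. CLINT u|Ms (n + n0). indicator ?J u *\<^sub>R f u) \<longlonglongrightarrow> (CLINT u|M. indicator ?J u *\<^sub>R f u)"
      unfolding uniform(3)[OF sets(1) fin(2) pos, symmetric] uniform(3)[OF sets(2) fin(4) n0[OF le_add2], symmetric] .
    then show ?thesis by (rule LIMSEQ_offset)
  qed
qed

text \<open>
  On \<open>{-T<..T}\<close> the integrals converge, and outside they are bounded by the tails, which are small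
  for the limit measure when \<open>T\<close> is large and hence for all but finitely many of the others.
\<close>

lemma proper_convergence_phi:
  assumes Ms: "\<And>n. canonical_measure (Ms n)" and M: "canonical_measure M"
    and conv: "converges_properly Ms M"
  shows "(\<lambda>n. phi (Ms n) z) \<longlonglongrightarrow> phi M z"
proof (rule tendstoI)
  fix e :: real assume e: "e > 0"
  define c where "c = 3 * (1 + z\<^sup>2)"
  have c: "c > 0" unfolding c_def by (simp add: add_pos_nonneg)
  have "(\<lambda>k. c * levy_tail M (real (Suc k))) \<longlonglongrightarrow> c * 0"
    by (intro tendsto_mult_left levy_tail_tendsto_0[OF M])
  then have "\<forall>\<^sub>F k in sequentially. c * levy_tail M (real (Suc k)) < e / 3"
    using e by (intro order_tendstoD(2)[of _ 0]) auto
  then obtain k where k: "c * levy_tail M (real (Suc k)) < e / 3"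
    by (auto simp: eventually_sequentially)
  define T where "T = real (Suc k)"
  have T: "T \<ge> 1" unfolding T_def by simp
  let ?I = "\<lambda>m. CLINT u|m. indicator {-T<..T} u *\<^sub>R phi_kernel z u"
  have "(\<lambda>n. levy_tail (Ms n) T) \<longlonglongrightarrow> levy_tail M T"
    unfolding levy_tail_def using conv M T unfolding converges_properly_def canonical_measure_def
    by (intro tendsto_add tendsto_enn2real) (auto simp: less_top)
  then have "(\<lambda>n. c * levy_tail (Ms n) T) \<longlonglongrightarrow> c * levy_tail M T"
    by (rule tendsto_mult_left)
  then have tail: "\<forall>\<^sub>F n in sequentially. c * levy_tail (Ms n) T < e / 3"
    using k unfolding T_def[symmetric] by (rule order_tendstoD(2))
  have "\<And>u. cmod (phi_kernel z u) \<le> c"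
  proof -
    fix u
    have "c * levy_weight u \<le> c * 1"
      using c levy_weight_le_1 by (intro mult_left_mono) auto
    then show "cmod (phi_kernel z u) \<le> c" using norm_phi_kernel_le[of z u] unfolding c_def by simp
  qed
  then have "(\<lambda>n. ?I (Ms n)) \<longlonglongrightarrow> ?I M"
    by (intro proper_convergence_truncated_integral[OF Ms M conv isCont_phi_kernel])
  then have "\<forall>\<^sub>F n in sequentially. dist (?I (Ms n)) (?I M) < e / 3"
    using e by (intro tendstoD) auto
  with tail show "\<forall>\<^sub>F n in sequentially. dist (phi (Ms n) z) (phi M z) < e"
  proof eventually_elim
    case (elim n)
    have "cmod (phi (Ms n) z - ?I (Ms n)) < e / 3" "cmod (phi M z - ?I M) < e / 3"
      using norm_phi_truncation_le[OF Ms T, of n z] norm_phi_truncation_le[OF M T, of z] elim(1) k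
      unfolding c_def T_def by linarith+
    moreover have "phi (Ms n) z - phi M z = (phi (Ms n) z - ?I (Ms n)) + (?I (Ms n) - ?I M) - (phi M z - ?I M)"
      by simp
    then have "cmod (phi (Ms n) z - phi M z) \<le> cmod (phi (Ms n) z - ?I (Ms n)) + cmod (?I (Ms n) - ?I M) + cmod (phi M z - ?I M)"
      by (simp only:) (intro order.trans[OF norm_triangle_ineq4] add_right_mono norm_triangle_ineq)
    ultimately show ?case using elim(2) by (simp add: dist_norm)
  qed
qed

text \<open>
  The factor \<open>u\<^sup>2\<close> is bounded on bounded intervals and cancels \<open>1 / u\<^sup>2\<close> in the tails.
\<close>

lemma canonical_density_square:
  assumes "real_distribution F" "c \<ge> 0"
  shows "canonical_measure (density F (\<lambda>u. ennreal (c * u\<^sup>2)))"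
proof -
  interpret F: real_distribution F by fact
  have [measurable_cong]: "sets F = sets borel" by simp
  have I: "emeasure (density F (\<lambda>u. ennreal (c * u\<^sup>2))) I < \<infinity>" if I: "is_interval I" "bounded I" for I
  proof -
    obtain B where B: "\<And>u. u \<in> I \<Longrightarrow> \<bar>u\<bar> \<le> B" using I(2) by (auto simp: bounded_iff)
    have [measurable]: "I \<in> sets borel" using I(1) by (rule real_interval_borel_measurable)
    have "emeasure (density F (\<lambda>u. ennreal (c * u\<^sup>2))) I = (\<integral>\<^sup>+u. ennreal (c * u\<^sup>2) * indicator I u \<partial>F)"
      by (rule emeasure_density) auto
    also have "\<dots> \<le> (\<integral>\<^sup>+u. ennreal (c * B\<^sup>2) \<partial>F)"
    proof (intro nn_integral_mono)
      fix u
      have "u\<^sup>2 \<le> B\<^sup>2" if "u \<in> I" using power_mono[OF B[OF that], of 2] by simp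
      then show "ennreal (c * u\<^sup>2) * indicator I u \<le> ennreal (c * B\<^sup>2)"
        using assms(2) by (auto simp: indicator_def intro!: ennreal_leI mult_left_mono)
    qed
    also have "\<dots> < \<infinity>" by (simp add: F.emeasure_space_1[simplified])
    finally show ?thesis .
  qed
  have tail: "(\<integral>\<^sup>+u. ennreal (1 / u\<^sup>2) * indicator A u \<partial>density F (\<lambda>u. ennreal (c * u\<^sup>2))) < \<infinity>"
    if [measurable]: "A \<in> sets borel" for A
  proof -
    have "(\<integral>\<^sup>+u. ennreal (1 / u\<^sup>2) * indicator A u \<partial>density F (\<lambda>u. ennreal (c * u\<^sup>2)))
      = (\<integral>\<^sup>+u. ennreal (c * u\<^sup>2) * (ennreal (1 / u\<^sup>2) * indicator A u) \<partial>F)"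
      by (subst nn_integral_density) auto
    also have "\<dots> \<le> (\<integral>\<^sup>+u. ennreal c \<partial>F)"
      using assms(2) by (intro nn_integral_mono) (auto simp: indicator_def ennreal_mult'[symmetric])
    also have "\<dots> < \<infinity>" by (simp add: F.emeasure_space_1[simplified])
    finally show ?thesis .
  qed
  show ?thesis
    unfolding canonical_measure_def Mplus_def Mminus_def using I tail by auto
qed

text \<open>
  The factor \<open>c * u\<^sup>2\<close> cancels the denominator of the kernel. With \<open>c\<close> the length of a row this
  identifies the exponent of the row with \<open>c * (1 - char F z)\<close> up to the centring term.
\<close>

lemma phi_density_square:
  assumes "real_distribution F" "c \<ge> 0"
  shows "phi (density F (\<lambda>u. ennreal (c * u\<^sup>2))) z
    = c * (1 - char F z) + \<i> * complex_of_real (z * (c * (LINT u|F. sin u)))"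
proof -
  interpret F: real_distribution F by fact
  have [measurable_cong]: "sets F = sets borel" by simp
  have i: "integrable F (\<lambda>u. iexp (z * u))" by (rule F.integrable_iexp) auto
  have s: "integrable F (\<lambda>u. sin u)" by (rule F.integrable_const_bound[where B=1]) auto
  have "phi (density F (\<lambda>u. ennreal (c * u\<^sup>2))) z = (CLINT u|F. (c * u\<^sup>2) *\<^sub>R phi_kernel z u)"
    unfolding phi_def using assms(2) by (subst integral_density) auto
  also have "\<dots> = (CLINT u|F. complex_of_real c * (1 - iexp (z * u)) + \<i> * complex_of_real (z * c) * complex_of_real (sin u))"
    by (intro Bochner_Integration.integral_cong refl)
      (simp add: phi_kernel_def scaleR_conv_of_real field_simps)
  also have "\<dots> = complex_of_real c * (1 - char F z) + \<i> * complex_of_real (z * c) * complex_of_real (LINT u|F. sin u)"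
    using i s F.prob_space unfolding char_def by (simp del: of_real_mult)
  finally show ?thesis by simp
qed

lemma integral_symmetrization_cos:
  assumes "real_distribution F"
  shows "(LINT u|symmetrization F. 1 - cos (z * u)) = 1 - Re (char F z)"
proof -
  interpret real_distribution F by fact
  have [measurable_cong]: "sets F = sets borel" by simp
  have "(LINT u|symmetrization F. 1 - cos (z * u)) = enn2real (\<integral>\<^sup>+u. ennreal (1 - cos (z * u)) \<partial>symmetrization F)"
    by (intro integral_eq_nn_integral) auto
  also have "(\<integral>\<^sup>+u. ennreal (1 - cos (z * u)) \<partial>symmetrization F) = (\<integral>\<^sup>+u. ennreal (1 - cos (z * u)) \<partial>F)"
    by (intro nn_integral_symmetrization_even) auto
  also have "enn2real \<dots> = (LINT u|F. 1 - cos (z * u))"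
    by (intro integral_eq_nn_integral[symmetric]) auto
  finally show ?thesis by (simp add: cos_char[OF assms])
qed

text \<open>
  The real part of the kernel is even and non-negative, so it only sees the symmetrized measure.
\<close>

lemma Re_phi_mono:
  assumes M: "canonical_measure M" and M': "canonical_measure M'"
    and le: "\<And>A. A \<in> sets borel \<Longrightarrow> emeasure (symmetrization M) A \<le> emeasure (symmetrization M') A"
  shows "Re (phi M z) \<le> Re (phi M' z)"
proof -
  have "ennreal (Re (phi M z)) = (\<integral>\<^sup>+u. ennreal (Re (phi_kernel z u)) \<partial>symmetrization M)"
    unfolding ennreal_Re_phi[OF M]
    by (intro nn_integral_symmetrization_even[symmetric] canonical_sets M) (auto simp: Re_phi_kernel_minus)
  also have "\<dots> \<le> (\<integral>\<^sup>+u. ennreal (Re (phi_kernel z u)) \<partial>symmetrization M')"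
    by (intro nn_integral_mono_measure) (auto simp: le_measure le)
  also have "\<dots> = ennreal (Re (phi M' z))"
    unfolding ennreal_Re_phi[OF M']
    by (intro nn_integral_symmetrization_even canonical_sets M') (auto simp: Re_phi_kernel_minus)
  finally show ?thesis using Re_phi_nonneg[OF M'] by simp
qed

section \<open>Comparing a power with an exponential\<close>

lemma norm_power_diff_le:
  fixes A B :: complex
  assumes "cmod A \<le> r" "cmod B \<le> r"
  shows "cmod (A ^ m - B ^ m) \<le> real m * cmod (A - B) * r ^ (m - 1)"
proof (cases "r > 0 \<and> m > 0")
  case True
  then have r: "r > 0" and m: "m > 0" by auto
  have "A ^ m - B ^ m = of_real (r ^ m) * ((A / r) ^ m - (B / r) ^ m)"
    using r by (simp add: power_divide algebra_simps)
  then have "cmod (A ^ m - B ^ m) = r ^ m * cmod ((A / r) ^ m - (B / r) ^ m)"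
    using r by (simp add: norm_mult norm_power)
  also have "\<dots> \<le> r ^ m * (real m * cmod (A / r - B / r))"
    using r assms by (intro mult_left_mono norm_power_diff) (auto simp: norm_divide divide_le_eq)
  also have "cmod (A / r - B / r) = cmod (A - B) / r"
    using r by (simp add: diff_divide_distrib[symmetric] norm_divide)
  also have "r ^ m * (real m * (cmod (A - B) / r)) = real m * cmod (A - B) * r ^ (m - 1)"
    using r m by (simp add: power_eq_if)
  finally show ?thesis .
next
  case False
  have "0 \<le> r" using assms(1) norm_ge_zero order.trans by blast
  then consider "r = 0" | "m = 0" using False by force
  then show ?thesis using assms by cases auto
qed

text \<open>
  Taylor's formula in the half plane \<open>Re \<le> 0\<close>, where the exponential is bounded by \<open>1\<close>.
\<close>

lemma norm_exp_minus_linear_le: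
  assumes "0 \<le> Re w"
  shows "cmod (exp (- w) - (1 - w)) \<le> (cmod w)\<^sup>2"
proof -
  have "cmod (exp (- w) - (\<Sum>i\<le>1. exp 0 * (- w - 0) ^ i / fact i)) \<le> 1 * cmod (- w - 0) ^ Suc 1 / fact 1"
  proof (rule complex_Taylor[where S="{z. Re z \<le> 0}" and f="\<lambda>_. exp"])
    show "convex {z. Re z \<le> 0}" by (rule convex_halfspace_Re_le)
    show "(exp has_field_derivative exp x) (at x within {z. Re z \<le> 0})" for x :: complex
      by (intro derivative_eq_intros) auto
  qed (use assms in auto)
  then show ?thesis by (simp add: power2_eq_square)
qed

text \<open>
  Compare the \<open>m\<close>-th powers of \<open>1 - w / m\<close> and of \<open>exp (- \<psi> / m)\<close> factor by factor. Each of the \<open>m\<close>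
  telescoping terms carries \<open>m - 1 \<ge> m / 2\<close> factors bounded by \<open>exp (- E / m)\<close>, whence the decay
  \<open>exp (- E / 2)\<close>.
\<close>

lemma power_minus_exp_le:
  fixes w \<psi> :: complex and m :: nat
  assumes m: "m \<ge> 2" and E: "0 \<le> E" "E \<le> Re \<psi>"
    and w: "cmod (1 - w / m) \<le> exp (- E / m)"
  shows "cmod ((1 - w / m) ^ m - exp (- \<psi>)) \<le> (cmod (w - \<psi>) + (cmod \<psi>)\<^sup>2 / m) * exp (- E / 2)"
proof -
  let ?B = "exp (- (\<psi> / m))"
  have m0: "real m > 0" using m by simp
  have B_pow: "?B ^ m = exp (- \<psi>)"
    using m by (simp add: exp_of_nat_mult[symmetric])
  have "- (Re \<psi> / m) \<le> - (E / m)"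
    using m0 E by (simp add: divide_right_mono)
  then have B: "cmod ?B \<le> exp (- E / m)"
    by (simp add: Re_divide_of_nat)
  have "cmod ((1 - w / m) ^ m - ?B ^ m) \<le> real m * cmod ((1 - w / m) - ?B) * exp (- E / m) ^ (m - 1)"
    by (rule norm_power_diff_le[OF w B])
  also have "\<dots> \<le> (cmod (w - \<psi>) + (cmod \<psi>)\<^sup>2 / m) * exp (- E / 2)"
  proof (rule mult_mono)
    have "(1 - w / m) - ?B = (\<psi> - w) / m - (?B - (1 - \<psi> / m))"
      by (simp add: diff_divide_distrib)
    then have "cmod ((1 - w / m) - ?B) \<le> cmod ((\<psi> - w) / m) + cmod (?B - (1 - \<psi> / m))"
      by (simp only: norm_triangle_ineq4)
    also have "cmod (?B - (1 - \<psi> / m)) \<le> (cmod (\<psi> / m))\<^sup>2"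
      using E m0 by (intro norm_exp_minus_linear_le) (simp add: Re_divide_of_nat)
    finally have "cmod ((1 - w / m) - ?B) \<le> cmod (w - \<psi>) / m + (cmod \<psi> / m)\<^sup>2"
      by (simp add: norm_divide norm_minus_commute)
    then have "real m * cmod ((1 - w / m) - ?B) \<le> real m * (cmod (w - \<psi>) / m + (cmod \<psi> / m)\<^sup>2)"
      using m0 by (intro mult_left_mono) auto
    also have "\<dots> = cmod (w - \<psi>) + (cmod \<psi>)\<^sup>2 / m"
      using m0 by (simp add: field_simps power2_eq_square)
    finally show "real m * cmod ((1 - w / m) - ?B) \<le> cmod (w - \<psi>) + (cmod \<psi>)\<^sup>2 / m" .
    have "E * m \<le> E * (2 * (m - 1))" using m E by (intro mult_left_mono) auto
    then have "E / 2 \<le> real (m - 1) * (E / m)"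
      using m0 by (simp add: field_simps)
    then show "exp (- E / m) ^ (m - 1) \<le> exp (- E / 2)"
      by (simp add: exp_of_nat_mult[symmetric])
  qed auto
  finally show ?thesis unfolding B_pow .
qed

text \<open>
  From \<open>(y / m) ^ m \<le> exp y\<close> with \<open>y = c * \<bar>z\<bar> powr \<kappa>\<close> and \<open>m\<close> so large that \<open>\<kappa> * m \<ge> 6\<close>.
\<close>

lemma polynomial_times_exp_powr_bounded:
  fixes c \<kappa> :: real
  assumes "c > 0" "\<kappa> > 0"
  shows "\<exists>K\<ge>0. \<forall>z. (1 + z\<^sup>2) ^ 3 * exp (- (c * \<bar>z\<bar> powr \<kappa>)) \<le> K"
proof -
  obtain m0 :: nat where m0: "6 / \<kappa> < real m0" using reals_Archimedean2 by blast
  define m where "m = Suc m0"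
  have m: "6 \<le> \<kappa> * m" "m > 0"
    using m0 assms unfolding m_def by (auto simp: field_simps)
  show ?thesis
  proof (intro exI[of _ "8 + 8 * (m / c) ^ m"] conjI allI)
    show "0 \<le> 8 + 8 * (m / c) ^ m" using assms by simp
    fix z :: real
    show "(1 + z\<^sup>2) ^ 3 * exp (- (c * \<bar>z\<bar> powr \<kappa>)) \<le> 8 + 8 * (m / c) ^ m"
    proof (cases "\<bar>z\<bar> \<le> 1")
      case True
      then have "z\<^sup>2 \<le> 1" by (simp add: abs_square_le_1)
      then have "(1 + z\<^sup>2) ^ 3 \<le> 2 ^ 3" by (intro power_mono) auto
      moreover have "exp (- (c * \<bar>z\<bar> powr \<kappa>)) \<le> 1" using assms by simp
      ultimately have "(1 + z\<^sup>2) ^ 3 * exp (- (c * \<bar>z\<bar> powr \<kappa>)) \<le> 2 ^ 3 * 1"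
        by (intro mult_mono) auto
      also have "\<dots> \<le> 8 + 8 * (m / c) ^ m" using assms by simp
      finally show ?thesis .
    next
      case False
      define y where "y = c * \<bar>z\<bar> powr \<kappa>"
      have y: "y > 0" using False assms unfolding y_def by simp
      have "(y / m) ^ m \<le> (1 + y / m) ^ m" using y by (intro power_mono) auto
      also have "\<dots> \<le> exp y"
        using y m by (intro exp_ge_one_plus_x_over_n_power_n) auto
      finally have "(y / m) ^ m \<le> exp y" .
      moreover have "(c / m) ^ m * \<bar>z\<bar> ^ 6 \<le> (y / m) ^ m"
      proof -
        have "\<bar>z\<bar> ^ 6 = \<bar>z\<bar> powr 6" using False by (simp add: powr_numeral)
        also have "\<dots> \<le> \<bar>z\<bar> powr (\<kappa> * m)" using False m by (intro powr_mono) auto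
        also have "\<dots> = (\<bar>z\<bar> powr \<kappa>) ^ m"
          using False by (simp add: powr_powr[symmetric] powr_realpow)
        finally have "(c / m) ^ m * \<bar>z\<bar> ^ 6 \<le> (c / m) ^ m * (\<bar>z\<bar> powr \<kappa>) ^ m"
          using assms by (intro mult_left_mono) auto
        then show ?thesis unfolding y_def by (simp add: power_mult_distrib[symmetric])
      qed
      ultimately have low: "(c / m) ^ m * \<bar>z\<bar> ^ 6 \<le> exp y" by linarith
      have "(1 + z\<^sup>2) ^ 3 \<le> (2 * \<bar>z\<bar>\<^sup>2) ^ 3"
        using False one_le_power[of "\<bar>z\<bar>" 2] by (intro power_mono) auto
      also have "\<dots> = 8 * \<bar>z\<bar> ^ 6"
        by (simp only: power_mult_distrib power_mult[symmetric]) simp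
      also have "\<dots> = 8 * (m / c) ^ m * ((c / m) ^ m * \<bar>z\<bar> ^ 6)"
        using assms m by (simp add: power_divide)
      also have "\<dots> \<le> 8 * (m / c) ^ m * exp y"
        using assms by (intro mult_left_mono[OF low]) auto
      finally have "(1 + z\<^sup>2) ^ 3 * exp (- y) \<le> 8 * (m / c) ^ m * exp y * exp (- y)"
        by (rule mult_right_mono) simp
      also have "\<dots> = 8 * (m / c) ^ m" by (simp add: mult.assoc exp_add[symmetric])
      finally show ?thesis unfolding y_def by simp
    qed
  qed
qed

lemma integrable_inverse_1_plus_square_lborel: "integrable lborel (\<lambda>z :: real. 1 / (1 + z\<^sup>2))"
  using integrable_inverse_1_plus_square
  by (simp add: set_integrable_def einterval_eq inverse_eq_divide)

text \<open>
  The defect \<open>T\<^sup>2 * t\<^sup>2 / 2\<close> left by \<open>one_minus_norm_char_ge\<close> is absorbed by the quadratic gap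
  \<open>char_quadratic_gap\<close>. The constant depends only on \<open>\<delta>\<close>, \<open>g0\<close> and \<open>N\<close>, so all rows of an array share
  it.
\<close>

lemma one_minus_Re_char_comparison:
  assumes "\<delta> > 0" "g0 > 0" "0 \<le> N" "N < 1"
  shows "\<exists>\<rho>>0. \<forall>\<mu>. real_distribution \<mu> \<longrightarrow> (\<forall>t. \<delta> \<le> \<bar>t\<bar> \<longrightarrow> cmod (char \<mu> t) \<le> N) \<longrightarrow>
     (\<forall>t. \<bar>t\<bar> \<le> \<delta> \<longrightarrow> g0 \<le> Re (char \<mu> t)) \<longrightarrow>
     (\<forall>t. \<bar>t\<bar> \<le> \<delta> \<longrightarrow> \<rho> * (1 - Re (char \<mu> t)) \<le> 1 - (cmod (char \<mu> t))\<^sup>2)"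
proof -
  obtain T where T: "T \<ge> 0" and mass: "\<And>\<mu>. real_distribution \<mu> \<Longrightarrow>
      (\<forall>t. \<bar>t\<bar> \<le> \<delta> \<longrightarrow> g0 \<le> Re (char \<mu> t)) \<Longrightarrow> g0 / 4 \<le> measure \<mu> {-T..T}"
    using char_bounded_below_imp_mass[OF assms(1,2)] by blast
  define \<eta> where "\<eta> = g0 / 4"
  define q where "q = (1 - N\<^sup>2) / (4 * \<delta>\<^sup>2)"
  have \<eta>: "\<eta> > 0" using assms unfolding \<eta>_def by simp
  have "N\<^sup>2 < 1" using assms by (simp add: abs_square_less_1)
  then have q: "q > 0" using assms unfolding q_def by simp
  define D where "D = 1 + \<eta> * T\<^sup>2 / (2 * q)"
  have D: "D > 0" using \<eta> q unfolding D_def by (simp add: add_pos_nonneg)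
  show ?thesis
  proof (intro exI[of _ "\<eta> / (2 * D)"] conjI allI impI)
    show "0 < \<eta> / (2 * D)" using \<eta> D by simp
    fix \<mu> t
    assume \<mu>: "real_distribution \<mu>" and N: "\<forall>t. \<delta> \<le> \<bar>t\<bar> \<longrightarrow> cmod (char \<mu> t) \<le> N"
      and g0: "\<forall>t. \<bar>t\<bar> \<le> \<delta> \<longrightarrow> g0 \<le> Re (char \<mu> t)" and t: "\<bar>t\<bar> \<le> \<delta>"
    define G where "G = 1 - (cmod (char \<mu> t))\<^sup>2"
    have 1: "\<eta> * ((1 - Re (char \<mu> t)) / 2 - T\<^sup>2 * t\<^sup>2 / 2) \<le> G"
      unfolding G_def \<eta>_def using mass[OF \<mu> g0] assms T by (intro one_minus_norm_char_ge[OF \<mu>]) auto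
    have "q * t\<^sup>2 \<le> G"
      unfolding G_def q_def using N t assms by (intro char_quadratic_gap[OF \<mu>]) auto
    then have "\<eta> * T\<^sup>2 / (2 * q) * (q * t\<^sup>2) \<le> \<eta> * T\<^sup>2 / (2 * q) * G"
      using \<eta> q by (intro mult_left_mono) auto
    moreover have "\<eta> * T\<^sup>2 / (2 * q) * (q * t\<^sup>2) = \<eta> * (T\<^sup>2 * t\<^sup>2 / 2)"
      using q by (simp add: field_simps)
    ultimately have "\<eta> / 2 * (1 - Re (char \<mu> t)) \<le> D * G"
      using 1 unfolding D_def by (simp add: algebra_simps)
    then show "\<eta> / (2 * D) * (1 - Re (char \<mu> t)) \<le> 1 - (cmod (char \<mu> t))\<^sup>2"
      unfolding G_def[symmetric] using D by (simp add: field_simps)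
  qed
qed

lemma one_minus_norm_square_le:
  assumes "real_distribution \<mu>"
  shows "1 - (cmod (char \<mu> t))\<^sup>2 \<le> 2 * (1 - Re (char \<mu> t))"
proof -
  interpret real_distribution \<mu> by fact
  have "Re (char \<mu> t) \<le> 1" by (rule order.trans[OF complex_Re_le_cmod cmod_char_le_1])
  have "1 - (cmod (char \<mu> t))\<^sup>2 \<le> 1 - (Re (char \<mu> t))\<^sup>2" by (simp add: cmod_power2)
  also have "\<dots> \<le> 2 * (1 - Re (char \<mu> t))"
    using zero_le_power2[of "1 - Re (char \<mu> t)"] by (simp add: power2_eq_square algebra_simps)
  finally show ?thesis .
qed

lemma norm_le_exp_of_gap:
  assumes "s \<le> 1 - (cmod x)\<^sup>2"
  shows "cmod x \<le> exp (- s / 2)"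
proof -
  have "(cmod x)\<^sup>2 \<le> 1 + (- s)" using assms by simp
  also have "\<dots> \<le> exp (- s)" by (rule exp_ge_add_one_self)
  also have "\<dots> = (exp (- s / 2))\<^sup>2" by (simp add: power2_eq_square exp_add[symmetric])
  finally show ?thesis by (rule power2_le_imp_le) simp
qed

text \<open>
  Two of the \<open>m\<close> factors make the integral converge; beyond \<open>\<delta> * b\<close> each of the others is at most \<open>N\<close>.
\<close>

lemma char_power_tail:
  assumes \<mu>: "real_distribution \<mu>" and G: "(\<integral>\<^sup>+t. ennreal ((cmod (char \<mu> t))\<^sup>2) \<partial>lborel) \<le> ennreal G" "0 \<le> G"
    and b: "b > 0" and N: "0 \<le> N" "\<And>t. \<delta> \<le> \<bar>t\<bar> \<Longrightarrow> cmod (char \<mu> t) \<le> N" and m: "m \<ge> 2"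
  shows "integrable lborel (\<lambda>z. char \<mu> (z / b) ^ m)"
    and "(LINT z|lborel. indicator {z. \<delta> * b < \<bar>z\<bar>} z * cmod (char \<mu> (z / b) ^ m)) \<le> b * N ^ (m - 2) * G"
proof -
  interpret M: real_distribution \<mu> by fact
  have scale: "(\<integral>\<^sup>+z. f (z / b) \<partial>lborel) = ennreal b * (\<integral>\<^sup>+t. f t \<partial>lborel)"
    if [measurable]: "f \<in> borel_measurable borel" for f :: "real \<Rightarrow> ennreal"
    using b by (subst nn_integral_real_affine[where c=b and t=0]) auto
  have split: "x ^ m = x\<^sup>2 * x ^ (m - 2)" for x :: real
    using power_add[of x 2 "m - 2"] unfolding le_add_diff_inverse[OF m] .
  have "(\<integral>\<^sup>+z. ennreal (cmod (char \<mu> (z / b) ^ m)) \<partial>lborel) \<le> (\<integral>\<^sup>+z. ennreal ((cmod (char \<mu> (z / b)))\<^sup>2) \<partial>lborel)"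
  proof (intro nn_integral_mono ennreal_leI)
    fix z
    show "cmod (char \<mu> (z / b) ^ m) \<le> (cmod (char \<mu> (z / b)))\<^sup>2"
      unfolding norm_power split by (intro mult_left_le power_le_one M.cmod_char_le_1) auto
  qed
  also have "\<dots> \<le> ennreal b * ennreal G"
    by (subst scale) (auto intro!: mult_left_mono G)
  also have "\<dots> < \<infinity>" by (simp add: ennreal_mult_less_top)
  finally show "integrable lborel (\<lambda>z. char \<mu> (z / b) ^ m)"
    by (intro integrableI_bounded) auto
  have "(\<integral>\<^sup>+z. ennreal (indicator {z. \<delta> * b < \<bar>z\<bar>} z * cmod (char \<mu> (z / b) ^ m)) \<partial>lborel)
      \<le> (\<integral>\<^sup>+z. ennreal (N ^ (m - 2)) * ennreal ((cmod (char \<mu> (z / b)))\<^sup>2) \<partial>lborel)"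
  proof (intro nn_integral_mono)
    fix z
    have "cmod (char \<mu> (z / b) ^ m) \<le> N ^ (m - 2) * (cmod (char \<mu> (z / b)))\<^sup>2" if "\<delta> * b < \<bar>z\<bar>"
    proof -
      have "\<delta> \<le> \<bar>z / b\<bar>" using that b by (simp add: field_simps)
      from N(2)[OF this] show ?thesis
        unfolding norm_power split by (subst mult.commute) (intro mult_right_mono power_mono, auto)
    qed
    then show "ennreal (indicator {z. \<delta> * b < \<bar>z\<bar>} z * cmod (char \<mu> (z / b) ^ m))
        \<le> ennreal (N ^ (m - 2)) * ennreal ((cmod (char \<mu> (z / b)))\<^sup>2)"
      using N(1) by (auto simp: indicator_def ennreal_mult[symmetric] intro!: ennreal_leI)
  qed
  also have "\<dots> = ennreal (N ^ (m - 2)) * (ennreal b * (\<integral>\<^sup>+t. ennreal ((cmod (char \<mu> t))\<^sup>2) \<partial>lborel))"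
    by (subst nn_integral_cmult, measurable) (subst scale, auto)
  also have "\<dots> \<le> ennreal (N ^ (m - 2)) * (ennreal b * ennreal G)"
    by (intro mult_left_mono G) auto
  also have "\<dots> = ennreal (b * N ^ (m - 2) * G)"
    using N b G by (simp add: ennreal_mult[symmetric] mult_ac)
  finally have "enn2real (\<integral>\<^sup>+z. ennreal (indicator {z. \<delta> * b < \<bar>z\<bar>} z * cmod (char \<mu> (z / b) ^ m)) \<partial>lborel)
      \<le> b * N ^ (m - 2) * G"
    using N b G by (intro enn2real_leI) auto
  then show "(LINT z|lborel. indicator {z. \<delta> * b < \<bar>z\<bar>} z * cmod (char \<mu> (z / b) ^ m)) \<le> b * N ^ (m - 2) * G"
    by (subst integral_eq_nn_integral) auto
qed

section \<open>Convolution powers and infinite divisibility\<close>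

lemma char_convolution:
  assumes "real_distribution \<mu>" "real_distribution \<nu>"
  shows "real_distribution (\<mu> \<star> \<nu>)" and "char (\<mu> \<star> \<nu>) t = char \<mu> t * char \<nu> t"
proof -
  interpret M: real_distribution \<mu> by fact
  interpret N: real_distribution \<nu> by fact
  interpret pair_prob_space \<mu> \<nu> ..
  have [measurable_cong]: "sets \<mu> = sets borel" "sets \<nu> = sets borel" by auto
  show "real_distribution (\<mu> \<star> \<nu>)"
    unfolding convolution_def by (intro P.real_distribution_distr) (auto simp: split_beta)
  have int: "integrable (\<mu> \<Otimes>\<^sub>M \<nu>) (\<lambda>z. iexp (t * (fst z + snd z)))"
    by (intro P.integrable_const_bound[where B=1]) (auto simp del: of_real_add of_real_mult)
  have "char (\<mu> \<star> \<nu>) t = (CLINT z|(\<mu> \<Otimes>\<^sub>M \<nu>). iexp (t * (fst z + snd z)))"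
    unfolding char_def convolution_def by (subst integral_distr) (auto simp: split_beta)
  also have "\<dots> = (CLINT x|\<mu>. CLINT y|\<nu>. iexp (t * (x + y)))"
    using integral_fst'[OF int] by simp
  also have "\<dots> = (CLINT x|\<mu>. CLINT y|\<nu>. iexp (t * x) * iexp (t * y))"
    by (intro Bochner_Integration.integral_cong refl) (simp add: exp_add[symmetric] algebra_simps)
  also have "\<dots> = char \<mu> t * char \<nu> t" unfolding char_def by simp
  finally show "char (\<mu> \<star> \<nu>) t = char \<mu> t * char \<nu> t" .
qed

lemma char_convolution_power:
  assumes "real_distribution \<nu>"
  shows "real_distribution (convolution_power \<nu> k) \<and> (\<forall>t. char (convolution_power \<nu> k) t = char \<nu> t ^ k)"
proof (induction k)
  case 0
  have "prob_space (return borel (0 :: real))" by (rule prob_space_return) simp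
  then have "real_distribution (return borel 0)"
    by (simp add: real_distribution_def real_distribution_axioms_def)
  then show ?case by (simp add: char_def integral_return)
next
  case (Suc k)
  then show ?case using char_convolution[OF assms, of "convolution_power \<nu> k"] by simp
qed

text \<open>
  Taking only \<open>a n div k\<close> of the \<open>a n\<close> factors divides the limiting exponent by \<open>k\<close>. Thus the array itself
  provides the laws that converge to a \<open>k\<close>-th convolution root of the limit; for \<open>k = 1\<close> it is the limit
  law.
\<close>

lemma exp_limit_root_is_char:
  fixes F :: "nat \<Rightarrow> real measure" and a :: "nat \<Rightarrow> nat"
  assumes F: "\<And>n. real_distribution (F n)" and a: "filterlim a at_top sequentially"
    and lim: "\<And>z. (\<lambda>n. complex_of_real (real (a n)) * (1 - char (F n) z)) \<longlonglongrightarrow> \<psi> z"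
    and cont: "isCont \<psi> 0" and Re: "\<And>z. 0 \<le> Re (\<psi> z)" and k: "k \<ge> (1 :: nat)"
  shows "\<exists>\<nu>. real_distribution \<nu> \<and> char \<nu> = (\<lambda>z. exp (- (\<psi> z / k)))"
proof (rule char_limit_is_char[where \<mu>="\<lambda>n. convolution_power (F n) (a n div k)"])
  show "real_distribution (convolution_power (F n) (a n div k))" for n
    using char_convolution_power[OF F] by blast
  show "isCont (\<lambda>z. exp (- (\<psi> z / k))) 0"
    using k by (intro continuous_intros cont) auto
  fix z
  define m where "m n = a n div k" for n
  define w where "w n = complex_of_real (real (m n)) * (1 - char (F n) z)" for n
  have m_top: "filterlim m at_top sequentially"
    unfolding filterlim_at_top
  proof
    fix Z
    have "\<forall>\<^sub>F n in sequentially. Z * k \<le> a n"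
      using a unfolding filterlim_at_top by blast
    then show "\<forall>\<^sub>F n in sequentially. Z \<le> m n"
      by eventually_elim (use k in \<open>simp add: m_def less_eq_div_iff_mult_less_eq\<close>)
  qed
  have a_pos: "\<forall>\<^sub>F n in sequentially. 1 \<le> a n"
    using a unfolding filterlim_at_top by blast
  have ratio: "(\<lambda>n. real (m n) / real (a n)) \<longlonglongrightarrow> 1 / k"
  proof (rule LIM_zero_cancel, rule Lim_null_comparison)
    show "\<forall>\<^sub>F n in sequentially. norm (real (m n) / real (a n) - 1 / k) \<le> 1 / real (a n)"
      using a_pos
    proof eventually_elim
      case (elim n)
      define r where "r = real (a n mod k) / k"
      have "a n = k * m n + a n mod k" unfolding m_def by simp
      then have "real (a n) = real (k * m n + a n mod k)" by (rule arg_cong)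
      then have "real (m n) = real (a n) / k - r"
        using k unfolding r_def by (simp add: field_simps)
      then have "real (m n) / real (a n) - 1 / k = - r / real (a n)"
        using elim k by (simp add: diff_divide_distrib)
      moreover have "0 \<le> r" "r \<le> 1" using k unfolding r_def by simp_all
      ultimately show ?case
        using elim by (simp add: divide_right_mono)
    qed
    show "(\<lambda>n. 1 / real (a n)) \<longlonglongrightarrow> 0"
      using tendsto_inverse_0_at_top[OF filterlim_compose[OF filterlim_real_sequentially a]]
      by (simp only: inverse_eq_divide)
  qed
  have w_lim: "w \<longlonglongrightarrow> \<psi> z / k"
  proof -
    have "(\<lambda>n. complex_of_real (real (m n) / real (a n)) * (complex_of_real (real (a n)) * (1 - char (F n) z)))
       \<longlonglongrightarrow> complex_of_real (1 / k) * \<psi> z"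
      by (rule tendsto_mult[OF tendsto_of_real[OF ratio] lim])
    moreover have "\<forall>\<^sub>F n in sequentially. complex_of_real (real (m n) / real (a n)) * (complex_of_real (real (a n)) * (1 - char (F n) z)) = w n"
      using a_pos by eventually_elim (simp add: w_def)
    ultimately have "w \<longlonglongrightarrow> complex_of_real (1 / k) * \<psi> z"
      by (rule Lim_transform_eventually)
    then show ?thesis by simp
  qed
  have "\<forall>\<^sub>F n in sequentially. cmod (char (F n) z ^ m n - exp (- (\<psi> z / k)))
      \<le> cmod (w n - \<psi> z / k) + (cmod (\<psi> z / k))\<^sup>2 / real (m n)"
    using m_top[unfolded filterlim_at_top, rule_format, of 2]
  proof eventually_elim
    case (elim n)
    interpret Fn: real_distribution "F n" by (rule F)
    have eq: "1 - w n / real (m n) = char (F n) z"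
      using elim by (simp add: w_def)
    have "cmod ((1 - w n / m n) ^ m n - exp (- (\<psi> z / k)))
        \<le> (cmod (w n - \<psi> z / k) + (cmod (\<psi> z / k))\<^sup>2 / m n) * exp (- 0 / 2)"
    proof (rule power_minus_exp_le[OF elim order.refl])
      show "0 \<le> Re (\<psi> z / k)" using Re[of z] by (simp add: Re_divide_of_nat)
      show "cmod (1 - w n / m n) \<le> exp (- 0 / real (m n))"
        using Fn.cmod_char_le_1[of z] eq by simp
    qed
    then show ?case using eq by simp
  qed
  moreover have "(\<lambda>n. cmod (w n - \<psi> z / k) + (cmod (\<psi> z / k))\<^sup>2 / real (m n)) \<longlonglongrightarrow> 0"
  proof -
    have "(\<lambda>n. (cmod (\<psi> z / k))\<^sup>2 * inverse (real (m n))) \<longlonglongrightarrow> (cmod (\<psi> z / k))\<^sup>2 * 0"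
      by (rule tendsto_mult_left[OF tendsto_inverse_0_at_top[OF filterlim_compose[OF filterlim_real_sequentially m_top]]])
    from tendsto_add[OF tendsto_norm_zero[OF LIM_zero[OF w_lim]] this] show ?thesis
      by (simp only: divide_inverse mult_zero_right add_0_right)
  qed
  ultimately have "(\<lambda>n. char (F n) z ^ m n - exp (- (\<psi> z / k))) \<longlonglongrightarrow> 0"
    by (rule Lim_null_comparison)
  then have "(\<lambda>n. char (F n) z ^ m n) \<longlonglongrightarrow> exp (- (\<psi> z / k))"
    by (rule LIM_zero_cancel)
  then show "(\<lambda>n. char (convolution_power (F n) (a n div k)) z) \<longlonglongrightarrow> exp (- (\<psi> z / k))"
    using char_convolution_power[OF F] unfolding m_def by simp
qed

lemma infinitely_divisible_of_roots:
  assumes \<mu>: "real_distribution \<mu>" "char \<mu> = (\<lambda>z. exp (- \<psi> z))"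
    and roots: "\<And>k :: nat. (1 :: nat) \<le> k \<Longrightarrow> \<exists>\<nu>. real_distribution \<nu> \<and> char \<nu> = (\<lambda>z. exp (- (\<psi> z / k)))"
  shows "infinitely_divisible \<mu>"
  unfolding infinitely_divisible_def
proof (intro allI impI)
  fix k :: nat assume k: "k \<ge> 1"
  from roots[OF k] obtain \<nu> where \<nu>: "real_distribution \<nu>" "char \<nu> = (\<lambda>z. exp (- (\<psi> z / k)))" by blast
  have "char (convolution_power \<nu> k) z = char \<mu> z" for z
  proof -
    have "char (convolution_power \<nu> k) z = exp (- (\<psi> z / k)) ^ k"
      using char_convolution_power[OF \<nu>(1)] \<nu>(2) by simp
    also have "\<dots> = exp (- \<psi> z)"
      using k by (simp add: exp_of_nat_mult[symmetric])
    finally show ?thesis using \<mu>(2) by simp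
  qed
  then have "convolution_power \<nu> k = \<mu>"
    using char_convolution_power[OF \<nu>(1)] \<mu>(1) by (intro Levy_uniqueness) auto
  then show "\<exists>\<nu>. real_distribution \<nu> \<and> convolution_power \<nu> k = \<mu>" using \<nu>(1) by blast
qed

section \<open>The rows of the array\<close>

lemma distr_lborel: "distr M lborel X = distr M borel X"
  by (intro distr_cong) auto

lemma (in prob_space) distributed_sum_indep:
  fixes X :: "'i \<Rightarrow> 'a \<Rightarrow> real"
  assumes "finite I" "I \<noteq> {}" "indep_vars (\<lambda>_. borel) X I"
    and "\<And>i. i \<in> I \<Longrightarrow> distributed M lborel (X i) f"
  shows "\<exists>q. distributed M lborel (\<lambda>\<omega>. \<Sum>i\<in>I. X i \<omega>) q"
  using assms
proof (induction I rule: finite_ne_induct)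
  case (singleton i)
  then show ?case by auto
next
  case (insert i I)
  then obtain q where "distributed M lborel (\<lambda>\<omega>. \<Sum>i\<in>I. X i \<omega>) q"
    using indep_vars_subset[OF insert.prems(1), of I] by auto
  moreover have "indep_var borel (X i) borel (\<lambda>\<omega>. \<Sum>i\<in>I. X i \<omega>)"
    using insert by (intro indep_vars_sum) auto
  ultimately have "distributed M lborel (\<lambda>\<omega>. X i \<omega> + (\<Sum>i\<in>I. X i \<omega>)) (\<lambda>x. \<integral>\<^sup>+y. f (x - y) * q y \<partial>lborel)"
    using insert.prems by (intro distributed_convolution) auto
  then show ?case using insert.hyps by auto
qed

context
  fixes P :: "nat \<Rightarrow> 'a measure" and a :: "nat \<Rightarrow> nat" and b :: "nat \<Rightarrow> real"
    and \<xi> :: "nat \<Rightarrow> nat \<Rightarrow> 'a \<Rightarrow> real" and n :: nat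
  assumes iid: "iid_array P a \<xi>" and n: "n \<ge> 1" and a: "a n \<ge> 1" and b: "b n > 0"
begin

lemma row_prob_space: "prob_space (P n)"
  using iid n unfolding iid_array_def by auto

lemma row_measurable: "k \<in> {1..a n} \<Longrightarrow> \<xi> k n \<in> borel_measurable (P n)"
  using iid n unfolding iid_array_def by auto

lemma row_indep: "prob_space.indep_vars (P n) (\<lambda>_. borel) (\<lambda>k. \<xi> k n) {1..a n}"
  using iid n unfolding iid_array_def by auto

lemma row_identical: "k \<in> {1..a n} \<Longrightarrow> distr (P n) borel (\<xi> k n) = distr (P n) borel (\<xi> 1 n)"
  using iid n unfolding iid_array_def by blast

lemma real_distribution_row: "real_distribution (distr (P n) borel (\<xi> 1 n))"
  by (intro prob_space.real_distribution_distr row_prob_space row_measurable) (use a in simp)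

lemma F_law_eq: "F_law P b \<xi> n = distr (distr (P n) borel (\<xi> 1 n)) borel (\<lambda>x. x / b n)"
  using row_measurable[of 1] a unfolding F_law_def X_array_def[abs_def]
  by (subst distr_distr) (auto simp: comp_def)

lemma real_distribution_F_law: "real_distribution (F_law P b \<xi> n)"
  unfolding F_law_eq by (intro real_distribution_distr real_distribution_row) measurable

lemma char_F_law: "char (F_law P b \<xi> n) z = theta P \<xi> n (z / b n)"
  unfolding F_law_eq theta_def char_def by (subst integral_distr) auto

lemma row_sum_eq: "row_sum a b \<xi> n = (\<lambda>\<omega>. 0 + (1 / b n) * (\<Sum>k\<in>{1..a n}. \<xi> k n \<omega>))"
  by (simp add: fun_eq_iff row_sum_def X_array_def sum_divide_distrib)

lemma row_sum_measurable: "row_sum a b \<xi> n \<in> borel_measurable (P n)"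
  unfolding row_sum_eq
  by (intro borel_measurable_add borel_measurable_times borel_measurable_sum borel_measurable_const row_measurable)

lemma real_distribution_row_sum: "real_distribution (distr (P n) borel (row_sum a b \<xi> n))"
  by (intro prob_space.real_distribution_distr row_prob_space row_sum_measurable)

lemma char_row_sum: "char (distr (P n) borel (row_sum a b \<xi> n)) z = theta P \<xi> n (z / b n) ^ a n"
proof -
  let ?S = "\<lambda>\<omega>. \<Sum>k\<in>{1..a n}. \<xi> k n \<omega>"
  have S: "?S \<in> borel_measurable (P n)"
    by (intro borel_measurable_sum row_measurable)
  have "char (distr (P n) borel (row_sum a b \<xi> n)) z = (CLINT \<omega>|P n. iexp (z * row_sum a b \<xi> n \<omega>))"
    unfolding char_def by (subst integral_distr) (auto intro: row_sum_measurable)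
  also have "\<dots> = (CLINT \<omega>|P n. iexp ((z / b n) * ?S \<omega>))"
    unfolding row_sum_eq by simp
  also have "\<dots> = char (distr (P n) borel ?S) (z / b n)"
    unfolding char_def by (subst integral_distr[OF S]) auto
  also have "\<dots> = (\<Prod>k\<in>{1..a n}. char (distr (P n) borel (\<xi> k n)) (z / b n))"
    by (rule prob_space.char_distr_sum[OF row_prob_space row_indep])
  also have "\<dots> = (\<Prod>k\<in>{1..a n}. theta P \<xi> n (z / b n))"
    unfolding theta_def by (intro prod.cong refl) (simp only: row_identical)
  finally show ?thesis by simp
qed

lemma canonical_M_array: "canonical_measure (M_array P a b \<xi> n)"
  unfolding M_array_def by (intro canonical_density_square real_distribution_F_law) simp

lemma phi_M_array:
  "phi (M_array P a b \<xi> n) z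
     = a n * (1 - theta P \<xi> n (z / b n)) + \<i> * complex_of_real (z * (a n * beta_array P b \<xi> n))"
  unfolding M_array_def beta_array_def char_F_law[symmetric]
  by (subst phi_density_square[OF real_distribution_F_law]) auto

lemma distributed_row_sum:
  assumes "distributed (P n) lborel (\<xi> 1 n) f"
  shows "\<exists>q. distributed (P n) lborel (row_sum a b \<xi> n) q"
proof -
  interpret prob_space "P n" by (rule row_prob_space)
  have "distributed (P n) lborel (\<xi> k n) f" if k: "k \<in> {1..a n}" for k
    using assms row_measurable[OF k] row_identical[OF k]
    unfolding distributed_def by (simp add: distr_lborel)
  then obtain q where "distributed (P n) lborel (\<lambda>\<omega>. \<Sum>k\<in>{1..a n}. \<xi> k n \<omega>) q"
    using distributed_sum_indep[OF _ _ row_indep] a by auto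
  then have "distributed (P n) lborel (row_sum a b \<xi> n) (\<lambda>x. q ((x - 0) / (1 / b n)) / \<bar>1 / b n\<bar>)"
    unfolding row_sum_eq by (rule distributed_affine) (use b in simp)
  then show ?thesis by blast
qed

end

section \<open>The rate of convergence of the densities\<close>

theorem theorem2:
  fixes P :: "nat \<Rightarrow> 'a measure"
    and a :: "nat \<Rightarrow> nat"
    and b :: "nat \<Rightarrow> real"
    and \<xi> :: "nat \<Rightarrow> nat \<Rightarrow> 'a \<Rightarrow> real"
    and g :: "nat \<Rightarrow> real \<Rightarrow> real"
    and M :: "real measure"
    and \<beta> \<delta> \<epsilon> :: real
  assumes a_pos: "\<forall>n\<ge>1. a n \<ge> 1"
    and a_lim: "filterlim a at_top sequentially"
    and b_pos: "\<forall>n\<ge>1. b n > 0"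
    and iid: "iid_array P a \<xi>"
    and null_array:
      "\<forall>e>0. (\<lambda>n. measure (P n) {\<omega> \<in> space (P n). \<bar>X_array b \<xi> 1 n \<omega>\<bar> \<ge> e}) \<longlonglongrightarrow> 0"
    and canonical: "canonical_measure M"
    and M_lim: "converges_properly (M_array P a b \<xi>) M"
    and beta_lim: "(\<lambda>n. real (a n) * beta_array P b \<xi> n) \<longlonglongrightarrow> \<beta>"
    and delta: "\<delta> > 0"
    and A: "\<forall>n\<ge>1. (\<forall>x. 0 \<le> g n x) \<and> distributed (P n) lborel (\<xi> 1 n) (\<lambda>x. ennreal (g n x))"
    and B: "\<exists>\<alpha>\<in>{0<..<2}. \<exists>c>0. \<exists>R. \<forall>z. \<bar>z\<bar> \<ge> R \<longrightarrow> Re (psi \<beta> M z) \<ge> c * \<bar>z\<bar> powr \<alpha>"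
    and C: "\<forall>d>0. char_tail_sup (theta P \<xi>) d < 1"
    and D: "(SUP n\<in>{1..}. \<integral>\<^sup>+x. ennreal ((g n x)\<^sup>2) \<partial>lborel) < \<infinity>"
    and E: "filterlim b at_top sequentially" "(\<lambda>n. ln (b n) / real (a n)) \<longlonglongrightarrow> 0"
    and F: "\<exists>c>0. \<exists>\<kappa>\<in>{0<..<2}. \<forall>n\<ge>1.
        (\<forall>z. \<bar>z\<bar> \<le> \<delta> * b n \<longrightarrow>
          real (a n) * (LINT u|symmetrization (F_law P b \<xi> n). 1 - cos (z * u))
            \<ge> c * \<bar>z\<bar> powr \<kappa>) \<or>
        (\<forall>A\<in>sets borel. emeasure (symmetrization M) A
            \<le> emeasure (symmetrization (M_array P a b \<xi> n)) A)"
    and G: "(INF (n, z)\<in>{(n, z). n \<ge> 1 \<and> \<bar>z\<bar> \<le> \<delta>}. \<bar>Re (theta P \<xi> n z)\<bar>) > 0"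
    and eps: "0 < \<epsilon>" "\<epsilon> < 1"
  shows "(\<forall>n\<ge>1. \<exists>q. distributed (P n) lborel (row_sum a b \<xi> n) q) \<and>
    (\<exists>\<mu> p. real_distribution \<mu> \<and>
      char \<mu> = (\<lambda>z. exp (- psi \<beta> M z)) \<and>
      weak_conv_m (\<lambda>n. distr (P n) borel (row_sum a b \<xi> n)) \<mu> \<and>
      infinitely_divisible \<mu> \<and>
      inversion_density \<mu> p \<and>
      (\<exists>pn. \<exists>C>0. \<forall>\<^sub>F n in sequentially.
        inversion_density (distr (P n) borel (row_sum a b \<xi> n)) (pn n) \<and>
        (\<forall>x. \<bar>pn n x - p x\<bar> \<le> C * rho P a b \<xi> M \<beta> \<epsilon> \<delta> n)))"
proof -
  define F where "F n = F_law P b \<xi> n" for n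
  define Ms where "Ms n = M_array P a b \<xi> n" for n
  define \<psi> where "\<psi> z = psi \<beta> M z" for z
  define w where "w n z = complex_of_real (real (a n)) * (1 - char (F n) z)" for n z
  define drift where "drift n = \<bar>real (a n) * beta_array P b \<xi> n - \<beta>\<bar>" for n
  define \<rho> where "\<rho> n = rho P a b \<xi> M \<beta> \<epsilon> \<delta> n" for n
  define \<theta> where "\<theta> n = distr (P n) borel (\<xi> 1 n)" for n
  have row: "n \<ge> 1 \<Longrightarrow> a n \<ge> 1" "n \<ge> 1 \<Longrightarrow> b n > 0" for n
    by (use a_pos in blast) (use b_pos in blast)
  have \<theta>: "real_distribution (\<theta> n)" if "n \<ge> 1" for n
    unfolding \<theta>_def using that by (intro real_distribution_row[where b=b, OF iid] row)
  have char_\<theta>: "char (\<theta> n) = theta P \<xi> n" for n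
    unfolding \<theta>_def theta_def ..
  have F: "real_distribution (F n)" if "n \<ge> 1" for n
    unfolding F_def using that by (intro real_distribution_F_law[OF iid] row)
  have char_F: "char (F n) z = char (\<theta> n) (z / b n)" if "n \<ge> 1" for n z
    unfolding F_def char_\<theta> using that by (intro char_F_law[OF iid] row)
  have Ms: "canonical_measure (Ms n)" if "n \<ge> 1" for n
    unfolding Ms_def using that by (intro canonical_M_array[OF iid] row)
  have \<psi>_eq: "\<psi> z = - \<i> * complex_of_real (\<beta> * z) + phi M z" for z
    unfolding \<psi>_def psi_def ..
  have Re_\<psi>: "Re (\<psi> z) = Re (phi M z)" for z
    unfolding \<psi>_eq by simp
  have w_eq: "w n z = phi (Ms n) z - \<i> * complex_of_real (z * (real (a n) * beta_array P b \<xi> n))" if "n \<ge> 1" for n z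
    unfolding w_def Ms_def char_F[OF that] char_\<theta>
    using phi_M_array[where z=z and a=a and b=b, OF iid that row(1)[OF that] row(2)[OF that]] by simp
  have Re_w: "Re (w n z) = Re (phi (Ms n) z)" if "n \<ge> 1" for n z
    unfolding w_eq[OF that] by simp

  \<comment> \<open>Row \<open>0\<close> is unconstrained, hence the shift to \<open>Suc n\<close> here and below.\<close>
  have phi_lim: "(\<lambda>n. phi (Ms n) z) \<longlonglongrightarrow> phi M z" for z
  proof (rule LIMSEQ_imp_Suc, rule proper_convergence_phi)
    show "converges_properly (\<lambda>n. Ms (Suc n)) M"
      using M_lim unfolding converges_properly_def Ms_def by (auto intro: LIMSEQ_Suc)
  qed (auto intro: Ms canonical)
  have w_lim: "(\<lambda>n. w (Suc n) z) \<longlonglongrightarrow> \<psi> z" for z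
  proof -
    have "(\<lambda>n. phi (Ms n) z - \<i> * complex_of_real (z * (real (a n) * beta_array P b \<xi> n))) \<longlonglongrightarrow> phi M z - \<i> * complex_of_real (z * \<beta>)"
      by (intro tendsto_diff tendsto_mult tendsto_of_real tendsto_const phi_lim beta_lim)
    from LIMSEQ_Suc[OF this] show ?thesis
      by (simp add: w_eq \<psi>_eq mult.commute)
  qed
  have roots: "\<exists>\<nu>. real_distribution \<nu> \<and> char \<nu> = (\<lambda>z. exp (- (\<psi> z / k)))" if "(1 :: nat) \<le> k" for k
  proof (rule exp_limit_root_is_char[where F="\<lambda>n. F (Suc n)" and a="\<lambda>n. a (Suc n)", OF _ _ _ _ _ that])
    show "real_distribution (F (Suc n))" for n by (intro F) simp
    show "filterlim (\<lambda>n. a (Suc n)) at_top sequentially"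
      by (rule filterlim_compose[OF a_lim filterlim_Suc])
    show "(\<lambda>n. complex_of_real (real (a (Suc n))) * (1 - char (F (Suc n)) z)) \<longlonglongrightarrow> \<psi> z" for z
      using w_lim unfolding w_def .
    show "isCont \<psi> 0"
      unfolding \<psi>_eq[abs_def] by (intro continuous_intros isCont_phi canonical)
    show "0 \<le> Re (\<psi> z)" for z unfolding Re_\<psi> by (rule Re_phi_nonneg[OF canonical])
  qed
  obtain \<mu> where \<mu>: "real_distribution \<mu>" and char_\<mu>: "char \<mu> = (\<lambda>z. exp (- \<psi> z))"
    using roots[of 1] by auto
  have char_sum: "char (distr (P n) borel (row_sum a b \<xi> n)) z = char (\<theta> n) (z / b n) ^ a n" if "n \<ge> 1" for n z
    unfolding char_\<theta> using that by (intro char_row_sum[OF iid] row)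
  have sum_dist: "real_distribution (distr (P n) borel (row_sum a b \<xi> n))" if "n \<ge> 1" for n
    using that by (intro real_distribution_row_sum[OF iid] row)
  have \<psi>_Re_nonneg: "0 \<le> Re (\<psi> z)" for z
    unfolding Re_\<psi> by (rule Re_phi_nonneg[OF canonical])

  define N where "N = char_tail_sup (theta P \<xi>) \<delta>"
  have N_le: "cmod (char (\<theta> n) t) \<le> N" if "n \<ge> 1" "\<delta> \<le> \<bar>t\<bar>" for n t
  proof -
    have "(\<lambda>(n, z). cmod (theta P \<xi> n z)) (n, t) \<le> N"
      unfolding N_def char_tail_sup_def
    proof (rule cSUP_upper)
      show "bdd_above ((\<lambda>(n, z). cmod (theta P \<xi> n z)) ` {(n, z). 1 \<le> n \<and> \<delta> \<le> \<bar>z\<bar>})"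
        using real_distribution.cmod_char_le_1[OF \<theta>] unfolding char_\<theta>
        by (intro bdd_aboveI[of _ 1]) auto
    qed (use that in auto)
    then show ?thesis by (simp add: char_\<theta>)
  qed
  have N0: "0 \<le> N" using N_le[of 1 \<delta>] order.trans[OF norm_ge_zero] delta by simp
  have N1: "N < 1" using C delta unfolding N_def by blast
  define g0 where "g0 = (INF (n, z)\<in>{(n, z). n \<ge> 1 \<and> \<bar>z\<bar> \<le> \<delta>}. \<bar>Re (theta P \<xi> n z)\<bar>)"
  have g0_pos: "g0 > 0" unfolding g0_def using G .
  have g0_le: "g0 \<le> Re (char (\<theta> n) t)" if n: "n \<ge> 1" and t: "\<bar>t\<bar> \<le> \<delta>" for n t
  proof (rule Re_char_bounded_below[OF \<theta>[OF n] g0_pos _ t])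
    fix s :: real assume s: "\<bar>s\<bar> \<le> \<delta>"
    have "g0 \<le> (\<lambda>(n, z). \<bar>Re (theta P \<xi> n z)\<bar>) (n, s)"
      unfolding g0_def by (rule cINF_lower) (use n s in \<open>auto intro!: bdd_belowI[of _ 0]\<close>)
    then show "g0 \<le> \<bar>Re (char (\<theta> n) s)\<bar>" by (simp add: char_\<theta>)
  qed
  obtain r0 where r0: "r0 > 0" and gap: "\<And>n t. n \<ge> 1 \<Longrightarrow> \<bar>t\<bar> \<le> \<delta> \<Longrightarrow>
      r0 * (1 - Re (char (\<theta> n) t)) \<le> 1 - (cmod (char (\<theta> n) t))\<^sup>2"
  proof -
    from one_minus_Re_char_comparison[OF delta g0_pos N0 N1]
    obtain r0 where r0: "r0 > 0" and r0_gap: "\<forall>\<mu>. real_distribution \<mu> \<longrightarrow>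
        (\<forall>t. \<delta> \<le> \<bar>t\<bar> \<longrightarrow> cmod (char \<mu> t) \<le> N) \<longrightarrow> (\<forall>t. \<bar>t\<bar> \<le> \<delta> \<longrightarrow> g0 \<le> Re (char \<mu> t)) \<longrightarrow>
        (\<forall>t. \<bar>t\<bar> \<le> \<delta> \<longrightarrow> r0 * (1 - Re (char \<mu> t)) \<le> 1 - (cmod (char \<mu> t))\<^sup>2)"
      by (elim exE conjE)
    have "r0 * (1 - Re (char (\<theta> n) t)) \<le> 1 - (cmod (char (\<theta> n) t))\<^sup>2" if "n \<ge> 1" "\<bar>t\<bar> \<le> \<delta>" for n t
      using r0_gap[rule_format, OF \<theta>[OF that(1)] N_le[OF that(1)] g0_le[OF that(1)] that(2)] .
    then show ?thesis using that r0 by blast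
  qed

  \<comment> \<open>Both alternatives of (F), and (B), give the same lower bound for the real parts of the exponents
    once \<open>\<bar>z\<bar> \<ge> R \<ge> 1\<close>, where the smaller of the two powers is the weaker bound. \<open>E\<close> is a minorant with a
    constant small enough to survive the passage from \<open>1 - Re\<close> to the modulus.\<close>
  obtain \<alpha> cB R0 where \<alpha>_in: "\<alpha> \<in> {0<..<2}" and cB: "cB > 0"
    and B_all: "\<forall>z. \<bar>z\<bar> \<ge> R0 \<longrightarrow> Re (psi \<beta> M z) \<ge> cB * \<bar>z\<bar> powr \<alpha>"
    using B by blast
  have \<alpha>: "0 < \<alpha>" "\<alpha> < 2" using \<alpha>_in by simp_all
  have B': "cB * \<bar>z\<bar> powr \<alpha> \<le> Re (\<psi> z)" if "R0 \<le> \<bar>z\<bar>" for z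
    using B_all that unfolding \<psi>_def by blast
  obtain cF \<kappa> where cF: "cF > 0" and \<kappa>_in: "\<kappa> \<in> {0<..<2}"
    and F_all: "\<forall>n\<ge>1. (\<forall>z. \<bar>z\<bar> \<le> \<delta> * b n \<longrightarrow>
          real (a n) * (LINT u|symmetrization (F_law P b \<xi> n). 1 - cos (z * u)) \<ge> cF * \<bar>z\<bar> powr \<kappa>) \<or>
        (\<forall>A\<in>sets borel. emeasure (symmetrization M) A
            \<le> emeasure (symmetrization (M_array P a b \<xi> n)) A)"
    using assms(16) by blast
  have \<kappa>: "0 < \<kappa>" "\<kappa> < 2" using \<kappa>_in by simp_all
  have F_n: "(\<forall>z. \<bar>z\<bar> \<le> \<delta> * b n \<longrightarrow>
          real (a n) * (LINT u|symmetrization (F_law P b \<xi> n). 1 - cos (z * u)) \<ge> cF * \<bar>z\<bar> powr \<kappa>) \<or>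
        (\<forall>A\<in>sets borel. emeasure (symmetrization M) A
            \<le> emeasure (symmetrization (M_array P a b \<xi> n)) A)" if "n \<ge> 1" for n
    using F_all that by blast
  define R where "R = max R0 1"
  define k0 where "k0 = min \<alpha> \<kappa>"
  define cm where "cm = min cB cF"
  define c0 where "c0 = min (r0 / 2) 1 * cm"
  have k0: "k0 > 0" using \<alpha> \<kappa> unfolding k0_def by simp
  have cm: "cm > 0" using cB cF unfolding cm_def by simp
  have c0: "c0 > 0" "c0 \<le> cm" "c0 \<le> r0 / 2 * cm"
    using r0 cm unfolding c0_def by (auto simp: mult_left_le_one_le intro: mult_right_mono)
  define E where "E z = (if \<bar>z\<bar> < R then 0 else c0 * \<bar>z\<bar> powr k0)" for z
  have E0: "0 \<le> E z" for z using c0 unfolding E_def by simp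
  have \<psi>_lower: "cm * \<bar>z\<bar> powr k0 \<le> Re (\<psi> z)" if "R \<le> \<bar>z\<bar>" for z
  proof -
    have "cm * \<bar>z\<bar> powr k0 \<le> cB * \<bar>z\<bar> powr \<alpha>"
      using that cm \<alpha> cB unfolding cm_def k0_def R_def by (intro mult_mono powr_mono) auto
    also have "\<dots> \<le> Re (\<psi> z)" using that by (intro B') (simp add: R_def)
    finally show ?thesis .
  qed
  have w_lower: "cm * \<bar>z\<bar> powr k0 \<le> Re (w n z)" if n: "n \<ge> 1" and z: "R \<le> \<bar>z\<bar>" "\<bar>z\<bar> \<le> \<delta> * b n" for n z
    using F_n[OF n]
  proof
    assume "\<forall>z. \<bar>z\<bar> \<le> \<delta> * b n \<longrightarrow>
          real (a n) * (LINT u|symmetrization (F_law P b \<xi> n). 1 - cos (z * u)) \<ge> cF * \<bar>z\<bar> powr \<kappa>"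
    then have "cF * \<bar>z\<bar> powr \<kappa> \<le> real (a n) * (LINT u|symmetrization (F n). 1 - cos (z * u))"
      using z(2) unfolding F_def by blast
    then have "cF * \<bar>z\<bar> powr \<kappa> \<le> real (a n) * (1 - Re (char (F n) z))"
      unfolding integral_symmetrization_cos[OF F[OF n]] .
    moreover have "cm * \<bar>z\<bar> powr k0 \<le> cF * \<bar>z\<bar> powr \<kappa>"
      using z(1) cm \<kappa> cF unfolding cm_def k0_def R_def by (intro mult_mono powr_mono) auto
    ultimately show ?thesis by (simp add: w_def)
  next
    assume "\<forall>A\<in>sets borel. emeasure (symmetrization M) A \<le> emeasure (symmetrization (M_array P a b \<xi> n)) A"
    then have "Re (phi M z) \<le> Re (phi (Ms n) z)"
      unfolding Ms_def[symmetric] by (intro Re_phi_mono[OF canonical Ms[OF n]]) auto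
    then show ?thesis using \<psi>_lower[OF z(1)] Re_w[OF n] Re_\<psi> by simp
  qed
  have E_le_\<psi>: "E z \<le> Re (\<psi> z)" for z
  proof (cases "\<bar>z\<bar> < R")
    case False
    have "c0 * \<bar>z\<bar> powr k0 \<le> cm * \<bar>z\<bar> powr k0" using c0 by (intro mult_right_mono) auto
    then show ?thesis using False \<psi>_lower[of z] by (simp add: E_def)
  qed (simp add: E_def \<psi>_Re_nonneg)
  have F_decay: "cmod (char (F n) z) \<le> exp (- E z / a n)" if n: "n \<ge> 1" and z: "\<bar>z\<bar> \<le> \<delta> * b n" for n z
  proof (cases "\<bar>z\<bar> < R")
    case True
    then show ?thesis using real_distribution.cmod_char_le_1[OF F[OF n]] by (simp add: E_def)
  next
    case False
    have a0: "real (a n) > 0" using row(1)[OF n] by simp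
    have zb: "\<bar>z / b n\<bar> \<le> \<delta>" using z row(2)[OF n] by (simp add: field_simps)
    have "E z \<le> r0 / 2 * cm * \<bar>z\<bar> powr k0"
      using False mult_right_mono[OF c0(3), of "\<bar>z\<bar> powr k0"] by (simp add: E_def)
    also have "\<dots> \<le> r0 / 2 * Re (w n z)"
      using w_lower[OF n _ z] False r0 by (simp only: mult.assoc) (intro mult_left_mono, auto)
    finally have "E z / a n \<le> r0 / 2 * Re (w n z) / a n"
      using a0 by (intro divide_right_mono) auto
    also have "\<dots> = r0 * (1 - Re (char (F n) z)) / 2"
      using a0 by (simp add: w_def)
    finally have E_a: "- (r0 * (1 - Re (char (F n) z))) / 2 \<le> - E z / a n" by simp
    have "cmod (char (F n) z) \<le> exp (- (r0 * (1 - Re (char (F n) z))) / 2)"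
      unfolding char_F[OF n] by (intro norm_le_exp_of_gap gap[OF n zb])
    also have "\<dots> \<le> exp (- E z / a n)" using E_a by simp
    finally show ?thesis .
  qed
  obtain K where K: "K \<ge> 0" and K_le: "\<And>z. (1 + z\<^sup>2) ^ 3 * exp (- E z / 2) \<le> K"
  proof -
    obtain K1 where K1: "K1 \<ge> 0" "\<And>z. (1 + z\<^sup>2) ^ 3 * exp (- (c0 / 2 * \<bar>z\<bar> powr k0)) \<le> K1"
      using polynomial_times_exp_powr_bounded[of "c0 / 2" k0] c0 k0 by auto
    show ?thesis
    proof (rule that[of "(1 + R\<^sup>2) ^ 3 + K1"])
      show "0 \<le> (1 + R\<^sup>2) ^ 3 + K1" using K1 by simp
      fix z
      show "(1 + z\<^sup>2) ^ 3 * exp (- E z / 2) \<le> (1 + R\<^sup>2) ^ 3 + K1"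
      proof (cases "\<bar>z\<bar> < R")
        case True
        then have "z\<^sup>2 \<le> R\<^sup>2" using power_mono[of "\<bar>z\<bar>" R 2] by simp
        then have "(1 + z\<^sup>2) ^ 3 \<le> (1 + R\<^sup>2) ^ 3" by (intro power_mono) auto
        moreover have "(1 + z\<^sup>2) ^ 3 * exp (- E z / 2) = (1 + z\<^sup>2) ^ 3"
          using True by (simp add: E_def)
        ultimately show ?thesis using K1(1) by linarith
      next
        case False
        then have "(1 + z\<^sup>2) ^ 3 * exp (- E z / 2) \<le> K1" using K1(2)[of z] by (simp add: E_def)
        moreover have "0 \<le> (1 + R\<^sup>2) ^ 3" by simp
        ultimately show ?thesis by linarith
      qed
    qed
  qed
  have exp_le: "exp (- E z / 2) \<le> K / (1 + z\<^sup>2) ^ 3" for z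
  proof -
    have "0 < (1 + z\<^sup>2) ^ 3" by (simp add: add_pos_nonneg)
    then show ?thesis using K_le[of z] by (simp add: field_simps)
  qed
  have \<Phi>_le: "cmod (exp (- \<psi> z)) \<le> K / (1 + z\<^sup>2) ^ 3" for z
  proof -
    have "- Re (\<psi> z) \<le> - E z / 2" using E_le_\<psi>[of z] E0[of z] by linarith
    then have "cmod (exp (- \<psi> z)) \<le> exp (- E z / 2)" by simp
    then show ?thesis using exp_le[of z] by (rule order.trans)
  qed

  have int_\<mu>: "integrable lborel (char \<mu>)"
  proof (rule Bochner_Integration.integrable_bound)
    show "integrable lborel (\<lambda>z. K * (1 / (1 + z\<^sup>2)))"
      by (intro integrable_mult_right integrable_inverse_1_plus_square_lborel)
    show "char \<mu> \<in> borel_measurable lborel"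
      using real_distribution.char_measurable[OF \<mu>] by simp
    show "AE z in lborel. norm (char \<mu> z) \<le> norm (K * (1 / (1 + z\<^sup>2)))"
    proof (rule AE_I2)
      fix z :: real
      have "(1 + z\<^sup>2) ^ 1 \<le> (1 + z\<^sup>2) ^ 3" by (intro power_increasing) auto
      then have "K / (1 + z\<^sup>2) ^ 3 \<le> K / (1 + z\<^sup>2)"
        using K by (intro divide_left_mono mult_pos_pos) (auto simp: add_pos_nonneg)
      then have "cmod (char \<mu> z) \<le> K / (1 + z\<^sup>2)" using \<Phi>_le[of z] char_\<mu> by simp
      then show "norm (char \<mu> z) \<le> norm (K * (1 / (1 + z\<^sup>2)))" using K by simp
    qed
  qed
  obtain p where p: "inversion_density \<mu> p" using exists_inversion_density[OF \<mu> int_\<mu>] by blast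
  have weak: "weak_conv_m (\<lambda>n. distr (P n) borel (row_sum a b \<xi> n)) \<mu>"
  proof -
    have "weak_conv_m (\<lambda>n. distr (P (Suc n)) borel (row_sum a b \<xi> (Suc n))) \<mu>"
    proof (rule levy_continuity)
      show "real_distribution (distr (P (Suc n)) borel (row_sum a b \<xi> (Suc n)))" for n
        by (intro sum_dist) simp
      show "real_distribution \<mu>" by fact
      fix z
      have "\<forall>\<^sub>F n in sequentially. cmod (char (distr (P (Suc n)) borel (row_sum a b \<xi> (Suc n))) z - exp (- \<psi> z))
          \<le> cmod (w (Suc n) z - \<psi> z) + (cmod (\<psi> z))\<^sup>2 / a (Suc n)"
        using filterlim_compose[OF a_lim filterlim_Suc, unfolded filterlim_at_top, rule_format, of 2]
      proof eventually_elim
        case (elim n)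
        have eq: "1 - w (Suc n) z / a (Suc n) = char (F (Suc n)) z"
          using elim by (simp add: w_def)
        have "cmod ((1 - w (Suc n) z / a (Suc n)) ^ a (Suc n) - exp (- \<psi> z))
            \<le> (cmod (w (Suc n) z - \<psi> z) + (cmod (\<psi> z))\<^sup>2 / a (Suc n)) * exp (- 0 / 2)"
        proof (rule power_minus_exp_le[OF elim order.refl \<psi>_Re_nonneg])
          show "cmod (1 - w (Suc n) z / a (Suc n)) \<le> exp (- 0 / real (a (Suc n)))"
            using real_distribution.cmod_char_le_1[OF F, of "Suc n" z] eq by simp
        qed
        then show ?case unfolding eq by (simp add: char_sum char_F)
      qed
      moreover have "(\<lambda>n. cmod (w (Suc n) z - \<psi> z) + (cmod (\<psi> z))\<^sup>2 / a (Suc n)) \<longlonglongrightarrow> 0"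
      proof -
        have "(\<lambda>n. (cmod (\<psi> z))\<^sup>2 * inverse (real (a (Suc n)))) \<longlonglongrightarrow> (cmod (\<psi> z))\<^sup>2 * 0"
          by (rule tendsto_mult_left[OF tendsto_inverse_0_at_top[OF filterlim_compose[OF filterlim_real_sequentially
            filterlim_compose[OF a_lim filterlim_Suc]]]])
        from tendsto_add[OF tendsto_norm_zero[OF LIM_zero[OF w_lim]] this] show ?thesis
          by (simp only: divide_inverse mult_zero_right add_0_right)
      qed
      ultimately have "(\<lambda>n. char (distr (P (Suc n)) borel (row_sum a b \<xi> (Suc n))) z - exp (- \<psi> z)) \<longlonglongrightarrow> 0"
        by (rule Lim_null_comparison)
      then show "(\<lambda>n. char (distr (P (Suc n)) borel (row_sum a b \<xi> (Suc n))) z) \<longlonglongrightarrow> char \<mu> z"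
        unfolding char_\<mu> by (rule LIM_zero_cancel)
    qed
    then show ?thesis
      unfolding weak_conv_m_def weak_conv_def by (auto intro: LIMSEQ_imp_Suc)
  qed

  obtain G2 where G2: "G2 \<ge> 0" and G2_le: "\<And>n. n \<ge> 1 \<Longrightarrow> (\<integral>\<^sup>+t. ennreal ((cmod (char (\<theta> n) t))\<^sup>2) \<partial>lborel) \<le> ennreal G2"
  proof -
    define S where "S = (SUP n\<in>{1..}. \<integral>\<^sup>+x. ennreal ((g n x)\<^sup>2) \<partial>lborel)"
    have S: "S = ennreal (enn2real S)" using D unfolding S_def[symmetric] by simp
    have "(\<integral>\<^sup>+t. ennreal ((cmod (char (\<theta> n) t))\<^sup>2) \<partial>lborel) \<le> ennreal (2 * pi * enn2real S)" if n: "n \<ge> 1" for n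
    proof -
      have g: "\<And>x. 0 \<le> g n x" "distributed (P n) lborel (\<xi> 1 n) (\<lambda>x. ennreal (g n x))" using A n by auto
      then have "(\<lambda>x. ennreal (g n x)) \<in> borel_measurable borel" by (simp add: distributed_def)
      then have "(\<lambda>x. enn2real (ennreal (g n x))) \<in> borel_measurable borel" by measurable
      then have meas: "g n \<in> borel_measurable borel" using g(1) by simp
      have "\<theta> n = density lborel (\<lambda>x. ennreal (g n x))"
        unfolding \<theta>_def using distributed_distr_eq_density[OF g(2)] by (simp add: distr_lborel)
      then have "(\<integral>\<^sup>+t. ennreal ((cmod (char (\<theta> n) t))\<^sup>2) \<partial>lborel) \<le> ennreal (2 * pi) * (\<integral>\<^sup>+x. ennreal ((g n x)\<^sup>2) \<partial>lborel)"
        by (rule nn_integral_norm_char_square_le[OF meas g(1) _ \<theta>[OF n]])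
      also have "\<dots> \<le> ennreal (2 * pi) * S"
        unfolding S_def using n by (intro mult_left_mono SUP_upper) auto
      also have "\<dots> = ennreal (2 * pi * enn2real S)"
        by (subst S) (simp add: ennreal_mult)
      finally show ?thesis .
    qed
    then show ?thesis using that[of "2 * pi * enn2real S"] by simp
  qed

  obtain K\<^sub>\<phi> where K\<^sub>\<phi>: "K\<^sub>\<phi> \<ge> 0" "\<And>z. cmod (phi M z) \<le> K\<^sub>\<phi> * (1 + z\<^sup>2)"
    using norm_phi_le[OF canonical] by blast
  have abs_le: "\<bar>z\<bar> \<le> 1 + z\<^sup>2" for z :: real
  proof -
    have "2 * \<bar>z\<bar> \<le> 1 + z\<^sup>2" using sum_squares_bound[of 1 "\<bar>z\<bar>"] by simp
    then show ?thesis using abs_ge_zero[of z] by linarith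
  qed
  define H where "H = \<bar>\<beta>\<bar> + K\<^sub>\<phi>"
  have H: "H \<ge> 0" "cmod (\<psi> z) \<le> H * (1 + z\<^sup>2)" for z
  proof -
    show "H \<ge> 0" using K\<^sub>\<phi> unfolding H_def by simp
    have "cmod (\<psi> z) \<le> cmod (- \<i> * complex_of_real (\<beta> * z)) + cmod (phi M z)"
      unfolding \<psi>_eq by (rule norm_triangle_ineq)
    also have "cmod (- \<i> * complex_of_real (\<beta> * z)) = \<bar>\<beta>\<bar> * \<bar>z\<bar>"
      by (simp only: norm_mult norm_of_real abs_mult norm_minus_cancel norm_ii mult_1_left)
    also have "\<bar>\<beta>\<bar> * \<bar>z\<bar> + cmod (phi M z) \<le> \<bar>\<beta>\<bar> * (1 + z\<^sup>2) + K\<^sub>\<phi> * (1 + z\<^sup>2)"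
      by (intro add_mono mult_left_mono abs_le K\<^sub>\<phi>) simp
    finally show "cmod (\<psi> z) \<le> H * (1 + z\<^sup>2)" by (simp add: H_def distrib_right)
  qed
  have \<rho>_ge: "drift n \<le> \<rho> n" "gamma_Re M (Ms n) \<le> \<rho> n" "gamma_Im M (Ms n) \<le> \<rho> n" "1 / real (a n) \<le> \<rho> n"
      "exp (real (a n) * (ln N + \<epsilon>)) \<le> \<rho> n" for n
    unfolding \<rho>_def rho_def drift_def Ms_def N_def by (rule Max_ge; simp)+
  have \<rho>0: "0 \<le> \<rho> n" for n using \<rho>_ge(4)[of n] by (rule order.trans[rotated]) simp
  have gamma: "\<bar>Re (phi M z) - Re (phi (Ms n) z)\<bar> \<le> \<rho> n * (1 + z\<^sup>2)"
      "\<bar>Im (phi M z) - Im (phi (Ms n) z)\<bar> \<le> \<rho> n * (1 + z\<^sup>2)" if n: "n \<ge> 1" for n z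
  proof -
    obtain K' where K': "\<And>z. cmod (phi (Ms n) z) \<le> K' * (1 + z\<^sup>2)"
      using norm_phi_le[OF Ms[OF n]] by blast
    have pos: "0 < 1 + z\<^sup>2" for z :: real by (simp add: add_pos_nonneg)
    have diff: "cmod (phi M z - phi (Ms n) z) \<le> (K\<^sub>\<phi> + K') * (1 + z\<^sup>2)" for z
      using norm_triangle_ineq4[of "phi M z" "phi (Ms n) z"] K\<^sub>\<phi>(2)[of z] K'[of z] by (simp add: distrib_right)
    have bdd: "\<bar>Re (phi M z) - Re (phi (Ms n) z)\<bar> / (1 + z\<^sup>2) \<le> K\<^sub>\<phi> + K'"
      "\<bar>Im (phi M z) - Im (phi (Ms n) z)\<bar> / (1 + z\<^sup>2) \<le> K\<^sub>\<phi> + K'" for z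
      using abs_Re_le_cmod[of "phi M z - phi (Ms n) z"] abs_Im_le_cmod[of "phi M z - phi (Ms n) z"] diff[of z] pos[of z]
      by (auto simp: divide_le_eq)
    have "\<bar>Re (phi M z) - Re (phi (Ms n) z)\<bar> / (1 + z\<^sup>2) \<le> gamma_Re M (Ms n)"
      unfolding gamma_Re_def using bdd by (intro cSUP_upper bdd_aboveI[of _ "K\<^sub>\<phi> + K'"]) auto
    then have "\<bar>Re (phi M z) - Re (phi (Ms n) z)\<bar> / (1 + z\<^sup>2) \<le> \<rho> n" using \<rho>_ge(2) by (rule order.trans)
    then show "\<bar>Re (phi M z) - Re (phi (Ms n) z)\<bar> \<le> \<rho> n * (1 + z\<^sup>2)" using pos[of z] by (simp add: divide_le_eq)
    have "\<bar>Im (phi M z) - Im (phi (Ms n) z)\<bar> / (1 + z\<^sup>2) \<le> gamma_Im M (Ms n)"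
      unfolding gamma_Im_def using bdd by (intro cSUP_upper bdd_aboveI[of _ "K\<^sub>\<phi> + K'"]) auto
    then have "\<bar>Im (phi M z) - Im (phi (Ms n) z)\<bar> / (1 + z\<^sup>2) \<le> \<rho> n" using \<rho>_ge(3) by (rule order.trans)
    then show "\<bar>Im (phi M z) - Im (phi (Ms n) z)\<bar> \<le> \<rho> n * (1 + z\<^sup>2)" using pos[of z] by (simp add: divide_le_eq)
  qed
  have w_\<psi>: "cmod (w n z - \<psi> z) \<le> 3 * \<rho> n * (1 + z\<^sup>2)" if n: "n \<ge> 1" for n z
  proof -
    have "w n z - \<psi> z = (phi (Ms n) z - phi M z) - \<i> * complex_of_real (z * (real (a n) * beta_array P b \<xi> n - \<beta>))"
      unfolding w_eq[OF n] \<psi>_eq by (simp add: algebra_simps)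
    then have "cmod (w n z - \<psi> z) \<le> cmod (phi (Ms n) z - phi M z) + cmod (\<i> * complex_of_real (z * (real (a n) * beta_array P b \<xi> n - \<beta>)))"
      by (simp only: norm_triangle_ineq4)
    also have "cmod (\<i> * complex_of_real (z * (real (a n) * beta_array P b \<xi> n - \<beta>))) = \<bar>z\<bar> * drift n"
      by (simp only: norm_mult norm_of_real abs_mult norm_ii mult_1_left drift_def)
    also have "\<dots> \<le> (1 + z\<^sup>2) * \<rho> n"
      using abs_le \<rho>_ge(1) \<rho>0 by (intro mult_mono) (auto simp: drift_def)
    also have "cmod (phi (Ms n) z - phi M z) \<le> \<bar>Re (phi M z) - Re (phi (Ms n) z)\<bar> + \<bar>Im (phi M z) - Im (phi (Ms n) z)\<bar>"
      using cmod_le[of "phi (Ms n) z - phi M z"] by (simp add: abs_minus_commute)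
    also have "\<dots> \<le> \<rho> n * (1 + z\<^sup>2) + \<rho> n * (1 + z\<^sup>2)" by (intro add_mono gamma n)
    finally show ?thesis by (simp add: algebra_simps)
  qed

  \<comment> \<open>\<open>Q\<close> is the constant of the quadratic gap, and \<open>a n \<le> L * (b n)\<^sup>2\<close> in all late rows. If \<open>N = 0\<close> the tail of
    the power vanishes; \<open>N'\<close> only keeps the constant \<open>C2\<close> meaningful in that case.\<close>
  define Q where "Q = (1 - N\<^sup>2) / (4 * \<delta>\<^sup>2)"
  have "N\<^sup>2 < 1" using N0 N1 by (simp add: abs_square_less_1)
  then have Q: "Q > 0" unfolding Q_def using delta by simp
  define L where "L = 2 * (Re (phi M 1) + 1) / Q"
  define N' where "N' = (if N = 0 then 1 else N)"
  define C1 where "C1 = K * (3 + H\<^sup>2) + K * L / \<delta>\<^sup>2"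
  define C2 where "C2 = G2 / N'\<^sup>2"
  define I1 where "I1 = (LINT z|lborel. 1 / (1 + z\<^sup>2 :: real))"
  define pn where "pn n = (SOME q. inversion_density (distr (P n) borel (row_sum a b \<xi> n)) q)" for n
  have "\<forall>\<^sub>F n in sequentially. 1 \<le> n \<and> 3 \<le> a n \<and> 1 / \<delta> \<le> b n \<and> ln (b n) / a n < \<epsilon> \<and> Re (phi (Ms n) 1) < Re (phi M 1) + 1"
    using a_lim E eps(1) unfolding filterlim_at_top
    by (intro eventually_conj eventually_ge_at_top order_tendstoD(2)[OF E(2)] order_tendstoD(2)[OF tendsto_Re[OF phi_lim]]) auto
  then have main: "\<forall>\<^sub>F n in sequentially.
      inversion_density (distr (P n) borel (row_sum a b \<xi> n)) (pn n) \<and>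
      (\<forall>x. \<bar>pn n x - p x\<bar> \<le> ((C1 * I1 + C2) / (2 * pi) + 1) * \<rho> n)"
  proof eventually_elim
    case (elim n)
    then have n: "n \<ge> 1" and a3: "a n \<ge> 3" and b\<delta>: "1 / \<delta> \<le> b n" and lnb: "ln (b n) / a n < \<epsilon>"
      and Re1: "Re (phi (Ms n) 1) < Re (phi M 1) + 1" by auto
    have b0: "b n > 0" by (rule row(2)[OF n])
    have a0: "real (a n) > 0" using a3 by simp
    define \<Phi> where "\<Phi> z = char (\<theta> n) (z / b n) ^ a n" for z
    have \<Phi>_char: "char (distr (P n) borel (row_sum a b \<xi> n)) = \<Phi>"
      by (rule ext) (simp add: \<Phi>_def char_sum[OF n])
    have tails: "integrable lborel \<Phi>"
        "(LINT z|lborel. indicator {z. \<delta> * b n < \<bar>z\<bar>} z * cmod (\<Phi> z)) \<le> b n * N ^ (a n - 2) * G2"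
      using char_power_tail[OF \<theta>[OF n] G2_le[OF n] G2 b0 N0 N_le[OF n], of \<delta> "a n"] a3
      unfolding \<Phi>_def by auto
    \<comment> \<open>The gap at \<open>t = 1 / b n\<close>, multiplied by \<open>a n\<close>, is bounded by \<open>2 * Re (w n 1)\<close>, which converges.\<close>
    have a_b: "real (a n) \<le> L * (b n)\<^sup>2"
    proof -
      have "\<bar>1 / b n\<bar> \<le> \<delta>" using b\<delta> b0 delta by (simp add: field_simps)
      then have "Q * (1 / b n)\<^sup>2 \<le> 1 - (cmod (char (\<theta> n) (1 / b n)))\<^sup>2"
        unfolding Q_def by (intro char_quadratic_gap[OF \<theta>[OF n] delta N_le[OF n]])
      also have "\<dots> \<le> 2 * (1 - Re (char (\<theta> n) (1 / b n)))"
        by (rule one_minus_norm_square_le[OF \<theta>[OF n]])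
      finally have "real (a n) * (Q * (1 / b n)\<^sup>2) \<le> real (a n) * (2 * (1 - Re (char (\<theta> n) (1 / b n))))"
        by (rule mult_left_mono) simp
      also have "\<dots> = 2 * Re (w n 1)" by (simp add: w_def char_F[OF n])
      also have "\<dots> \<le> 2 * (Re (phi M 1) + 1)" using Re1 Re_w[OF n] by simp
      finally show ?thesis using Q b0 by (simp add: L_def field_simps power2_eq_square)
    qed
    have inv_z: "1 / (1 + z\<^sup>2) \<le> L / \<delta>\<^sup>2 * \<rho> n" if "\<delta> * b n < \<bar>z\<bar>" for z
    proof -
      have "(\<delta> * b n)\<^sup>2 \<le> \<bar>z\<bar>\<^sup>2" using that delta b0 by (intro power_mono) auto
      then have db: "\<delta>\<^sup>2 * (b n)\<^sup>2 \<le> 1 + z\<^sup>2" by (simp add: power_mult_distrib)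
      have L0: "0 < L" using a_b a0 b0 by (smt (verit) zero_less_mult_pos2 zero_less_power)
      have "\<delta>\<^sup>2 * real (a n) \<le> \<delta>\<^sup>2 * (L * (b n)\<^sup>2)" using a_b by (intro mult_left_mono) auto
      also have "\<dots> = L * (\<delta>\<^sup>2 * (b n)\<^sup>2)" by simp
      also have "\<dots> \<le> L * (1 + z\<^sup>2)" using L0 by (intro mult_left_mono[OF db]) simp
      finally have "\<delta>\<^sup>2 * real (a n) \<le> L * (1 + z\<^sup>2)" .
      then have "1 / (1 + z\<^sup>2) \<le> L / \<delta>\<^sup>2 * (1 / real (a n))"
        using delta a0 by (simp add: field_simps add_pos_nonneg)
      also have "\<dots> \<le> L / \<delta>\<^sup>2 * \<rho> n" using L0 by (intro mult_left_mono \<rho>_ge(4)) simp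
      finally show ?thesis .
    qed
    have L0: "0 \<le> L" using a_b a0 b0 by (smt (verit) zero_less_mult_pos2 zero_less_power)
    have C1: "K * (3 + H\<^sup>2) \<le> C1" "K * L / \<delta>\<^sup>2 \<le> C1" "0 \<le> C1"
      using K L0 unfolding C1_def by auto
    \<comment> \<open>The decay \<open>K / (1 + z\<^sup>2) ^ 3\<close> leaves an integrable \<open>1 / (1 + z\<^sup>2)\<close> after the quadratic growth of \<open>\<psi>\<close>
      has been squared.\<close>
    have pointwise: "cmod (\<Phi> z - exp (- \<psi> z))
        \<le> C1 * \<rho> n * (1 / (1 + z\<^sup>2)) + indicator {z. \<delta> * b n < \<bar>z\<bar>} z * cmod (\<Phi> z)" for z
    proof (cases "\<delta> * b n < \<bar>z\<bar>")
      case False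
      define q where "q = 1 + z\<^sup>2"
      have q: "q > 0" unfolding q_def by (simp add: add_pos_nonneg)
      have eq: "1 - w n z / a n = char (F n) z" using a0 by (simp add: w_def)
      have "cmod ((1 - w n z / a n) ^ a n - exp (- \<psi> z))
          \<le> (cmod (w n z - \<psi> z) + (cmod (\<psi> z))\<^sup>2 / a n) * exp (- E z / 2)"
        using F_decay[OF n, of z] False a3 by (intro power_minus_exp_le E0 E_le_\<psi>) (auto simp: eq)
      also have "\<dots> \<le> ((3 + H\<^sup>2) * \<rho> n * q\<^sup>2) * (K / q ^ 3)"
      proof (rule mult_mono)
        have "q ^ 1 \<le> q\<^sup>2" unfolding q_def by (rule power_increasing) auto
        then have "q \<le> q\<^sup>2" by simp
        then have "3 * \<rho> n * q \<le> 3 * \<rho> n * q\<^sup>2" using \<rho>0 by (intro mult_left_mono) auto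
        then have 1: "cmod (w n z - \<psi> z) \<le> 3 * \<rho> n * q\<^sup>2" using w_\<psi>[OF n, of z] unfolding q_def by linarith
        have "(cmod (\<psi> z))\<^sup>2 \<le> (H * q)\<^sup>2" using H(2)[of z] unfolding q_def by (intro power_mono) auto
        then have "(cmod (\<psi> z))\<^sup>2 * (1 / a n) \<le> (H * q)\<^sup>2 * \<rho> n"
          using \<rho>_ge(4)[of n] by (intro mult_mono) auto
        then have 2: "(cmod (\<psi> z))\<^sup>2 / a n \<le> H\<^sup>2 * \<rho> n * q\<^sup>2" by (simp add: power_mult_distrib mult_ac)
        show "cmod (w n z - \<psi> z) + (cmod (\<psi> z))\<^sup>2 / a n \<le> (3 + H\<^sup>2) * \<rho> n * q\<^sup>2"
          using 1 2 by (simp add: distrib_right)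
        show "exp (- E z / 2) \<le> K / q ^ 3" using exp_le[of z] unfolding q_def .
        show "0 \<le> (3 + H\<^sup>2) * \<rho> n * q\<^sup>2" using \<rho>0 by simp
      qed simp
      also have "\<dots> = K * (3 + H\<^sup>2) * (\<rho> n * (1 / q))"
        using q by (simp add: power2_eq_square power3_eq_cube)
      also have "\<dots> \<le> C1 * (\<rho> n * (1 / q))"
        using \<rho>0 q by (intro mult_right_mono C1) auto
      finally show ?thesis using False n by (simp add: \<Phi>_def eq char_F[OF n] q_def)
    next
      case True
      define q where "q = 1 + z\<^sup>2"
      have q: "q \<ge> 1" unfolding q_def by simp
      have "cmod (exp (- \<psi> z)) \<le> K / q ^ 3" using \<Phi>_le[of z] unfolding q_def .
      also have "\<dots> \<le> K / q\<^sup>2"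
        using q K by (intro divide_left_mono power_increasing) auto
      also have "\<dots> = K * (1 / q) * (1 / q)" by (simp add: power2_eq_square)
      also have "\<dots> \<le> K * (L / \<delta>\<^sup>2 * \<rho> n) * (1 / q)"
        using inv_z[OF True] K q unfolding q_def[symmetric] by (intro mult_right_mono mult_left_mono) auto
      also have "\<dots> = K * L / \<delta>\<^sup>2 * (\<rho> n * (1 / q))" by simp
      also have "\<dots> \<le> C1 * (\<rho> n * (1 / q))"
        using \<rho>0 q by (intro mult_right_mono C1) auto
      finally have "cmod (exp (- \<psi> z)) \<le> C1 * \<rho> n * (1 / q)" by simp
      then show ?thesis
        using True norm_triangle_ineq4[of "\<Phi> z" "exp (- \<psi> z)"] by (simp add: q_def)
    qed
    have tail_le: "b n * N ^ (a n - 2) * G2 \<le> C2 * \<rho> n"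
    proof (cases "N = 0")
      case True
      then show ?thesis using a3 G2 \<rho>0 by (simp add: C2_def N'_def power_0_left)
    next
      case False
      then have N: "N > 0" using N0 by simp
      have "ln (b n) \<le> \<epsilon> * a n" using lnb a0 by (simp add: divide_less_eq)
      then have "exp (ln (b n)) \<le> exp (\<epsilon> * a n)" by simp
      then have b_le: "b n \<le> exp (\<epsilon> * a n)" using b0 by simp
      have pow1: "N ^ a n = exp (a n * ln N)" using N by (simp add: exp_of_nat_mult)
      have pow2: "N ^ a n = N\<^sup>2 * N ^ (a n - 2)"
      proof -
        have "2 + (a n - 2) = a n" using a3 by simp
        with power_add[of N 2 "a n - 2"] show ?thesis by (simp only:)
      qed
      have "exp (a n * ln N) / N\<^sup>2 = N\<^sup>2 * N ^ (a n - 2) / N\<^sup>2"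
        unfolding pow1[symmetric] pow2[symmetric] ..
      also have "\<dots> = N ^ (a n - 2)" using N by simp
      finally have pow: "exp (a n * ln N) / N\<^sup>2 = N ^ (a n - 2)" .
      have "b n * N ^ (a n - 2) \<le> exp (\<epsilon> * a n) * (exp (a n * ln N) / N\<^sup>2)"
        unfolding pow by (rule mult_right_mono[OF b_le]) (use N in simp)
      also have "\<dots> = exp (real (a n) * (ln N + \<epsilon>)) / N\<^sup>2"
      proof -
        have "real (a n) * (ln N + \<epsilon>) = \<epsilon> * a n + a n * ln N" by (simp add: distrib_left)
        then show ?thesis by (simp only: exp_add times_divide_eq_right)
      qed
      also have "\<dots> \<le> \<rho> n / N\<^sup>2" by (rule divide_right_mono[OF \<rho>_ge(5)]) simp
      finally have "b n * N ^ (a n - 2) * G2 \<le> \<rho> n / N\<^sup>2 * G2" by (rule mult_right_mono[OF _ G2])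
      moreover have "C2 * \<rho> n = \<rho> n / N\<^sup>2 * G2" using False by (simp add: C2_def N'_def)
      ultimately show ?thesis by (simp only:)
    qed
    have dens: "inversion_density (distr (P n) borel (row_sum a b \<xi> n)) (pn n)"
    proof -
      have "integrable lborel (char (distr (P n) borel (row_sum a b \<xi> n)))"
        unfolding \<Phi>_char by (rule tails(1))
      from exists_inversion_density[OF sum_dist[OF n] this] show ?thesis
        unfolding pn_def by (rule someI_ex)
    qed
    have int_diff: "integrable lborel (\<lambda>z. \<Phi> z - exp (- \<psi> z))"
      using tails(1) int_\<mu> unfolding char_\<mu> by (rule Bochner_Integration.integrable_diff)
    have int_tail: "integrable lborel (\<lambda>z. indicator {z. \<delta> * b n < \<bar>z\<bar>} z * cmod (\<Phi> z))"
    proof (rule Bochner_Integration.integrable_bound[OF integrable_norm[OF tails(1)]])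
      show "(\<lambda>z. indicator {z. \<delta> * b n < \<bar>z\<bar>} z * cmod (\<Phi> z)) \<in> borel_measurable lborel"
        using borel_measurable_integrable[OF tails(1)] by measurable
    qed (auto simp: indicator_def)
    have L1: "(LINT z|lborel. cmod (\<Phi> z - exp (- \<psi> z))) \<le> (C1 * I1 + C2) * \<rho> n"
    proof -
      have "(LINT z|lborel. cmod (\<Phi> z - exp (- \<psi> z)))
          \<le> (LINT z|lborel. C1 * \<rho> n * (1 / (1 + z\<^sup>2)) + indicator {z. \<delta> * b n < \<bar>z\<bar>} z * cmod (\<Phi> z))"
        by (intro integral_mono integrable_norm int_diff Bochner_Integration.integrable_add int_tail integrable_mult_right
            integrable_inverse_1_plus_square_lborel pointwise)
      also have "\<dots> = C1 * \<rho> n * I1 + (LINT z|lborel. indicator {z. \<delta> * b n < \<bar>z\<bar>} z * cmod (\<Phi> z))"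
      proof -
        have "integrable lborel (\<lambda>z. C1 * \<rho> n * (1 / (1 + z\<^sup>2)))"
          by (intro integrable_mult_right integrable_inverse_1_plus_square_lborel)
        from Bochner_Integration.integral_add[OF this int_tail] show ?thesis
          by (simp only: integral_mult_right_zero I1_def)
      qed
      also have "\<dots> \<le> C1 * \<rho> n * I1 + C2 * \<rho> n"
        using tails(2) tail_le by simp
      finally show ?thesis by (simp add: algebra_simps)
    qed
    have "\<bar>pn n x - p x\<bar> \<le> ((C1 * I1 + C2) / (2 * pi) + 1) * \<rho> n" for x
    proof -
      have i1: "integrable lborel (\<lambda>z. iexp (- (z * x)) * f z)" if "integrable lborel f" for f :: "real \<Rightarrow> complex"
        by (rule Bochner_Integration.integrable_bound[OF that])
          (use borel_measurable_integrable[OF that] in \<open>auto simp: norm_mult\<close>)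
      have "complex_of_real (pn n x - p x)
          = (CLINT z|lborel. iexp (- (z * x)) * \<Phi> z) / (2 * pi) - (CLINT z|lborel. iexp (- (z * x)) * exp (- \<psi> z)) / (2 * pi)"
        using dens p unfolding inversion_density_def \<Phi>_char char_\<mu> by simp
      also have "\<dots> = (CLINT z|lborel. iexp (- (z * x)) * (\<Phi> z - exp (- \<psi> z))) / (2 * pi)"
      proof -
        have "(CLINT z|lborel. iexp (- (z * x)) * (\<Phi> z - exp (- \<psi> z)))
            = (CLINT z|lborel. iexp (- (z * x)) * \<Phi> z - iexp (- (z * x)) * exp (- \<psi> z))"
          by (simp only: right_diff_distrib)
        also have "\<dots> = (CLINT z|lborel. iexp (- (z * x)) * \<Phi> z) - (CLINT z|lborel. iexp (- (z * x)) * exp (- \<psi> z))"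
          by (rule Bochner_Integration.integral_diff[OF i1[OF tails(1)] i1[OF int_\<mu>[unfolded char_\<mu>]]])
        finally show ?thesis by (simp only: diff_divide_distrib)
      qed
      finally have diff: "complex_of_real (pn n x - p x)
          = (CLINT z|lborel. iexp (- (z * x)) * (\<Phi> z - exp (- \<psi> z))) / (2 * pi)" .
      have "\<bar>pn n x - p x\<bar> = cmod ((CLINT z|lborel. iexp (- (z * x)) * (\<Phi> z - exp (- \<psi> z))) / (2 * pi))"
        unfolding diff[symmetric] by (simp only: norm_of_real)
      also have "\<dots> = cmod (CLINT z|lborel. iexp (- (z * x)) * (\<Phi> z - exp (- \<psi> z))) / (2 * pi)"
        by (simp add: norm_divide)
      also have "\<dots> \<le> (LINT z|lborel. cmod (iexp (- (z * x)) * (\<Phi> z - exp (- \<psi> z)))) / (2 * pi)"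
        by (intro divide_right_mono integral_norm_bound) simp
      also have "\<dots> = (LINT z|lborel. cmod (\<Phi> z - exp (- \<psi> z))) / (2 * pi)"
        by (simp only: norm_mult norm_exp_i_times mult_1_left)
      also have "\<dots> \<le> (C1 * I1 + C2) * \<rho> n / (2 * pi)"
        by (intro divide_right_mono L1) simp
      also have "\<dots> \<le> ((C1 * I1 + C2) / (2 * pi) + 1) * \<rho> n"
        using \<rho>0[of n] by (simp add: distrib_right)
      finally show ?thesis .
    qed
    with dens show ?case by blast
  qed
  have L0: "0 \<le> L" using Q Re_phi_nonneg[OF canonical, of 1] unfolding L_def by simp
  have C_pos: "0 < (C1 * I1 + C2) / (2 * pi) + 1"
  proof -
    have "0 \<le> C1" "0 \<le> C2" "0 \<le> I1"
      using K L0 G2 unfolding C1_def C2_def I1_def by (auto intro!: integral_nonneg)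
    then have "0 \<le> (C1 * I1 + C2) / (2 * pi)" by simp
    then show ?thesis by linarith
  qed
  have part1: "\<forall>n\<ge>1. \<exists>q. distributed (P n) lborel (row_sum a b \<xi> n) q"
  proof (intro allI impI)
    fix n :: nat assume n: "1 \<le> n"
    have "distributed (P n) lborel (\<xi> 1 n) (\<lambda>x. ennreal (g n x))" using A n by blast
    then show "\<exists>q. distributed (P n) lborel (row_sum a b \<xi> n) q"
      by (rule distributed_row_sum[where a=a and b=b, OF iid n row(1)[OF n] row(2)[OF n]])
  qed
  have "infinitely_divisible \<mu>"
    by (rule infinitely_divisible_of_roots[OF \<mu> char_\<mu> roots])
  then have limit: "real_distribution \<mu> \<and> char \<mu> = (\<lambda>z. exp (- psi \<beta> M z)) \<and>
      weak_conv_m (\<lambda>n. distr (P n) borel (row_sum a b \<xi> n)) \<mu> \<and> infinitely_divisible \<mu> \<and> inversion_density \<mu> p"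
    using \<mu> char_\<mu> weak p unfolding \<psi>_def by (intro conjI)
  have "\<exists>pn. \<exists>C>0. \<forall>\<^sub>F n in sequentially.
        inversion_density (distr (P n) borel (row_sum a b \<xi> n)) (pn n) \<and>
        (\<forall>x. \<bar>pn n x - p x\<bar> \<le> C * rho P a b \<xi> M \<beta> \<epsilon> \<delta> n)"
    using C_pos main unfolding \<rho>_def by (intro exI conjI)
  with part1 limit show ?thesis by blast
qed

end
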